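(* Fix $L\ge1$ and $\mathbf q=(q_1,\dots,q_L)\in\mathbb N_0^L$. The leaf-decorated chain $\alpha_{L,\mathbf q}$ has $v=L+2+Q$ vertices, $d=L+1+Q$ edges, no isolated middle role (vertex outside $U\cup V$) and no detached component (component disjoint from $U\cup V$). Its minimum separator size is one, and its maximum active count over minimum separators is $q_{\max}$. Consequently, in the globally injective unordered-edge sign model, as $n\to\infty$, $$\mathbb E\|M_{\alpha_{L,\mathbf q}}\|\asymp_{L,\mathbf q}n^{(L+1+Q)/2}(\log n)^{q_{\max}/2}.$$ The same scale holds in the balanced typed model: $\mathbb E\|H_{\alpha_{L,\mathbf q}}\|\asymp n^{(L+1+Q)/2}(\log n)^{q_{\max}/2}$.
   Context: Leaf-decorated chain: $\alpha_{L,\mathbf q}$ consists of the path $x_0-x_1-\cdots-x_L-x_{L+1}$, with boundaries $U=(x_0)$ and $V=(x_{L+1})$, together with $q_j$ distinct leaves attached to $x_j$ for each $1\le j\le L$. $Q=\sum_jq_j$, $q_{\max}=\max_jq_j$. Write $W,E$ for its vertex and edge sets. Separators: $S\subseteq W$ is a separator if it meets every path from $U$ to $V$ (boundary vertices may belong to $S$). For a separator $S$, the active count is the number of connected components of $\alpha_{L,\mathbf q}-S$ disjoint from $U\cup V$ and adjacent to $S$. Minimum separators are those of minimum size. Globally injective model: with i.i.d. uniform signs $\xi_{\{i,j\}}$ over unordered pairs $\{i,j\}\subseteq[n]$, $M_\alpha[i,j]=\sum_\phi\prod_{\{x,y\}\in E}\xi_{\{\phi(x),\phi(y)\}}$, the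 sum over injective $\phi:W\to[n]$ with $\phi(x_0)=i$, $\phi(x_{L+1})=j$ ($0$ if there is none). Balanced typed model: each vertex $x\in W$ has its own label set $I_x$ with $c_xn\le|I_x|\le C_xn$ for fixed positive constants; each edge $e=\{x,y\}$ has its own array $\xi^e:I_x\times I_y\to\{-1,1\}$ of independent uniform signs, independent across edges. $H_\alpha$ has rows indexed by $I_{x_0}$ and columns by $I_{x_{L+1}}$, and its $(i,j)$ entry is the sum, over all labelings $x\mapsto\ell_x\in I_x$ with $\ell_{x_0}=i$, $\ell_{x_{L+1}}=j$ (no injectivity required), of $\prod_{e=\{x,y\}\in E}\xi^e(\ell_x,\ell_y)$. $\|\cdot\|$ is the operator norm. *)

theory Defs
  imports "HOL-Probability.Probability" "HOL-Probability.Product_PMF" "HOL-Library.Landau_Symbols"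
begin

text \<open>A finite simple graph is given by its vertex set \<open>W\<close> and its set \<open>E\<close> of unordered
  edges \<open>{x, y}\<close>; the boundaries \<open>U\<close>, \<open>V\<close> enter only through their sets of entries.\<close>

definition graph_path :: "'v set \<Rightarrow> 'v set set \<Rightarrow> 'v list \<Rightarrow> bool" where
  "graph_path W E p \<longleftrightarrow>
     p \<noteq> [] \<and> distinct p \<and> set p \<subseteq> W \<and> successively (\<lambda>x y. {x, y} \<in> E) p"

definition graph_components :: "'v set \<Rightarrow> 'v set set \<Rightarrow> 'v set set" where
  "graph_components W E =
     W // {(x, y). \<exists>p. graph_path W E p \<and> hd p = x \<and> last p = y}"

definition is_separator :: "'v set \<Rightarrow> 'v set set \<Rightarrow> 'v set \<Rightarrow> 'v set \<Rightarrow> 'v set \<Rightarrow> bool" where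
  "is_separator W E U V S \<longleftrightarrow>
     S \<subseteq> W \<and> (\<forall>p. graph_path W E p \<and> hd p \<in> U \<and> last p \<in> V \<longrightarrow> set p \<inter> S \<noteq> {})"

definition min_separator_size :: "'v set \<Rightarrow> 'v set set \<Rightarrow> 'v set \<Rightarrow> 'v set \<Rightarrow> nat" where
  "min_separator_size W E U V = Min (card ` {S. is_separator W E U V S})"

definition min_separators :: "'v set \<Rightarrow> 'v set set \<Rightarrow> 'v set \<Rightarrow> 'v set \<Rightarrow> 'v set set" where
  "min_separators W E U V =
     {S. is_separator W E U V S \<and> card S = min_separator_size W E U V}"

definition active_count :: "'v set \<Rightarrow> 'v set set \<Rightarrow> 'v set \<Rightarrow> 'v set \<Rightarrow> 'v set \<Rightarrow> nat" where
  "active_count W E U V S =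
     card {K \<in> graph_components (W - S) {e \<in> E. e \<inter> S = {}}.
             K \<inter> (U \<union> V) = {} \<and> (\<exists>x\<in>K. \<exists>s\<in>S. {x, s} \<in> E)}"

definition max_active_count :: "'v set \<Rightarrow> 'v set set \<Rightarrow> 'v set \<Rightarrow> 'v set \<Rightarrow> nat" where
  "max_active_count W E U V = Max (active_count W E U V ` min_separators W E U V)"

definition isolated_middle :: "'v set \<Rightarrow> 'v set set \<Rightarrow> 'v set \<Rightarrow> 'v set \<Rightarrow> 'v \<Rightarrow> bool" where
  "isolated_middle W E U V x \<longleftrightarrow> x \<in> W - (U \<union> V) \<and> (\<forall>e\<in>E. x \<notin> e)"

definition detached_component :: "'v set \<Rightarrow> 'v set set \<Rightarrow> 'v set \<Rightarrow> 'v set \<Rightarrow> 'v set \<Rightarrow> bool" where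
  "detached_component W E U V K \<longleftrightarrow> K \<in> graph_components W E \<and> K \<inter> (U \<union> V) = {}"

text \<open>\<open>Spine j\<close> is \<open>x\<^sub>j\<close> and \<open>Leaf j k\<close>, for \<open>k < q j\<close>, is the \<open>k\<close>-th leaf at \<open>x\<^sub>j\<close>. Only the values
  of \<open>q\<close> on \<open>{1..L}\<close> are used.\<close>

datatype role = Spine nat | Leaf nat nat

definition chain_verts :: "nat \<Rightarrow> (nat \<Rightarrow> nat) \<Rightarrow> role set" where
  "chain_verts L q =
     {Spine j | j. j \<le> L + 1} \<union> {Leaf j k | j k. 1 \<le> j \<and> j \<le> L \<and> k < q j}"

definition chain_edges :: "nat \<Rightarrow> (nat \<Rightarrow> nat) \<Rightarrow> role set set" where
  "chain_edges L q =
     {{Spine j, Spine (j + 1)} | j. j \<le> L} \<union>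
     {{Spine j, Leaf j k} | j k. 1 \<le> j \<and> j \<le> L \<and> k < q j}"

text \<open>The operator norm of a real matrix with rows indexed by the finite set \<open>R\<close> and columns by
  the finite set \<open>C\<close>, with respect to the Euclidean norms.\<close>

definition mat_opnorm :: "'r set \<Rightarrow> 'c set \<Rightarrow> ('r \<Rightarrow> 'c \<Rightarrow> real) \<Rightarrow> real" where
  "mat_opnorm R C A =
     (SUP x \<in> {x. L2_set x C \<le> 1}. L2_set (\<lambda>i. \<Sum>j\<in>C. A i j * x j) R)"

lemma mat_opnorm_UNIV_eq_onorm:
  fixes A :: "real ^ 'c ^ 'r"
  shows "mat_opnorm UNIV UNIV (\<lambda>i j. A $ i $ j) = onorm ((*v) A)"
proof -
  have bl: "bounded_linear ((*v) A)" by simp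
  have eq: "L2_set (\<lambda>i. \<Sum>j\<in>UNIV. A $ i $ j * x j) UNIV = norm (A *v vec_lambda x)"
    for x :: "'c \<Rightarrow> real"
    by (simp add: norm_vec_def matrix_vector_mult_def L2_set_def)
  have nx: "L2_set x UNIV = norm (vec_lambda x)" for x :: "'c \<Rightarrow> real"
    by (simp add: norm_vec_def L2_set_def)
  have bound: "norm (A *v vec_lambda x) \<le> onorm ((*v) A)" if "norm (vec_lambda x) \<le> 1"
    for x :: "'c \<Rightarrow> real"
    using onorm[OF bl, of "vec_lambda x"] that onorm_pos_le[OF bl]
    by (meson mult_left_le order_trans)
  have bdd: "bdd_above ((\<lambda>x. norm (A *v vec_lambda x)) ` {x. norm (vec_lambda x :: real ^ 'c) \<le> 1})"
    using bound by (auto intro!: bdd_aboveI2)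
  let ?s = "SUP x \<in> {x. norm (vec_lambda x :: real ^ 'c) \<le> 1}. norm (A *v vec_lambda x)"
  have "?s \<le> onorm ((*v) A)"
    by (rule cSUP_least) (auto intro: bound exI[of _ "\<lambda>_. 0"] simp flip: zero_vec_def)
  moreover have "onorm ((*v) A) \<le> ?s"
    unfolding onorm_def
  proof (rule cSUP_least)
    fix y :: "real ^ 'c"
    let ?z = "(1 / norm y) *\<^sub>R y"
    have "norm (A *v y) / norm y = norm (A *v vec_lambda (vec_nth ?z))"
      by (simp only: vec_nth_inverse matrix_vector_mult_scaleR norm_scaleR) simp
    also have "\<dots> \<le> ?s"
      by (rule cSUP_upper[OF _ bdd]) (auto simp: vec_nth_inverse)
    finally show "norm (A *v y) / norm y \<le> ?s" .
  qed simp
  ultimately show ?thesis by (simp add: mat_opnorm_def eq nx)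
qed

text \<open>A family of i.i.d. uniform signs indexed by the finite set \<open>A\<close> (and \<open>0\<close> off \<open>A\<close>).\<close>

definition iid_signs :: "'k set \<Rightarrow> ('k \<Rightarrow> real) pmf" where
  "iid_signs A = Pi_pmf A 0 (\<lambda>_. pmf_of_set {-1, 1})"

definition unordered_pairs :: "nat \<Rightarrow> nat set set" where
  "unordered_pairs n = {e. e \<subseteq> {1..n} \<and> card e = 2}"

definition inj_matrix ::
  "'v set \<Rightarrow> 'v set set \<Rightarrow> 'v \<Rightarrow> 'v \<Rightarrow> nat \<Rightarrow> (nat set \<Rightarrow> real) \<Rightarrow> nat \<Rightarrow> nat \<Rightarrow> real" where
  "inj_matrix W E u v n \<xi> i j =
     (\<Sum>\<phi> \<in> {\<phi> \<in> W \<rightarrow>\<^sub>E {1..n}. inj_on \<phi> W \<and> \<phi> u = i \<and> \<phi> v = j}. \<Prod>e\<in>E. \<xi> (\<phi> ` e))"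

definition inj_expected_norm :: "'v set \<Rightarrow> 'v set set \<Rightarrow> 'v \<Rightarrow> 'v \<Rightarrow> nat \<Rightarrow> real" where
  "inj_expected_norm W E u v n =
     measure_pmf.expectation (iid_signs (unordered_pairs n))
       (\<lambda>\<xi>. mat_opnorm {1..n} {1..n} (inj_matrix W E u v n \<xi>))"

text \<open>For an edge \<open>e = {x, y}\<close>, the array \<open>\<xi>\<^sup>e\<close> on \<open>I x \<times> I y\<close> is indexed without choosing an
  orientation of \<open>e\<close>: a position is a labeling of the two vertices of \<open>e\<close>, that is, an element of
  \<open>PiE e I\<close>. The pair \<open>(e, m)\<close> addresses position \<open>m\<close> of the array \<open>\<xi>\<^sup>e\<close>.\<close>

definition typed_positions ::
  "'v set set \<Rightarrow> ('v \<Rightarrow> 'l set) \<Rightarrow> ('v set \<times> ('v \<Rightarrow> 'l)) set" where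
  "typed_positions E I = (SIGMA e:E. PiE e I)"

definition typed_matrix ::
  "'v set \<Rightarrow> 'v set set \<Rightarrow> 'v \<Rightarrow> 'v \<Rightarrow> ('v \<Rightarrow> 'l set) \<Rightarrow> ('v set \<times> ('v \<Rightarrow> 'l) \<Rightarrow> real)
    \<Rightarrow> 'l \<Rightarrow> 'l \<Rightarrow> real" where
  "typed_matrix W E u v I \<xi> i j =
     (\<Sum>l \<in> {l \<in> PiE W I. l u = i \<and> l v = j}. \<Prod>e\<in>E. \<xi> (e, restrict l e))"

definition typed_expected_norm ::
  "'v set \<Rightarrow> 'v set set \<Rightarrow> 'v \<Rightarrow> 'v \<Rightarrow> ('v \<Rightarrow> 'l set) \<Rightarrow> real" where
  "typed_expected_norm W E u v I =
     measure_pmf.expectation (iid_signs (typed_positions E I))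
       (\<lambda>\<xi>. mat_opnorm (I u) (I v) (typed_matrix W E u v I \<xi>))"

definition balanced_labels ::
  "'v set \<Rightarrow> ('v \<Rightarrow> real) \<Rightarrow> ('v \<Rightarrow> real) \<Rightarrow> nat \<Rightarrow> ('v \<Rightarrow> 'l set) \<Rightarrow> bool" where
  "balanced_labels W c C n I \<longleftrightarrow>
     (\<forall>x\<in>W. finite (I x) \<and> c x * real n \<le> real (card (I x)) \<and> real (card (I x)) \<le> C x * real n)"

end

theory Submission
  imports Defs
begin

text \<open>The typed matrix is a product \<open>A\<^sub>0 D\<^sub>1 A\<^sub>1 \<dots> D\<^sub>L A\<^sub>L\<close> of independent sign matrices and diagonal
  matrices whose entries are products of \<open>q\<^sub>j\<close> independent leaf sums. A Chevet type bound
  \<open>E |B A D| \<lesssim> |B|\<^sub>F max |D| + |B| |D|\<^sub>F\<close>, applied factor by factor, shows that only one of the \<open>D\<^sub>j\<close> can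
  contribute its large entries, of order \<open>(n log n)\<^bsup>q\<^sub>j/2\<^esup>\<close>, at a time. Conversely, flipping the signs of
  the columns of the matrix to the left of \<open>D\<^sub>j\<close> bounds the expected norm from below by that of the rank one
  contribution of the label with the largest entry of \<open>D\<^sub>j\<close>.

  The injective matrix is an average, up to a constant factor, of typed matrices over the colourings of the
  labels by the vertices of the graph; conversely, averaging over random signs of the colour pairs projects it
  onto the typed matrix of a fixed balanced colouring.\<close>

section \<open>Expectations over independent signs\<close>

text \<open>Logarithms of different levels must not multiply. This is why the Chevet bound is used
  asymmetrically: the maximum of a diagonal factor, which carries a logarithm, is paired with the
  Frobenius norm of everything to its left, a second moment and free of logarithms; the operator
  norm, which may already carry one, is paired with a log-free size of the diagonal. Bounding each
  diagonal factor by its maximum would collect a logarithm at every level. For signs the bound is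
  proved directly: the squared length of the image of one vector is a quadratic form in the signs,
  so only the column side needs a net. For the lower bound a leaf sum is cut into about
  \<open>log n\<close> blocks. That all of them are large on the same side costs only a small
  negative power of \<open>n\<close>, and there are order \<open>n\<close> independent labels to
  try. In the injective model one array of signs serves every edge, so the factors are dependent.
  Once colours separate the vertices, different edges read different signs; each injective map
  respects a fixed positive fraction of all colourings, so that averaging loses only a
  constant.\<close>

definition sE :: "'k set \<Rightarrow> (('k \<Rightarrow> real) \<Rightarrow> real) \<Rightarrow> real" where
  "sE P F = measure_pmf.expectation (iid_signs P) F"

text \<open>Functional form of measurability with respect to the coordinates in \<open>Z\<close>:
  independence of two such functions reduces to disjointness of their index sets
  (\<open>sE_indep\<close>).\<close>

definition depends :: "'k set \<Rightarrow> (('k \<Rightarrow> real) \<Rightarrow> 'b) \<Rightarrow> bool" where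
  "depends Z F \<longleftrightarrow> (\<forall>\<xi> \<xi>'. (\<forall>p\<in>Z. \<xi> p = \<xi>' p) \<longrightarrow> F \<xi> = F \<xi>')"

definition signs :: "'k set \<Rightarrow> ('k \<Rightarrow> real) set" where
  "signs P = PiE_dflt P 0 (\<lambda>_. {-1, 1})"

lemma signsD: "\<xi> \<in> signs P \<Longrightarrow> p \<in> P \<Longrightarrow> \<xi> p = -1 \<or> \<xi> p = 1"
  by (auto simp: signs_def PiE_dflt_def)

lemma signs_square: "\<xi> \<in> signs P \<Longrightarrow> p \<in> P \<Longrightarrow> \<xi> p * \<xi> p = 1"
  by (drule (1) signsD) auto

lemma signs_abs: "\<xi> \<in> signs P \<Longrightarrow> p \<in> P \<Longrightarrow> \<bar>\<xi> p\<bar> = 1"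
  by (drule (1) signsD) auto

lemma finite_signs: "finite P \<Longrightarrow> finite (signs P)"
  by (auto simp: signs_def)

lemma set_iid_signs: "finite P \<Longrightarrow> set_pmf (iid_signs P) = signs P"
  by (simp add: iid_signs_def signs_def set_Pi_pmf comp_def)

lemma integrable_iid_signs [simp]:
  "finite P \<Longrightarrow> integrable (measure_pmf (iid_signs P)) (F :: _ \<Rightarrow> real)"
  by (intro integrable_measure_pmf_finite) (simp add: set_iid_signs finite_signs)

lemma sE_eq_sum: "finite P \<Longrightarrow> sE P F = (\<Sum>\<xi>\<in>signs P. F \<xi> * pmf (iid_signs P) \<xi>)"
  unfolding sE_def
  by (subst integral_measure_pmf_real[where A="signs P"]) (auto simp: finite_signs set_iid_signs)

lemma sE_cong: "finite P \<Longrightarrow> (\<And>\<xi>. \<xi> \<in> signs P \<Longrightarrow> F \<xi> = G \<xi>) \<Longrightarrow> sE P F = sE P G"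
  by (simp add: sE_eq_sum)

lemma sE_mono: "finite P \<Longrightarrow> (\<And>\<xi>. \<xi> \<in> signs P \<Longrightarrow> F \<xi> \<le> G \<xi>) \<Longrightarrow> sE P F \<le> sE P G"
  by (auto simp: sE_eq_sum intro!: sum_mono mult_right_mono)

lemma sE_nonneg: "finite P \<Longrightarrow> (\<And>\<xi>. \<xi> \<in> signs P \<Longrightarrow> 0 \<le> F \<xi>) \<Longrightarrow> 0 \<le> sE P F"
  by (auto simp: sE_eq_sum intro!: sum_nonneg)

lemma sE_const [simp]: "sE P (\<lambda>_. c) = c"
  by (simp add: sE_def)

lemma sE_add: "finite P \<Longrightarrow> sE P (\<lambda>\<xi>. F \<xi> + G \<xi>) = sE P F + sE P G"
  by (simp add: sE_def)

lemma sE_diff: "finite P \<Longrightarrow> sE P (\<lambda>\<xi>. F \<xi> - G \<xi>) = sE P F - sE P G"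
  by (simp add: sE_def)

lemma sE_uminus: "finite P \<Longrightarrow> sE P (\<lambda>\<xi>. - F \<xi>) = - sE P F"
  by (simp add: sE_def)

lemma sE_cmult: "sE P (\<lambda>\<xi>. c * F \<xi>) = c * sE P F"
  by (simp add: sE_def)

lemma sE_cmult_right: "sE P (\<lambda>\<xi>. F \<xi> * c) = sE P F * c"
  by (simp add: sE_def)

lemma sE_divide: "sE P (\<lambda>\<xi>. F \<xi> / c) = sE P F / c"
  by (simp add: sE_def)

lemma sE_sum: "finite P \<Longrightarrow> sE P (\<lambda>\<xi>. \<Sum>x\<in>A. F x \<xi>) = (\<Sum>x\<in>A. sE P (F x))"
  by (simp add: sE_def)

lemma exp_sE_le:
  assumes "finite P" shows "exp (sE P F) \<le> sE P (\<lambda>\<xi>. exp (F \<xi>))"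
proof -
  let ?m = "sE P F"
  have "exp ?m = sE P (\<lambda>\<xi>. exp ?m * (1 + (F \<xi> - ?m)))"
    using assms by (simp add: sE_cmult sE_add sE_diff)
  also have "\<dots> \<le> sE P (\<lambda>\<xi>. exp (F \<xi>))"
  proof (rule sE_mono[OF assms])
    fix \<xi>
    have "exp ?m * (1 + (F \<xi> - ?m)) \<le> exp ?m * exp (F \<xi> - ?m)"
      by (intro mult_left_mono) (auto simp: exp_ge_add_one_self)
    then show "exp ?m * (1 + (F \<xi> - ?m)) \<le> exp (F \<xi>)" by (simp flip: exp_add)
  qed
  finally show ?thesis .
qed

lemma sE_square_le:
  assumes "finite P" shows "(sE P F)\<^sup>2 \<le> sE P (\<lambda>\<xi>. (F \<xi>)\<^sup>2)"
proof -
  have "0 \<le> sE P (\<lambda>\<xi>. (F \<xi> - sE P F)\<^sup>2)" using assms by (intro sE_nonneg) auto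
  also have "\<dots> = sE P (\<lambda>\<xi>. (F \<xi>)\<^sup>2) - (sE P F)\<^sup>2"
    using assms by (simp add: power2_diff sE_add sE_diff sE_cmult sE_cmult_right mult.assoc) (simp add: power2_eq_square)
  finally show ?thesis by simp
qed

lemma sE_sqrt_le:
  assumes "finite P" "\<And>\<xi>. \<xi> \<in> signs P \<Longrightarrow> 0 \<le> F \<xi>"
  shows "sE P (\<lambda>\<xi>. sqrt (F \<xi>)) \<le> sqrt (sE P F)"
proof (rule real_le_rsqrt)
  have "(sE P (\<lambda>\<xi>. sqrt (F \<xi>)))\<^sup>2 \<le> sE P (\<lambda>\<xi>. (sqrt (F \<xi>))\<^sup>2)" by (rule sE_square_le[OF assms(1)])
  also have "\<dots> = sE P F" by (rule sE_cong) (use assms in auto)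
  finally show "(sE P (\<lambda>\<xi>. sqrt (F \<xi>)))\<^sup>2 \<le> sE P F" .
qed

text \<open>Reading i.i.d. signs along an injection gives i.i.d. signs again. The explicit
  \<open>0\<close> off \<open>P\<close> is there because \<open>F\<close> may look at coordinates
  outside \<open>P\<close>, where members of \<open>signs P\<close> vanish.\<close>

lemma sE_reindex:
  assumes "finite P'" "inj_on h P" "h ` P \<subseteq> P'"
  shows "sE P' (\<lambda>\<xi>. F (\<lambda>p. if p \<in> P then \<xi> (h p) else 0)) = sE P F"
proof -
  have fin: "finite P" using assms finite_imageD finite_subset by blast
  have 1: "iid_signs (h ` P) = map_pmf (\<lambda>f x. if x \<in> h ` P then f x else 0) (iid_signs P')"
    unfolding iid_signs_def by (rule Pi_pmf_subset) (use assms in auto)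
  \<comment> \<open>Transport along a bijection asks that points outside \<open>P\<close> stay
    outside the target, which \<open>h\<close> need not respect; \<open>None\<close> is a spare
    point that certainly lies outside.\<close>
  define g where "g = (\<lambda>p. if p \<in> P then Some (h p) else None)"
  have 2: "iid_signs P = map_pmf (\<lambda>f. f \<circ> g) (iid_signs (Some ` h ` P))"
    unfolding iid_signs_def
  proof (rule Pi_pmf_bij_betw[OF fin])
    show "bij_betw g P (Some ` h ` P)" using assms(2) by (auto simp: bij_betw_def g_def inj_on_def)
  qed (auto simp: g_def)
  have 3: "iid_signs (h ` P) = map_pmf (\<lambda>f. f \<circ> Some) (iid_signs (Some ` h ` P))"
    unfolding iid_signs_def
    by (rule Pi_pmf_bij_betw) (use fin in \<open>auto simp: bij_betw_def\<close>)
  have 4: "iid_signs P = map_pmf (\<lambda>f p. if p \<in> P then f (h p) else 0) (iid_signs (h ` P))"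
    unfolding 2 3 map_pmf_comp
  proof (rule map_pmf_cong[OF refl])
    fix f assume "f \<in> set_pmf (iid_signs (Some ` h ` P))"
    then have "f None = 0" using fin by (auto simp: set_iid_signs signs_def PiE_dflt_def)
    then show "f \<circ> g = (\<lambda>p. if p \<in> P then (f \<circ> Some) (h p) else 0)" by (auto simp: g_def)
  qed
  show ?thesis unfolding sE_def 4 unfolding 1 map_pmf_comp
    by (simp cong: if_cong)
qed

lemma dependsD: "depends Z F \<Longrightarrow> (\<And>p. p \<in> Z \<Longrightarrow> \<xi> p = \<xi>' p) \<Longrightarrow> F \<xi> = F \<xi>'"
  by (auto simp: depends_def)

lemma sE_subset:
  assumes "finite P'" "P \<subseteq> P'" "depends P F"
  shows "sE P' F = sE P F"
proof -
  have "sE P' F = sE P' (\<lambda>\<xi>. F (\<lambda>p. if p \<in> P then \<xi> (id p) else 0))"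
    by (rule sE_cong[OF assms(1)], rule dependsD[OF assms(3)]) auto
  also have "\<dots> = sE P F" by (rule sE_reindex) (use assms in auto)
  finally show ?thesis .
qed

lemma sE_reindex':
  assumes "finite P'" "inj_on h P" "h ` P \<subseteq> P'" "depends P F"
  shows "sE P' (\<lambda>\<xi>. F (\<lambda>p. \<xi> (h p))) = sE P F"
proof -
  have "F (\<lambda>p. \<xi> (h p)) = F (\<lambda>p. if p \<in> P then \<xi> (h p) else 0)" for \<xi>
    by (rule dependsD[OF assms(4)]) auto
  then show ?thesis using sE_reindex[OF assms(1-3), of F] by simp
qed

text \<open>Fubini for the split of \<open>P\<close> into \<open>Y\<close> and \<open>P - Y\<close>:
  in the inner expectation the signs off \<open>Y\<close> are frozen. The later conditioning
  arguments all go through this form.\<close>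

lemma sE_resample:
  assumes "finite P" "Y \<subseteq> P"
  shows "sE P F = sE P (\<lambda>\<xi>. sE Y (\<lambda>\<eta>. F (\<lambda>p. if p \<in> Y then \<eta> p else \<xi> p)))"
proof -
  let ?Z = "P - Y"
  have fY: "finite Y" using assms finite_subset by blast
  have "iid_signs P = map_pmf (\<lambda>(f,g) x. if x \<in> Y then f x else g x) (pair_pmf (iid_signs Y) (iid_signs ?Z))"
    using Pi_pmf_union[of Y ?Z "0::real" "\<lambda>_. pmf_of_set {-1,1}"] assms fY
    by (simp add: iid_signs_def Un_absorb1)
  then have "sE P F = measure_pmf.expectation (pair_pmf (iid_signs Y) (iid_signs ?Z)) (\<lambda>(f,g). F (\<lambda>x. if x \<in> Y then f x else g x))"
    by (simp add: sE_def case_prod_unfold)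
  also have "\<dots> = sE ?Z (\<lambda>g. sE Y (\<lambda>f. F (\<lambda>x. if x \<in> Y then f x else g x)))" (is "?l = _")
  proof -
    have "?l = (\<Sum>a\<in>signs Y \<times> signs ?Z. (case a of (f, g) \<Rightarrow> F (\<lambda>x. if x \<in> Y then f x else g x)) *
        pmf (pair_pmf (iid_signs Y) (iid_signs ?Z)) a)"
      using fY assms
      by (intro integral_measure_pmf_real) (auto simp: finite_signs set_iid_signs)
    also have "\<dots> = (\<Sum>f\<in>signs Y. \<Sum>g\<in>signs ?Z. F (\<lambda>x. if x \<in> Y then f x else g x) *
        (pmf (iid_signs Y) f * pmf (iid_signs ?Z) g))"
      unfolding sum.cartesian_product by (intro sum.cong refl) (auto simp: pmf_pair)
    also have "\<dots> = sE ?Z (\<lambda>g. sE Y (\<lambda>f. F (\<lambda>x. if x \<in> Y then f x else g x)))"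
      using fY assms by (subst sum.swap) (simp add: sE_eq_sum sum_distrib_left sum_distrib_right mult_ac)
    finally show ?thesis .
  qed
  also have "\<dots> = sE P (\<lambda>g. sE Y (\<lambda>f. F (\<lambda>x. if x \<in> Y then f x else g x)))"
    (is "sE ?Z ?G = _")
  proof -
    have "sE P ?G = sE P (\<lambda>\<xi>. ?G (\<lambda>p. if p \<in> ?Z then \<xi> (id p) else 0))"
    proof (intro sE_cong[OF assms(1)] sE_cong[OF fY] arg_cong[where f=F] ext)
      fix \<xi> \<eta> x assume "\<xi> \<in> signs P"
      then show "(if x \<in> Y then \<eta> x else \<xi> x) = (if x \<in> Y then \<eta> x else if x \<in> ?Z then \<xi> (id x) else 0)"
        by (auto simp: signs_def PiE_dflt_def)
    qed
    also have "\<dots> = sE ?Z ?G" by (rule sE_reindex) (use assms in auto)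
    finally show ?thesis by simp
  qed
  finally show ?thesis .
qed

lemma sE_indep:
  assumes "finite P" "depends Y F" "depends Z G" "Y \<inter> Z = {}"
  shows "sE P (\<lambda>\<xi>. F \<xi> * G \<xi>) = sE P F * sE P G"
proof -
  have "sE P (\<lambda>\<xi>. F \<xi> * G \<xi>) = sE P (\<lambda>\<xi>. sE (P \<inter> Y) (\<lambda>\<eta>. F (\<lambda>p. if p \<in> P \<inter> Y then \<eta> p else \<xi> p) * G (\<lambda>p. if p \<in> P \<inter> Y then \<eta> p else \<xi> p)))"
    by (rule sE_resample) (use assms in auto)
  also have "\<dots> = sE P (\<lambda>\<xi>. sE (P \<inter> Y) F * G \<xi>)"
  proof (rule sE_cong[OF assms(1)])
    fix \<xi> assume x: "\<xi> \<in> signs P"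
    have "F (\<lambda>p. if p \<in> P \<inter> Y then \<eta> p else \<xi> p) * G (\<lambda>p. if p \<in> P \<inter> Y then \<eta> p else \<xi> p) = F \<eta> * G \<xi>"
      if "\<eta> \<in> signs (P \<inter> Y)" for \<eta>
    proof -
      have "F (\<lambda>p. if p \<in> P \<inter> Y then \<eta> p else \<xi> p) = F \<eta>"
        by (rule dependsD[OF assms(2)]) (use x that in \<open>auto simp: signs_def PiE_dflt_def\<close>)
      moreover have "G (\<lambda>p. if p \<in> P \<inter> Y then \<eta> p else \<xi> p) = G \<xi>"
        by (rule dependsD[OF assms(3)]) (use assms(4) in auto)
      ultimately show ?thesis by simp
    qed
    then show "sE (P \<inter> Y) (\<lambda>\<eta>. F (\<lambda>p. if p \<in> P \<inter> Y then \<eta> p else \<xi> p) * G (\<lambda>p. if p \<in> P \<inter> Y then \<eta> p else \<xi> p)) = sE (P \<inter> Y) F * G \<xi>"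
      unfolding sE_cmult_right[symmetric] by (intro sE_cong) (use assms(1) in auto)
  qed
  also have "\<dots> = sE (P \<inter> Y) F * sE P G" by (rule sE_cmult)
  also have "sE (P \<inter> Y) F = sE P F"
  proof -
    have "sE P F = sE P (\<lambda>\<xi>. sE (P \<inter> Y) (\<lambda>\<eta>. F (\<lambda>p. if p \<in> P \<inter> Y then \<eta> p else \<xi> p)))"
      by (rule sE_resample) (use assms in auto)
    also have "\<dots> = sE P (\<lambda>\<xi>. sE (P \<inter> Y) F)"
    proof (rule sE_cong[OF assms(1)], rule sE_cong)
      fix \<xi> \<eta> assume x: "\<xi> \<in> signs P" and that: "\<eta> \<in> signs (P \<inter> Y)"
      show "F (\<lambda>p. if p \<in> P \<inter> Y then \<eta> p else \<xi> p) = F \<eta>"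
        by (rule dependsD[OF assms(2)]) (use x that in \<open>auto simp: signs_def PiE_dflt_def\<close>)
    qed (use assms(1) in auto)
    finally show ?thesis by simp
  qed
  finally show ?thesis .
qed

lemma sE_indep_prod:
  assumes "finite P" "finite T" "\<And>t. t \<in> T \<Longrightarrow> depends (Y t) (F t)"
    "\<And>s t. s \<in> T \<Longrightarrow> t \<in> T \<Longrightarrow> s \<noteq> t \<Longrightarrow> Y s \<inter> Y t = {}"
  shows "sE P (\<lambda>\<xi>. \<Prod>t\<in>T. F t \<xi>) = (\<Prod>t\<in>T. sE P (F t))"
  using assms(2-4)
proof (induction T rule: finite_induct)
  case (insert t T)
  have d: "depends (\<Union>s\<in>T. Y s) (\<lambda>\<xi>. \<Prod>s\<in>T. F s \<xi>)"
    unfolding depends_def by (auto intro!: prod.cong dependsD[OF insert.prems(1)])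
  have "sE P (\<lambda>\<xi>. F t \<xi> * (\<Prod>s\<in>T. F s \<xi>)) = sE P (F t) * sE P (\<lambda>\<xi>. \<Prod>s\<in>T. F s \<xi>)"
    by (rule sE_indep[OF assms(1) insert.prems(1)[of t] d]) (use insert in blast)+
  then show ?case using insert by simp
qed simp

text \<open>All points of \<open>signs P\<close> have the same weight and the flip is an involution
  of this set; off \<open>P\<close> every sign is \<open>0\<close>, so the values of \<epsilon>
  there do not matter.\<close>

lemma sE_flip:
  assumes "finite P" "\<And>p. p \<in> P \<Longrightarrow> \<epsilon> p = -1 \<or> \<epsilon> p = 1"
  shows "sE P (\<lambda>\<xi>. F (\<lambda>p. \<epsilon> p * \<xi> p)) = sE P F"
proof -
  have pmfc: "pmf (iid_signs P) \<xi> = (1/2) ^ card P" if "\<xi> \<in> signs P" for \<xi>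
  proof -
    have "pmf (iid_signs P) \<xi> = (\<Prod>x\<in>P. pmf (pmf_of_set {-1,1::real}) (\<xi> x))"
      unfolding iid_signs_def by (rule pmf_Pi') (use assms that in \<open>auto simp: signs_def PiE_dflt_def\<close>)
    also have "\<dots> = (\<Prod>x\<in>P. 1/2)"
      by (intro prod.cong refl) (use signsD[OF that] in \<open>auto simp: indicator_def pmf_of_set\<close>)
    finally show ?thesis by simp
  qed
  have sq: "\<epsilon> p * (\<epsilon> p * y) = y" if "p \<in> P" for p and y :: real using assms(2)[OF that] by auto
  have flip: "(\<lambda>p. \<epsilon> p * \<xi> p) \<in> signs P" if "\<xi> \<in> signs P" for \<xi>
    unfolding signs_def PiE_dflt_def
  proof (intro CollectI allI conjI impI)
    fix p
    show "\<epsilon> p * \<xi> p \<in> {-1, 1}" if "p \<in> P"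
      using assms(2)[OF that] signsD[OF \<open>\<xi> \<in> signs P\<close> that] by auto
    show "\<epsilon> p * \<xi> p = 0" if "p \<notin> P"
      using \<open>\<xi> \<in> signs P\<close> that by (auto simp: signs_def PiE_dflt_def)
  qed
  have sq2: "(\<lambda>p. \<epsilon> p * (\<epsilon> p * \<xi> p)) = \<xi>" if "\<xi> \<in> signs P" for \<xi>
  proof
    show "\<epsilon> p * (\<epsilon> p * \<xi> p) = \<xi> p" for p
      using sq[of p] that by (cases "p \<in> P") (auto simp: signs_def PiE_dflt_def)
  qed
  have "(\<Sum>\<xi>\<in>signs P. F (\<lambda>p. \<epsilon> p * \<xi> p)) = (\<Sum>\<xi>\<in>signs P. F \<xi>)"
    by (rule sum.reindex_bij_witness[where i="\<lambda>\<xi> p. \<epsilon> p * \<xi> p" and j="\<lambda>\<xi> p. \<epsilon> p * \<xi> p"])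
      (use flip sq2 in auto)
  then show ?thesis unfolding sE_eq_sum[OF assms(1)]
    by (simp add: pmfc flip: sum_distrib_right)
qed

section \<open>Operator norms of finite matrices\<close>

lemma L2_set_power2: "(L2_set f A)\<^sup>2 = (\<Sum>i\<in>A. (f i)\<^sup>2)"
  by (simp add: L2_set_def sum_nonneg)

lemma L2_set_le_iff: "0 \<le> B \<Longrightarrow> L2_set f A \<le> B \<longleftrightarrow> (\<Sum>i\<in>A. (f i)\<^sup>2) \<le> B\<^sup>2"
  unfolding L2_set_def by (auto intro: real_le_lsqrt sqrt_le_D sum_nonneg)

lemma L2_set_abs [simp]: "L2_set (\<lambda>x. \<bar>f x\<bar>) A = L2_set f A"
  by (simp add: L2_set_def)

lemma L2_set_mono_abs:
  assumes "\<And>i. i \<in> A \<Longrightarrow> \<bar>f i\<bar> \<le> \<bar>g i\<bar>"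
  shows "L2_set f A \<le> L2_set g A"
proof -
  have "L2_set (\<lambda>i. \<bar>f i\<bar>) A \<le> L2_set (\<lambda>i. \<bar>g i\<bar>) A"
    by (rule L2_set_mono) (use assms in auto)
  then show ?thesis by simp
qed

lemma L2_set_cmult: "L2_set (\<lambda>x. c * f x) A = \<bar>c\<bar> * L2_set f A"
proof -
  have "L2_set (\<lambda>x. \<bar>c\<bar> * f x) A = \<bar>c\<bar> * L2_set f A"
    by (simp add: L2_set_right_distrib)
  moreover have "L2_set (\<lambda>x. \<bar>c\<bar> * f x) A = L2_set (\<lambda>x. c * f x) A"
    by (simp add: L2_set_def power_mult_distrib)
  ultimately show ?thesis by simp
qed

lemma L2_set_subset: "finite B \<Longrightarrow> A \<subseteq> B \<Longrightarrow> L2_set f A \<le> L2_set f B"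
  unfolding L2_set_def by (intro real_sqrt_le_mono sum_mono2) auto

lemma L2_set_zero_extend:
  "finite B \<Longrightarrow> A \<subseteq> B \<Longrightarrow> (\<And>x. x \<in> B - A \<Longrightarrow> f x = 0) \<Longrightarrow> L2_set f B = L2_set f A"
  unfolding L2_set_def by (intro arg_cong[where f=sqrt] sum.mono_neutral_right) auto

lemma Cauchy_Schwarz_L2_set: "\<bar>\<Sum>i\<in>A. f i * g i\<bar> \<le> L2_set f A * L2_set g A"
  by (rule order_trans[OF sum_abs]) (use L2_set_mult_ineq in \<open>simp add: abs_mult\<close>)

text \<open>Jensen for the Euclidean norm, by duality: the mean vector is paired with itself and
  Cauchy-Schwarz is applied under the expectation.\<close>

lemma L2_set_sE_le:
  assumes "finite P" "finite R"
  shows "L2_set (\<lambda>i. sE P (F i)) R \<le> sE P (\<lambda>\<xi>. L2_set (\<lambda>i. F i \<xi>) R)"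
proof -
  define v where "v = (\<lambda>i. sE P (F i))"
  have "L2_set v R * L2_set v R = (\<Sum>i\<in>R. v i * sE P (F i))"
    using L2_set_power2[of v R] by (simp add: power2_eq_square v_def)
  also have "\<dots> = sE P (\<lambda>\<xi>. \<Sum>i\<in>R. v i * F i \<xi>)" by (simp add: sE_sum assms sE_cmult)
  also have "\<dots> \<le> sE P (\<lambda>\<xi>. L2_set v R * L2_set (\<lambda>i. F i \<xi>) R)"
    by (intro sE_mono assms(1) order_trans[OF abs_ge_self Cauchy_Schwarz_L2_set])
  also have "\<dots> = L2_set v R * sE P (\<lambda>\<xi>. L2_set (\<lambda>i. F i \<xi>) R)" by (rule sE_cmult)
  finally have *: "L2_set v R * L2_set v R \<le> L2_set v R * sE P (\<lambda>\<xi>. L2_set (\<lambda>i. F i \<xi>) R)" .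
  show ?thesis
  proof (cases "L2_set v R = 0")
    case True
    then show ?thesis using assms(1) by (simp add: v_def sE_nonneg)
  next
    case False
    then have "L2_set v R > 0" using L2_set_nonneg[of v R] by linarith
    then show ?thesis using * by (simp add: v_def)
  qed
qed

definition frobenius :: "'r set \<Rightarrow> 'c set \<Rightarrow> ('r \<Rightarrow> 'c \<Rightarrow> real) \<Rightarrow> real" where
  "frobenius R C A = sqrt (\<Sum>i\<in>R. \<Sum>j\<in>C. (A i j)\<^sup>2)"

lemma frobenius_nonneg: "0 \<le> frobenius R C A"
  by (simp add: frobenius_def sum_nonneg)

lemma frobenius_power2: "(frobenius R C A)\<^sup>2 = (\<Sum>i\<in>R. \<Sum>j\<in>C. (A i j)\<^sup>2)"
  by (simp add: frobenius_def sum_nonneg)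

lemma L2_set_matrix_le_frobenius:
  "L2_set (\<lambda>i. \<Sum>j\<in>C. A i j * x j) R \<le> frobenius R C A * L2_set x C"
proof -
  have "(\<Sum>i\<in>R. (\<Sum>j\<in>C. A i j * x j)\<^sup>2) \<le> (\<Sum>i\<in>R. (\<Sum>j\<in>C. (A i j)\<^sup>2) * (\<Sum>j\<in>C. (x j)\<^sup>2))"
    by (intro sum_mono Cauchy_Schwarz_ineq_sum)
  also have "\<dots> = (frobenius R C A * L2_set x C)\<^sup>2"
    by (simp add: power_mult_distrib frobenius_power2 L2_set_power2 sum_distrib_right)
  finally show ?thesis
    by (subst L2_set_le_iff) (auto simp: frobenius_nonneg)
qed

lemma mat_opnorm_bdd:
  "bdd_above ((\<lambda>x. L2_set (\<lambda>i. \<Sum>j\<in>C. A i j * x j) R) ` {x. L2_set x C \<le> 1})"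
proof (rule bdd_aboveI2)
  fix x assume "x \<in> {x. L2_set x C \<le> 1}"
  then show "L2_set (\<lambda>i. \<Sum>j\<in>C. A i j * x j) R \<le> frobenius R C A"
    using L2_set_matrix_le_frobenius[of A x C R] frobenius_nonneg[of R C A]
    by (smt (verit) mem_Collect_eq mult_left_le)
qed

lemma mat_opnorm_upper:
  "L2_set x C \<le> 1 \<Longrightarrow> L2_set (\<lambda>i. \<Sum>j\<in>C. A i j * x j) R \<le> mat_opnorm R C A"
  unfolding mat_opnorm_def by (rule cSUP_upper[OF _ mat_opnorm_bdd]) simp

lemma mat_opnorm_least:
  assumes "\<And>x. L2_set x C \<le> 1 \<Longrightarrow> L2_set (\<lambda>i. \<Sum>j\<in>C. A i j * x j) R \<le> B"
  shows "mat_opnorm R C A \<le> B"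
  unfolding mat_opnorm_def
proof (rule cSUP_least)
  have "L2_set (\<lambda>_. 0) C \<le> 1" by (simp add: L2_set_def)
  then show "{x. L2_set x C \<le> 1} \<noteq> {}" by blast
qed (use assms in auto)

lemma mat_opnorm_nonneg: "0 \<le> mat_opnorm R C A"
  by (rule order_trans[OF _ mat_opnorm_upper[of "\<lambda>_. 0"]]) (auto simp: L2_set_def)

lemma mat_opnorm_apply:
  assumes "finite C"
  shows "L2_set (\<lambda>i. \<Sum>j\<in>C. A i j * x j) R \<le> mat_opnorm R C A * L2_set x C"
proof (cases "L2_set x C = 0")
  case True
  then have "\<forall>j\<in>C. x j = 0" using assms by (simp add: L2_set_eq_0_iff)
  then show ?thesis using True by (simp add: L2_set_def)
next
  case False
  then have pos: "L2_set x C > 0" using L2_set_nonneg[of x C] by linarith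
  define c where "c = inverse (L2_set x C)"
  have c: "c > 0" using pos by (simp add: c_def)
  have "L2_set (\<lambda>i. c * (\<Sum>j\<in>C. A i j * x j)) R \<le> mat_opnorm R C A"
  proof -
    have "L2_set (\<lambda>j. c * x j) C \<le> 1" using pos by (simp add: L2_set_cmult c_def)
    from mat_opnorm_upper[OF this, of A R] show ?thesis by (simp add: sum_distrib_left mult_ac)
  qed
  then have "c * L2_set (\<lambda>i. \<Sum>j\<in>C. A i j * x j) R \<le> mat_opnorm R C A"
    unfolding L2_set_cmult using c by simp
  then show ?thesis using pos
    by (simp add: c_def divide_simps mult_ac)
qed

lemma mat_opnorm_leI:
  assumes "0 \<le> B" "finite C"
    "\<And>x. L2_set (\<lambda>i. \<Sum>j\<in>C. A i j * x j) R \<le> B * L2_set x C"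
  shows "mat_opnorm R C A \<le> B"
proof (rule mat_opnorm_least)
  fix x assume "L2_set x C \<le> 1"
  then have "B * L2_set x C \<le> B" using assms(1) by (simp add: mult_left_le)
  then show "L2_set (\<lambda>i. \<Sum>j\<in>C. A i j * x j) R \<le> B" using assms(3)[of x] by linarith
qed

lemma mat_opnorm_cong:
  assumes "\<And>i j. i \<in> R \<Longrightarrow> j \<in> C \<Longrightarrow> A i j = B i j"
  shows "mat_opnorm R C A = mat_opnorm R C B"
proof -
  have "L2_set (\<lambda>i. \<Sum>j\<in>C. A i j * x j) R = L2_set (\<lambda>i. \<Sum>j\<in>C. B i j * x j) R" for x
    by (intro L2_set_cong refl sum.cong) (use assms in auto)
  then show ?thesis by (simp add: mat_opnorm_def)
qed

lemma mat_opnorm_add: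
  assumes "finite C"
  shows "mat_opnorm R C (\<lambda>i j. A i j + B i j) \<le> mat_opnorm R C A + mat_opnorm R C B"
proof (rule mat_opnorm_leI[OF _ assms])
  fix x
  have "L2_set (\<lambda>i. \<Sum>j\<in>C. (A i j + B i j) * x j) R
      = L2_set (\<lambda>i. (\<Sum>j\<in>C. A i j * x j) + (\<Sum>j\<in>C. B i j * x j)) R"
    by (simp add: ring_distribs sum.distrib)
  also have "\<dots> \<le> L2_set (\<lambda>i. \<Sum>j\<in>C. A i j * x j) R + L2_set (\<lambda>i. \<Sum>j\<in>C. B i j * x j) R"
    by (rule L2_set_triangle_ineq)
  also have "\<dots> \<le> (mat_opnorm R C A + mat_opnorm R C B) * L2_set x C"
    using mat_opnorm_apply[OF assms, of A x R] mat_opnorm_apply[OF assms, of B x R]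
    by (simp add: ring_distribs)
  finally show "L2_set (\<lambda>i. \<Sum>j\<in>C. (A i j + B i j) * x j) R \<le> (mat_opnorm R C A + mat_opnorm R C B) * L2_set x C" .
qed (use mat_opnorm_nonneg[of R C A] mat_opnorm_nonneg[of R C B] in simp)

lemma mat_opnorm_zero [simp]: "mat_opnorm R C (\<lambda>i j. 0) = 0"
  by (intro antisym mat_opnorm_least mat_opnorm_nonneg) (simp add: L2_set_def)

lemma mat_opnorm_sum:
  assumes "finite C"
  shows "mat_opnorm R C (\<lambda>i j. \<Sum>s\<in>T. A s i j) \<le> (\<Sum>s\<in>T. mat_opnorm R C (A s))"
proof (induction T rule: infinite_finite_induct)
  case (insert s T)
  then show ?case using mat_opnorm_add[OF assms, of R "A s" "\<lambda>i j. \<Sum>s\<in>T. A s i j"] by simp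
qed simp_all

lemma mat_opnorm_cmult_le:
  assumes "finite C"
  shows "mat_opnorm R C (\<lambda>i j. c * A i j) \<le> \<bar>c\<bar> * mat_opnorm R C A"
proof (rule mat_opnorm_leI[OF _ assms])
  fix x
  have "L2_set (\<lambda>i. \<Sum>j\<in>C. c * A i j * x j) R = \<bar>c\<bar> * L2_set (\<lambda>i. \<Sum>j\<in>C. A i j * x j) R"
    by (simp add: sum_distrib_left mult_ac flip: L2_set_cmult)
  also have "\<dots> \<le> \<bar>c\<bar> * (mat_opnorm R C A * L2_set x C)"
    by (intro mult_left_mono mat_opnorm_apply assms) auto
  finally show "L2_set (\<lambda>i. \<Sum>j\<in>C. c * A i j * x j) R \<le> \<bar>c\<bar> * mat_opnorm R C A * L2_set x C"
    by (simp add: mult_ac)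
qed (use mat_opnorm_nonneg[of R C A] in simp)

text \<open>The support \<open>S\<close> is kept on the right because a random matrix on few columns
  has a smaller norm; the layers of a diagonal factor exploit this.\<close>

lemma mat_opnorm_columns:
  assumes "finite C" "S \<subseteq> C" "0 \<le> T" "\<And>j. j \<in> S \<Longrightarrow> \<bar>d j\<bar> \<le> T" "\<And>j. j \<in> C - S \<Longrightarrow> d j = 0"
  shows "mat_opnorm R C (\<lambda>i j. A i j * d j) \<le> T * mat_opnorm R S A"
proof (rule mat_opnorm_leI[OF _ assms(1)])
  fix x
  have fS: "finite S" using assms finite_subset by blast
  have "(\<Sum>j\<in>C. A i j * d j * x j) = (\<Sum>j\<in>S. A i j * (d j * x j))" for i
    by (rule sum.mono_neutral_cong_right) (use assms in auto)
  then have "L2_set (\<lambda>i. \<Sum>j\<in>C. A i j * d j * x j) R \<le> mat_opnorm R S A * L2_set (\<lambda>j. d j * x j) S"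
    by (simp add: mat_opnorm_apply fS)
  moreover have 2: "L2_set (\<lambda>j. d j * x j) S \<le> T * L2_set x C"
  proof -
    have "L2_set (\<lambda>j. d j * x j) S \<le> L2_set (\<lambda>j. T * x j) S"
      by (intro L2_set_mono_abs) (use assms(3,4) in \<open>auto simp: abs_mult intro!: mult_right_mono\<close>)
    also have "\<dots> = T * L2_set x S" using assms(3) by (simp add: L2_set_cmult)
    also have "\<dots> \<le> T * L2_set x C" by (intro mult_left_mono L2_set_subset assms)
    finally show ?thesis .
  qed
  ultimately show "L2_set (\<lambda>i. \<Sum>j\<in>C. A i j * d j * x j) R \<le> T * mat_opnorm R S A * L2_set x C"
    using mult_left_mono[OF 2 mat_opnorm_nonneg[of R S A]] by (simp add: mult_ac)
qed (use mat_opnorm_nonneg[of R S A] assms in simp)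

lemma mat_opnorm_submatrix:
  assumes "finite R" "finite C" "R' \<subseteq> R" "C' \<subseteq> C"
  shows "mat_opnorm R' C' A \<le> mat_opnorm R C A"
proof (rule mat_opnorm_least)
  fix x assume x: "L2_set x C' \<le> 1"
  define y where "y j = (if j \<in> C' then x j else 0)" for j
  have "L2_set y C = L2_set y C'" using assms by (intro L2_set_zero_extend) (auto simp: y_def)
  then have 1: "L2_set y C \<le> 1" using x by (simp add: y_def cong: L2_set_cong_simp)
  have "(\<Sum>j\<in>C'. A i j * x j) = (\<Sum>j\<in>C. A i j * y j)" for i
    using assms by (intro sum.mono_neutral_cong_left) (auto simp: y_def)
  then have "L2_set (\<lambda>i. \<Sum>j\<in>C'. A i j * x j) R' \<le> L2_set (\<lambda>i. \<Sum>j\<in>C. A i j * y j) R"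
    using assms by (simp add: L2_set_subset)
  also have "\<dots> \<le> mat_opnorm R C A" by (rule mat_opnorm_upper[OF 1])
  finally show "L2_set (\<lambda>i. \<Sum>j\<in>C'. A i j * x j) R' \<le> mat_opnorm R C A" .
qed

lemma mat_opnorm_zero_pad:
  assumes "finite R" "finite C" "R' \<subseteq> R" "C' \<subseteq> C"
    "\<And>i j. i \<in> R \<Longrightarrow> j \<in> C \<Longrightarrow> i \<notin> R' \<or> j \<notin> C' \<Longrightarrow> A i j = 0"
  shows "mat_opnorm R C A \<le> mat_opnorm R' C' A"
proof (rule mat_opnorm_least)
  fix x assume x: "L2_set x C \<le> 1"
  have 1: "L2_set x C' \<le> 1" using L2_set_subset[OF assms(2,4), of x] x by linarith
  have "(\<Sum>j\<in>C. A i j * x j) = (\<Sum>j\<in>C'. A i j * x j)" if "i \<in> R" for i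
    using assms that by (intro sum.mono_neutral_cong_right) auto
  then have "L2_set (\<lambda>i. \<Sum>j\<in>C. A i j * x j) R = L2_set (\<lambda>i. \<Sum>j\<in>C'. A i j * x j) R"
    by (intro L2_set_cong) auto
  also have "\<dots> = L2_set (\<lambda>i. \<Sum>j\<in>C'. A i j * x j) R'"
    using assms by (intro L2_set_zero_extend) (auto intro!: sum.neutral)
  also have "\<dots> \<le> mat_opnorm R' C' A" by (rule mat_opnorm_upper[OF 1])
  finally show "L2_set (\<lambda>i. \<Sum>j\<in>C. A i j * x j) R \<le> mat_opnorm R' C' A" .
qed

lemma mat_opnorm_rank_one:
  assumes "finite C"
  shows "L2_set p R * L2_set r C \<le> mat_opnorm R C (\<lambda>i j. p i * r j)"
proof (cases "L2_set r C = 0")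
  case False
  then have pos: "L2_set r C > 0" using L2_set_nonneg[of r C] by linarith
  have "L2_set (\<lambda>i. \<Sum>j\<in>C. p i * r j * r j) R = L2_set (\<lambda>i. (L2_set r C)\<^sup>2 * p i) R"
    by (simp add: L2_set_power2 sum_distrib_left mult_ac power2_eq_square[of "r _"])
  also have "\<dots> = (L2_set p R * L2_set r C) * L2_set r C" by (simp add: L2_set_cmult power2_eq_square)
  finally have "(L2_set p R * L2_set r C) * L2_set r C \<le> mat_opnorm R C (\<lambda>i j. p i * r j) * L2_set r C"
    using mat_opnorm_apply[OF assms, of "\<lambda>i j. p i * r j" r R] by simp
  then show ?thesis using pos by simp
qed (simp add: mat_opnorm_nonneg)

lemma mat_opnorm_sE_le:
  assumes "finite P" "finite R" "finite C"
  shows "mat_opnorm R C (\<lambda>i j. sE P (A i j)) \<le> sE P (\<lambda>\<xi>. mat_opnorm R C (\<lambda>i j. A i j \<xi>))"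
proof (rule mat_opnorm_least)
  fix x assume x: "L2_set x C \<le> 1"
  have "L2_set (\<lambda>i. \<Sum>j\<in>C. sE P (A i j) * x j) R = L2_set (\<lambda>i. sE P (\<lambda>\<xi>. \<Sum>j\<in>C. A i j \<xi> * x j)) R"
    using assms by (simp add: sE_sum sE_cmult_right)
  also have "\<dots> \<le> sE P (\<lambda>\<xi>. L2_set (\<lambda>i. \<Sum>j\<in>C. A i j \<xi> * x j) R)"
    by (rule L2_set_sE_le) (use assms in auto)
  also have "\<dots> \<le> sE P (\<lambda>\<xi>. mat_opnorm R C (\<lambda>i j. A i j \<xi>))"
    by (intro sE_mono assms mat_opnorm_upper x)
  finally show "L2_set (\<lambda>i. \<Sum>j\<in>C. sE P (A i j) * x j) R \<le> \<dots>" .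
qed

text \<open>Settles matrices of norm zero, for which the parameter
  \<open>1 / (8 * b\<^sup>2)\<close> of the exponential moment method would make no sense.\<close>

lemma mat_opnorm_entry_zero:
  assumes "finite R" "finite C" "mat_opnorm R C A = 0" "i \<in> R" "j \<in> C"
  shows "A i j = 0"
proof -
  have "L2_set (\<lambda>i. \<Sum>l\<in>C. A i l * (if l = j then 1 else 0)) R \<le> 0"
    using mat_opnorm_apply[OF assms(2), of A "\<lambda>l. if l = j then 1 else 0" R] assms(3) by simp
  then have "L2_set (\<lambda>i. A i j) R = 0"
    using assms(2,5) L2_set_nonneg[of "\<lambda>i. A i j" R] by (simp add: if_distrib cong: if_cong)
  then show ?thesis using assms by (simp add: L2_set_eq_0_iff)
qed

lemma mat_opnorm_id_le: "finite X \<Longrightarrow> mat_opnorm X X (\<lambda>i j. if i = j then 1 else 0) \<le> 1"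
  by (rule mat_opnorm_leI) (auto simp: if_distrib if_distribR cong: if_cong L2_set_cong_simp)

lemma frobenius_id:
  "finite X \<Longrightarrow> frobenius X X (\<lambda>i j. if i = j then 1 else 0) = sqrt (real (card X))"
  by (simp add: frobenius_def if_distrib[of "\<lambda>x. x\<^sup>2"] cong: if_cong)

section \<open>Norms of random sign matrices\<close>

lemma sinh_le_mult_cosh:
  fixes x :: real
  assumes "0 \<le> x" shows "sinh x \<le> x * cosh x"
proof -
  have "0 * cosh 0 - sinh 0 \<le> x * cosh x - sinh x"
    by (rule DERIV_nonneg_imp_nondecreasing[OF assms])
      (auto intro!: exI derivative_eq_intros mult_nonneg_nonneg)
  then show ?thesis by simp
qed

lemma cosh_le_exp_half_square:
  fixes x :: real shows "cosh x \<le> exp (x\<^sup>2 / 2)"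
proof -
  have *: "cosh x \<le> exp (x\<^sup>2 / 2)" if "0 \<le> x" for x :: real
  proof -
    have "cosh x * exp (- x\<^sup>2 / 2) \<le> cosh 0 * exp (- 0\<^sup>2 / 2)"
    proof (rule DERIV_nonpos_imp_nonincreasing[OF that], intro exI conjI)
      fix y :: real assume "0 \<le> y"
      show "((\<lambda>x. cosh x * exp (- x\<^sup>2 / 2)) has_real_derivative (sinh y - y * cosh y) * exp (- y\<^sup>2 / 2)) (at y)"
        by (auto intro!: derivative_eq_intros simp: algebra_simps)
      show "(sinh y - y * cosh y) * exp (- y\<^sup>2 / 2) \<le> 0"
        using sinh_le_mult_cosh[OF \<open>0 \<le> y\<close>] by (intro mult_nonpos_nonneg) auto
    qed
    then show ?thesis by (simp add: exp_minus field_simps)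
  qed
  from *[of "\<bar>x\<bar>"] show ?thesis by simp
qed

text \<open>The form in which a single sign is integrated out: up to a common factor 1/2, the left
  side is \<open>a\<close> times the difference of the two values of an exponential, the right side
  \<open>t * a\<^sup>2\<close> times their sum.\<close>

lemma mult_sinh_le:
  fixes a t :: real
  assumes "0 \<le> t" shows "a * sinh (t * a) \<le> t * a\<^sup>2 * cosh (t * a)"
proof (cases "0 \<le> a")
  case True
  then have "a * sinh (t * a) \<le> a * (t * a * cosh (t * a))"
    by (intro mult_left_mono sinh_le_mult_cosh) (use assms in auto)
  then show ?thesis by (simp add: power2_eq_square mult_ac)
next
  case False
  then have "- a * sinh (t * - a) \<le> - a * (t * - a * cosh (t * - a))"
    by (intro mult_left_mono sinh_le_mult_cosh) (use assms in \<open>auto simp: mult_nonneg_nonpos\<close>)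
  then show ?thesis by (simp add: power2_eq_square mult_ac)
qed

lemma sE_singleton:
  "sE {p} F = (F (\<lambda>x. if x = p then 1 else 0) + F (\<lambda>x. if x = p then -1 else 0)) / 2"
proof -
  have "iid_signs {p} = map_pmf (\<lambda>a x. if x = p then a else 0) (pmf_of_set {-1,1})"
    by (simp add: iid_signs_def Pi_pmf_singleton)
  then show ?thesis by (simp add: sE_def integral_pmf_of_set add.commute)
qed

lemma sE_coordinate:
  assumes "finite P" "p \<in> P"
  shows "sE P F = sE P (\<lambda>\<xi>. (F (\<xi>(p := 1)) + F (\<xi>(p := -1))) / 2)"
proof -
  have "(\<lambda>x. if x = p then if x = p then c else 0 else \<xi> x) = \<xi>(p := c)" for c and \<xi> :: "_ \<Rightarrow> real" by auto
  then show ?thesis using sE_resample[of P "{p}" F] assms by (simp add: sE_singleton)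
qed

text \<open>With \<open>q = \<Sum>\<^sub>i ((T \<xi>)\<^sub>i)\<^sup>2\<close> and \<open>G t = E (exp (t q))\<close>, resampling a single sign and using
  \<open>x sinh x \<le> x\<^sup>2 cosh x\<close> plays the role of Gaussian integration by parts and gives \<open>G' \<le> 3 |T|\<^sup>2 G\<close>,
  where \<open>|T|\<close> is the Frobenius norm.\<close>

lemma rademacher_quadratic_mgf:
  fixes T :: "'r \<Rightarrow> 'k \<Rightarrow> real"
  assumes fin: "finite P" "finite R" and b: "0 \<le> b" and lam: "0 \<le> lam" "8 * lam * b\<^sup>2 \<le> 1"
    and bound: "\<And>x. L2_set (\<lambda>i. \<Sum>p\<in>P. T i p * x p) R \<le> b * L2_set x P"
  shows "sE P (\<lambda>\<xi>. exp (lam * (\<Sum>i\<in>R. (\<Sum>p\<in>P. T i p * \<xi> p)\<^sup>2))) \<le> exp (3 * lam * (\<Sum>i\<in>R. \<Sum>p\<in>P. (T i p)\<^sup>2))"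
proof -
  define y where "y \<xi> i = (\<Sum>p\<in>P. T i p * \<xi> p)" for \<xi> i
  define qf where "qf \<xi> = (\<Sum>i\<in>R. (y \<xi> i)\<^sup>2)" for \<xi>
  \<comment> \<open>\<open>2 * a \<xi> p\<close> is the coefficient of the sign
    \<open>\<xi> p\<close> in \<open>qf\<close>, and \<open>a \<xi> p\<close> does not involve that
    sign; \<open>v\<close> is the transpose of \<open>T\<close> applied to \<open>y\<close> and
    exceeds \<open>a\<close> by the diagonal term \<open>m p * \<xi> p\<close>.\<close>
  define a where "a \<xi> p = (\<Sum>i\<in>R. T i p * (\<Sum>r\<in>P-{p}. T i r * \<xi> r))" for \<xi> p
  define v where "v \<xi> p = (\<Sum>i\<in>R. T i p * y \<xi> i)" for \<xi> p
  define m where "m p = (\<Sum>i\<in>R. (T i p)\<^sup>2)" for p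
  define tr where "tr = (\<Sum>p\<in>P. m p)"
  have tr_eq: "tr = (\<Sum>i\<in>R. \<Sum>p\<in>P. (T i p)\<^sup>2)" unfolding tr_def m_def by (rule sum.swap)
  have tr0: "0 \<le> tr" by (simp add: tr_eq sum_nonneg)
  have m0: "0 \<le> m p" for p by (simp add: m_def sum_nonneg)
  have y_split: "y \<xi> i = T i p * \<xi> p + (\<Sum>r\<in>P-{p}. T i r * \<xi> r)" if "p \<in> P" for \<xi> i p
    unfolding y_def using fin that by (simp add: sum.remove)
  have v_eq: "v \<xi> p = a \<xi> p + m p * \<xi> p" if "p \<in> P" for \<xi> p
    unfolding v_def a_def m_def y_split[OF that]
    by (simp add: sum.distrib ring_distribs sum_distrib_left power2_eq_square mult_ac)
  have qf_split: "qf \<xi> = (\<Sum>i\<in>R. (\<Sum>r\<in>P-{p}. T i r * \<xi> r)\<^sup>2) + 2 * \<xi> p * a \<xi> p + m p * (\<xi> p)\<^sup>2"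
    if "p \<in> P" for \<xi> p
    unfolding qf_def a_def m_def y_split[OF that]
    by (simp add: sum.distrib power2_sum sum_distrib_left sum_distrib_right power_mult_distrib mult_ac)
  have qf_eq: "qf \<xi> = (\<Sum>p\<in>P. \<xi> p * v \<xi> p)" for \<xi>
  proof -
    have "qf \<xi> = (\<Sum>i\<in>R. \<Sum>p\<in>P. \<xi> p * (T i p * y \<xi> i))"
      unfolding qf_def by (simp add: power2_eq_square y_def[of _ _] sum_distrib_right mult_ac)
    also have "\<dots> = (\<Sum>p\<in>P. \<xi> p * v \<xi> p)" by (subst sum.swap) (simp add: v_def sum_distrib_left)
    finally show ?thesis .
  qed
  have mb: "m p \<le> b\<^sup>2" if "p \<in> P" for p
  proof -
    have "L2_set (\<lambda>r. if r = p then 1 else 0) P = 1"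
      using that fin by (simp add: L2_set_def if_distrib[of "\<lambda>x. x\<^sup>2"] cong: if_cong)
    moreover have "(\<Sum>r\<in>P. T i r * (if r = p then 1 else 0)) = T i p" for i
      using that fin by (simp add: if_distrib cong: if_cong)
    ultimately have "L2_set (\<lambda>i. T i p) R \<le> b" using bound[of "\<lambda>r. if r = p then 1 else 0"] by simp
    then show ?thesis unfolding m_def L2_set_le_iff[OF b] .
  qed
  \<comment> \<open>The hypothesis bounds \<open>T\<close>; the same bound for its transpose follows
    by duality, since the squared length of \<open>v\<close> is the scalar product of
    \<open>y\<close> with the image of \<open>v\<close> under \<open>T\<close>.\<close>
  have vb: "(\<Sum>p\<in>P. (v \<xi> p)\<^sup>2) \<le> b\<^sup>2 * qf \<xi>" for \<xi>
  proof -
    have qfL: "qf \<xi> = (L2_set (y \<xi>) R)\<^sup>2" by (simp add: qf_def L2_set_power2)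
    have "L2_set (v \<xi>) P * L2_set (v \<xi>) P = (\<Sum>p\<in>P. v \<xi> p * (\<Sum>i\<in>R. T i p * y \<xi> i))"
      using L2_set_power2[of "v \<xi>" P] by (simp add: power2_eq_square v_def)
    also have "\<dots> = (\<Sum>p\<in>P. \<Sum>i\<in>R. y \<xi> i * (T i p * v \<xi> p))"
      by (simp add: sum_distrib_left mult_ac)
    also have "\<dots> = (\<Sum>i\<in>R. y \<xi> i * (\<Sum>p\<in>P. T i p * v \<xi> p))"
      by (subst sum.swap) (simp add: sum_distrib_left mult_ac)
    also have "\<dots> \<le> L2_set (y \<xi>) R * L2_set (\<lambda>i. \<Sum>p\<in>P. T i p * v \<xi> p) R"
      by (rule order_trans[OF abs_ge_self Cauchy_Schwarz_L2_set])
    also have "\<dots> \<le> L2_set (y \<xi>) R * (b * L2_set (v \<xi>) P)"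
      by (intro mult_left_mono bound) auto
    finally have "L2_set (v \<xi>) P * L2_set (v \<xi>) P \<le> (b * L2_set (y \<xi>) R) * L2_set (v \<xi>) P" by (simp add: mult_ac)
    then have "L2_set (v \<xi>) P \<le> b * L2_set (y \<xi>) R"
      using L2_set_nonneg[of "v \<xi>" P] mult_nonneg_nonneg[OF b L2_set_nonneg[of "y \<xi>" R]]
      by (cases "L2_set (v \<xi>) P = 0") auto
    then have "(L2_set (v \<xi>) P)\<^sup>2 \<le> (b * L2_set (y \<xi>) R)\<^sup>2" by (intro power_mono) auto
    then show ?thesis by (simp add: L2_set_power2[symmetric] qfL power_mult_distrib)
  qed
  have ab: "(\<Sum>p\<in>P. (a \<xi> p)\<^sup>2) \<le> 2 * b\<^sup>2 * (qf \<xi> + tr)" if \<xi>: "\<xi> \<in> signs P" for \<xi>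
  proof -
    have "(a \<xi> p)\<^sup>2 \<le> 2 * (v \<xi> p)\<^sup>2 + 2 * b\<^sup>2 * m p" if "p \<in> P" for p
    proof -
      have "a \<xi> p = v \<xi> p - m p * \<xi> p" using v_eq[OF that] by simp
      then have "(a \<xi> p)\<^sup>2 \<le> 2 * (v \<xi> p)\<^sup>2 + 2 * (m p * \<xi> p)\<^sup>2"
        using sum_squares_bound[of "v \<xi> p" "- (m p * \<xi> p)"] by (simp add: power2_diff)
      also have "(m p * \<xi> p)\<^sup>2 = m p * m p"
        using signs_square[OF \<xi> that] by (simp add: power2_eq_square mult_ac)
      also have "m p * m p \<le> b\<^sup>2 * m p" by (intro mult_right_mono mb m0 that)
      finally show ?thesis by simp
    qed
    then have "(\<Sum>p\<in>P. (a \<xi> p)\<^sup>2) \<le> (\<Sum>p\<in>P. 2 * (v \<xi> p)\<^sup>2 + 2 * b\<^sup>2 * m p)" by (rule sum_mono)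
    also have "\<dots> = 2 * (\<Sum>p\<in>P. (v \<xi> p)\<^sup>2) + 2 * b\<^sup>2 * tr"
      by (simp add: sum.distrib tr_def sum_distrib_left)
    finally show ?thesis using vb[of \<xi>] by (simp add: algebra_simps)
  qed
  have key: "sE P (\<lambda>\<xi>. \<xi> p * a \<xi> p * exp (t * qf \<xi>)) \<le> sE P (\<lambda>\<xi>. 2 * t * ((a \<xi> p)\<^sup>2 * exp (t * qf \<xi>)))"
    if p: "p \<in> P" and t: "0 \<le> t" for p t
  proof -
    have aupd: "a (\<xi>(p := c)) p = a \<xi> p" for \<xi> c unfolding a_def by (intro sum.cong refl arg_cong2[where f="(*)"]) auto
    have qupd: "qf (\<xi>(p := c)) = (\<Sum>i\<in>R. (\<Sum>r\<in>P-{p}. T i r * \<xi> r)\<^sup>2) + 2 * c * a \<xi> p + m p * c\<^sup>2" for \<xi> c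
      unfolding qf_split[OF p] aupd
      by (auto intro!: arg_cong2[where f="(+)"] sum.cong arg_cong[where f="\<lambda>x. x\<^sup>2"])
    show ?thesis
      unfolding sE_coordinate[OF fin(1) p, of "\<lambda>\<xi>. \<xi> p * a \<xi> p * exp (t * qf \<xi>)"]
        sE_coordinate[OF fin(1) p, of "\<lambda>\<xi>. 2 * t * ((a \<xi> p)\<^sup>2 * exp (t * qf \<xi>))"]
    proof (rule sE_mono[OF fin(1)])
      fix \<xi>
      define c where "c = exp (t * ((\<Sum>i\<in>R. (\<Sum>r\<in>P-{p}. T i r * \<xi> r)\<^sup>2) + m p))"
      define z where "z = a \<xi> p"
      have e1: "exp (t * qf (\<xi>(p := 1))) = c * exp (2 * t * z)"
        unfolding qupd c_def z_def exp_add[symmetric] by (simp add: algebra_simps)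
      have e2: "exp (t * qf (\<xi>(p := -1))) = c * exp (- (2 * t * z))"
        unfolding qupd c_def z_def exp_add[symmetric] by (simp add: algebra_simps)
      have "c * (z * sinh (2 * t * z)) \<le> c * (2 * t * z\<^sup>2 * cosh (2 * t * z))"
        by (intro mult_left_mono mult_sinh_le) (use t in \<open>auto simp: c_def\<close>)
      then show "((\<xi>(p := 1)) p * a (\<xi>(p := 1)) p * exp (t * qf (\<xi>(p := 1))) +
         (\<xi>(p := -1)) p * a (\<xi>(p := -1)) p * exp (t * qf (\<xi>(p := -1)))) / 2
        \<le> (2 * t * ((a (\<xi>(p := 1)) p)\<^sup>2 * exp (t * qf (\<xi>(p := 1)))) +
          2 * t * ((a (\<xi>(p := -1)) p)\<^sup>2 * exp (t * qf (\<xi>(p := -1))))) / 2"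
        unfolding aupd e1 e2 z_def[symmetric] sinh_field_def cosh_field_def
        by (simp add: field_simps)
    qed
  qed
  define G where "G t = sE P (\<lambda>\<xi>. exp (t * qf \<xi>))" for t
  define G' where "G' t = sE P (\<lambda>\<xi>. qf \<xi> * exp (t * qf \<xi>))" for t
  have deriv: "(G has_real_derivative G' t) (at t)" for t
    unfolding G_def G'_def sE_eq_sum[OF fin(1)]
    by (auto intro!: derivative_eq_intros simp: mult_ac)
  have qf0: "0 \<le> qf \<xi>" for \<xi> by (simp add: qf_def sum_nonneg)
  have G'0: "0 \<le> G' t" for t unfolding G'_def by (intro sE_nonneg fin) (simp add: qf0)
  have ineq: "G' t \<le> 3 * tr * G t" if t: "0 \<le> t" "t \<le> lam" for t
  proof -
    have "G' t = sE P (\<lambda>\<xi>. tr * exp (t * qf \<xi>) + (\<Sum>p\<in>P. \<xi> p * a \<xi> p * exp (t * qf \<xi>)))"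
      unfolding G'_def
    proof (rule sE_cong[OF fin(1)])
      fix \<xi> assume \<xi>: "\<xi> \<in> signs P"
      have "qf \<xi> = (\<Sum>p\<in>P. m p + \<xi> p * a \<xi> p)" unfolding qf_eq
      proof (rule sum.cong[OF refl])
        fix p assume "p \<in> P"
        then show "\<xi> p * v \<xi> p = m p + \<xi> p * a \<xi> p"
          using signs_square[OF \<xi>, of p] v_eq[of p \<xi>] by (simp add: algebra_simps)
      qed
      then show "qf \<xi> * exp (t * qf \<xi>) = tr * exp (t * qf \<xi>) + (\<Sum>p\<in>P. \<xi> p * a \<xi> p * exp (t * qf \<xi>))"
        by (simp add: sum.distrib tr_def ring_distribs flip: sum_distrib_right)
    qed
    also have "\<dots> = tr * G t + (\<Sum>p\<in>P. sE P (\<lambda>\<xi>. \<xi> p * a \<xi> p * exp (t * qf \<xi>)))"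
      by (simp add: sE_add sE_sum fin sE_cmult G_def)
    also have "(\<Sum>p\<in>P. sE P (\<lambda>\<xi>. \<xi> p * a \<xi> p * exp (t * qf \<xi>))) \<le> (\<Sum>p\<in>P. sE P (\<lambda>\<xi>. 2 * t * ((a \<xi> p)\<^sup>2 * exp (t * qf \<xi>))))"
      by (intro sum_mono key t)
    also have "\<dots> = sE P (\<lambda>\<xi>. 2 * t * ((\<Sum>p\<in>P. (a \<xi> p)\<^sup>2) * exp (t * qf \<xi>)))"
      by (simp add: sE_sum fin sum_distrib_left sum_distrib_right)
    also have "\<dots> \<le> sE P (\<lambda>\<xi>. 2 * t * (2 * b\<^sup>2 * (qf \<xi> + tr) * exp (t * qf \<xi>)))"
      by (intro sE_mono fin mult_left_mono mult_right_mono ab) (use t in auto)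
    also have "\<dots> = 4 * t * b\<^sup>2 * (G' t + tr * G t)"
    proof -
      have "(\<lambda>\<xi>. 2 * t * (2 * b\<^sup>2 * (qf \<xi> + tr) * exp (t * qf \<xi>)))
        = (\<lambda>\<xi>. 4 * t * b\<^sup>2 * (qf \<xi> * exp (t * qf \<xi>) + tr * exp (t * qf \<xi>)))"
        by (auto simp: fun_eq_iff algebra_simps)
      then show ?thesis by (simp add: sE_cmult sE_add fin G_def G'_def)
    qed
    \<comment> \<open>By \<open>8 * lam * b\<^sup>2 \<le> 1\<close> half of \<open>G' t\<close> can
      be absorbed on the left: \<open>G' \<le> tr * G + (G' + tr * G) / 2\<close> amounts to
      \<open>G' \<le> 3 * tr * G\<close>.\<close>
    also have "\<dots> \<le> (1/2) * (G' t + tr * G t)"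
    proof (rule mult_right_mono)
      have "4 * t * b\<^sup>2 \<le> 4 * lam * b\<^sup>2" using t by (intro mult_right_mono) auto
      then show "4 * t * b\<^sup>2 \<le> 1/2" using lam by linarith
      show "0 \<le> G' t + tr * G t" using G'0[of t] tr0
        by (auto simp: G_def intro!: add_nonneg_nonneg mult_nonneg_nonneg sE_nonneg fin)
    qed
    finally show ?thesis by (simp add: algebra_simps)
  qed
  have "G lam * exp (- 3 * tr * lam) \<le> G 0 * exp (- 3 * tr * 0)"
  proof (rule DERIV_nonpos_imp_nonincreasing[OF lam(1)], intro exI conjI)
    fix t assume t: "0 \<le> t" "t \<le> lam"
    show "((\<lambda>t. G t * exp (- 3 * tr * t)) has_real_derivative (G' t - 3 * tr * G t) * exp (- 3 * tr * t)) (at t)"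
      by (auto intro!: derivative_eq_intros deriv simp: algebra_simps)
    show "(G' t - 3 * tr * G t) * exp (- 3 * tr * t) \<le> 0"
      using ineq[OF t] by (intro mult_nonpos_nonneg) auto
  qed
  then have "G lam \<le> exp (3 * lam * tr)" by (simp add: G_def exp_minus field_simps)
  then show ?thesis by (simp add: G_def qf_def y_def tr_eq)
qed

section \<open>Nets, and the norm of a fixed matrix times a sign matrix\<close>

lemma sum_half_powers: "(\<Sum>m\<in>{-int N..int N}. (1/2::real) ^ nat \<bar>m\<bar>) = 3 - 2 * (1/2) ^ N"
proof (induction N)
  case (Suc N)
  have "{-int (Suc N)..int (Suc N)} = insert (int (Suc N)) (insert (- int (Suc N)) {-int N..int N})" by auto
  then show ?case using Suc by (simp add: nat_add_distrib)
qed simp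

text \<open>The net consists of lattice points of mesh \<open>1 / (2 sqrt (card S))\<close>; rounding towards \<open>0\<close> stays in
  the unit ball.\<close>

lemma unit_ball_net:
  fixes S :: "'a set"
  assumes "finite S" "S \<noteq> {}"
  obtains Net :: "('a \<Rightarrow> real) set" where "finite Net" "real (card Net) \<le> 48 ^ card S"
    "\<And>z. z \<in> Net \<Longrightarrow> L2_set z S \<le> 1"
    "\<And>y. L2_set y S \<le> 1 \<Longrightarrow> \<exists>z\<in>Net. L2_set (\<lambda>l. y l - z l) S \<le> 1/2"
proof -
  define k where "k = card S"
  have k: "k > 0" using assms by (simp add: k_def card_gt_0_iff)
  define c where "c = 2 * sqrt (real k)"
  have c: "c > 0" "c\<^sup>2 = 4 * real k" using k by (auto simp: c_def power_mult_distrib)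
  define X where "X = {-int (4 * k)..int (4 * k)}"
  define Z where "Z = {z \<in> S \<rightarrow>\<^sub>E X. (\<Sum>l\<in>S. (z l)\<^sup>2) \<le> 4 * int k}"
  define Net where "Net = (\<lambda>z l. real_of_int (z l) / c) ` Z"
  have finPi: "finite (S \<rightarrow>\<^sub>E X)" using assms by (intro finite_PiE) (auto simp: X_def)
  then have finZ: "finite Z" by (simp add: Z_def)
  have absle: "\<bar>z\<bar> \<le> z\<^sup>2" for z :: int
    using self_le_power[of "\<bar>z\<bar>" 2] by (cases "z = 0") auto
  have "real (card Z) = (\<Sum>z\<in>Z. 1)" by simp
  \<comment> \<open>Counting by exponential weights. Integers satisfy
    \<open>\<bar>z\<bar> \<le> z\<^sup>2\<close>, so the absolute values of a point of
    \<open>Z\<close> sum to at most \<open>4 * k\<close> and its weight is at least 1. The total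
    weight factorises over the coordinates, each of mass below 3, and
    \<open>16 * 3 = 48\<close>.\<close>
  also have "\<dots> \<le> (\<Sum>z\<in>Z. 16 ^ k * (\<Prod>l\<in>S. (1/2) ^ nat \<bar>z l\<bar>))"
  proof (rule sum_mono)
    fix z assume z: "z \<in> Z"
    have "int (\<Sum>l\<in>S. nat \<bar>z l\<bar>) = (\<Sum>l\<in>S. \<bar>z l\<bar>)" by simp
    also have "\<dots> \<le> (\<Sum>l\<in>S. (z l)\<^sup>2)" by (intro sum_mono absle)
    also have "\<dots> \<le> int (4 * k)" using z by (simp add: Z_def)
    finally have "(\<Sum>l\<in>S. nat \<bar>z l\<bar>) \<le> 4 * k" by linarith
    then have "(1/2::real) ^ (4 * k) \<le> (1/2) ^ (\<Sum>l\<in>S. nat \<bar>z l\<bar>)" by (intro power_decreasing) auto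
    then have "16 ^ k * (1/2::real) ^ (4 * k) \<le> 16 ^ k * (\<Prod>l\<in>S. (1/2) ^ nat \<bar>z l\<bar>)"
      by (intro mult_left_mono) (auto simp: power_sum)
    moreover have "16 ^ k * (1/2::real) ^ (4 * k) = (16 * (1/2) ^ 4) ^ k"
      by (simp only: power_mult power_mult_distrib)
    then have "16 ^ k * (1/2::real) ^ (4 * k) = 1" by (simp add: power_divide)
    ultimately show "(1::real) \<le> 16 ^ k * (\<Prod>l\<in>S. (1/2) ^ nat \<bar>z l\<bar>)" by linarith
  qed
  also have "\<dots> \<le> (\<Sum>z\<in>S \<rightarrow>\<^sub>E X. 16 ^ k * (\<Prod>l\<in>S. (1/2) ^ nat \<bar>z l\<bar>))"
    by (intro sum_mono2 finPi) (auto simp: Z_def intro!: mult_nonneg_nonneg prod_nonneg)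
  also have "\<dots> = 16 ^ k * (\<Prod>l\<in>S. \<Sum>m\<in>X. (1/2) ^ nat \<bar>m\<bar>)"
    by (subst prod_sum_PiE) (auto simp: assms X_def sum_distrib_left)
  also have "(\<Sum>m\<in>X. (1/2::real) ^ nat \<bar>m\<bar>) = 3 - 2 * (1/2) ^ (4 * k)"
    unfolding X_def by (rule sum_half_powers)
  also have "16 ^ k * (\<Prod>l\<in>S. 3 - 2 * (1/2::real) ^ (4 * k)) \<le> 16 ^ k * 3 ^ k"
  proof (rule mult_left_mono)
    have "(1/2::real) ^ (4 * k) \<le> 1" "(0::real) \<le> (1/2) ^ (4 * k)" by (simp_all add: power_le_one)
    then have "(3 - 2 * (1/2::real) ^ (4 * k)) ^ k \<le> 3 ^ k" by (intro power_mono) linarith+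
    then show "(\<Prod>l\<in>S. 3 - 2 * (1/2::real) ^ (4 * k)) \<le> 3 ^ k" by (simp add: k_def)
  qed simp
  also have "\<dots> = 48 ^ card S" unfolding k_def power_mult_distrib[symmetric] by simp
  finally have cardZ: "real (card Z) \<le> 48 ^ card S" .
  show thesis
  proof (rule that[of Net])
    show "finite Net" using finZ by (simp add: Net_def)
    show "real (card Net) \<le> 48 ^ card S"
      using cardZ card_image_le[OF finZ, of "\<lambda>z l. real_of_int (z l) / c"] unfolding Net_def by linarith
    show "L2_set z S \<le> 1" if "z \<in> Net" for z
    proof -
      obtain w where w: "w \<in> Z" "z = (\<lambda>l. real_of_int (w l) / c)" using \<open>z \<in> Net\<close> by (auto simp: Net_def)
      have "real_of_int (\<Sum>l\<in>S. (w l)\<^sup>2) \<le> 4 * real k"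
      proof -
        have "(\<Sum>l\<in>S. (w l)\<^sup>2) \<le> 4 * int k" using w(1) by (simp add: Z_def)
        then have "real_of_int (\<Sum>l\<in>S. (w l)\<^sup>2) \<le> real_of_int (4 * int k)" by (simp only: of_int_le_iff)
        then show ?thesis by simp
      qed
      then have "(\<Sum>l\<in>S. (z l)\<^sup>2) \<le> 1" using c k
        by (simp add: w(2) power_divide flip: sum_divide_distrib)
      then show ?thesis by (simp add: L2_set_le_iff)
    qed
    show "\<exists>z\<in>Net. L2_set (\<lambda>l. y l - z l) S \<le> 1/2" if y: "L2_set y S \<le> 1" for y
    proof -
      define w where "w = (\<lambda>l\<in>S. if 0 \<le> y l then \<lfloor>c * y l\<rfloor> else - \<lfloor>- c * y l\<rfloor>)"
      have wle: "\<bar>real_of_int (w l)\<bar> \<le> c * \<bar>y l\<bar>" and werr: "\<bar>c * y l - real_of_int (w l)\<bar> \<le> 1" if "l \<in> S" for l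
      proof -
        have "\<bar>real_of_int \<lfloor>t\<rfloor>\<bar> \<le> t" "\<bar>t - real_of_int \<lfloor>t\<rfloor>\<bar> \<le> 1" if "0 \<le> t" for t :: real
        proof -
          have "real_of_int \<lfloor>t\<rfloor> \<le> t" "t < real_of_int \<lfloor>t\<rfloor> + 1" "0 \<le> real_of_int \<lfloor>t\<rfloor>"
            using that by simp_all
          then show "\<bar>real_of_int \<lfloor>t\<rfloor>\<bar> \<le> t" "\<bar>t - real_of_int \<lfloor>t\<rfloor>\<bar> \<le> 1"
            unfolding abs_le_iff by linarith+
        qed
        note flr = this
        have "\<bar>real_of_int (w l)\<bar> \<le> c * \<bar>y l\<bar> \<and> \<bar>c * y l - real_of_int (w l)\<bar> \<le> 1"
        proof (cases "0 \<le> y l")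
          case True
          then show ?thesis using flr[of "c * y l"] c(1) that by (simp add: w_def)
        next
          case False
          define t where "t = - (c * y l)"
          have "0 \<le> t" using False c(1) by (simp add: t_def mult_nonneg_nonpos)
          moreover have "w l = - \<lfloor>t\<rfloor>" "c * \<bar>y l\<bar> = t" "c * y l = - t" using False that by (simp_all add: w_def t_def)
          ultimately show ?thesis using flr[of t] by simp
        qed
        then show "\<bar>real_of_int (w l)\<bar> \<le> c * \<bar>y l\<bar>" "\<bar>c * y l - real_of_int (w l)\<bar> \<le> 1" by blast+
      qed
      have sq: "(real_of_int (w l))\<^sup>2 \<le> 4 * real k * (y l)\<^sup>2" if "l \<in> S" for l
      proof -
        have "\<bar>real_of_int (w l)\<bar>\<^sup>2 \<le> (c * \<bar>y l\<bar>)\<^sup>2" by (intro power_mono wle that) auto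
        then show ?thesis by (simp add: power_mult_distrib c)
      qed
      have "(\<Sum>l\<in>S. (real_of_int (w l))\<^sup>2) \<le> (\<Sum>l\<in>S. 4 * real k * (y l)\<^sup>2)" by (intro sum_mono sq)
      also have "\<dots> = 4 * real k * (\<Sum>l\<in>S. (y l)\<^sup>2)" by (simp add: sum_distrib_left)
      also have "\<dots> \<le> 4 * real k * 1" using y by (intro mult_left_mono) (auto simp: L2_set_le_iff)
      finally have "real_of_int (\<Sum>l\<in>S. (w l)\<^sup>2) \<le> real_of_int (4 * int k)" by simp
      then have sum_le: "(\<Sum>l\<in>S. (w l)\<^sup>2) \<le> 4 * int k" by linarith
      have "w l \<in> X" if "l \<in> S" for l
      proof -
        have "\<bar>w l\<bar> \<le> (w l)\<^sup>2" by (rule absle)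
        also have "\<dots> \<le> (\<Sum>l\<in>S. (w l)\<^sup>2)" using that assms by (intro member_le_sum) auto
        finally show ?thesis using sum_le by (auto simp: X_def)
      qed
      then have "w \<in> Z" using sum_le by (auto simp: Z_def w_def)
      moreover have "L2_set (\<lambda>l. y l - real_of_int (w l) / c) S \<le> 1/2"
      proof (subst L2_set_le_iff)
        have "(y l - real_of_int (w l) / c)\<^sup>2 \<le> 1 / (4 * real k)" if "l \<in> S" for l
        proof -
          have "\<bar>c * y l - real_of_int (w l)\<bar>\<^sup>2 \<le> 1\<^sup>2" by (intro power_mono werr that) auto
          moreover have "y l - real_of_int (w l) / c = (c * y l - real_of_int (w l)) / c" using c by (simp add: field_simps)
          ultimately show ?thesis using k by (simp add: power_divide c divide_right_mono)
        qed
        then have "(\<Sum>l\<in>S. (y l - real_of_int (w l) / c)\<^sup>2) \<le> (\<Sum>l\<in>S. 1 / (4 * real k))" by (rule sum_mono)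
        also have "\<dots> = (1/2)\<^sup>2" using k by (simp add: k_def[symmetric] power2_eq_square)
        finally show "(\<Sum>l\<in>S. (y l - real_of_int (w l) / c)\<^sup>2) \<le> (1/2)\<^sup>2" .
      qed simp
      ultimately show ?thesis
        by (intro bexI[of _ "\<lambda>l. real_of_int (w l) / c"]) (auto simp: Net_def)
    qed
  qed
qed

text \<open>Half of the norm is absorbed: a vector of the unit ball is within 1/2 of the net, and
  the image of the error is controlled by the norm itself.\<close>

lemma mat_opnorm_net:
  assumes "finite S" "finite Net"
    "\<And>y. L2_set y S \<le> 1 \<Longrightarrow> \<exists>z\<in>Net. L2_set (\<lambda>l. y l - z l) S \<le> 1/2"
  obtains z where "z \<in> Net" "mat_opnorm R S A \<le> 2 * L2_set (\<lambda>i. \<Sum>j\<in>S. A i j * z j) R"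
proof -
  let ?f = "\<lambda>z. L2_set (\<lambda>i. \<Sum>j\<in>S. A i j * z j) R"
  have "Net \<noteq> {}" using assms(3)[of "\<lambda>_. 0"] by (auto simp: L2_set_def)
  then have "Max (?f ` Net) \<in> ?f ` Net" using assms(2) by (intro Max_in) auto
  then obtain z where z: "z \<in> Net" "?f z = Max (?f ` Net)" by force
  have "mat_opnorm R S A \<le> ?f z + mat_opnorm R S A / 2"
  proof (rule mat_opnorm_least)
    fix y assume "L2_set y S \<le> 1"
    then obtain w where w: "w \<in> Net" "L2_set (\<lambda>l. y l - w l) S \<le> 1/2" using assms(3) by blast
    have "?f y = L2_set (\<lambda>i. (\<Sum>j\<in>S. A i j * w j) + (\<Sum>j\<in>S. A i j * (y j - w j))) R"
      by (simp add: algebra_simps flip: sum.distrib)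
    also have "\<dots> \<le> ?f w + ?f (\<lambda>l. y l - w l)" by (rule L2_set_triangle_ineq)
    also have "?f (\<lambda>l. y l - w l) \<le> mat_opnorm R S A * (1/2)"
      by (rule order_trans[OF mat_opnorm_apply[OF assms(1)]])
        (intro mult_left_mono w mat_opnorm_nonneg)
    also have "?f w \<le> ?f z" unfolding z(2) using w assms(2) by (intro Max_ge) auto
    finally show "?f y \<le> ?f z + mat_opnorm R S A / 2" by simp
  qed
  then show thesis using z by (intro that[of z]) auto
qed

lemma exp_4_ge: "(48::real) \<le> exp 4"
proof -
  have "(48::real) \<le> (8/3) ^ 4" by (simp add: power_divide)
  also have "(8/3::real) \<le> exp 1"
    using e_approx_32 by (simp add: abs_if split: if_splits)
  then have "(8/3::real) ^ 4 \<le> exp 1 ^ 4" by (intro power_mono) auto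
  also have "exp 1 ^ 4 = exp (4::real)" by (simp flip: exp_of_nat_mult)
  finally show ?thesis .
qed

lemma sum_Times: "(\<Sum>p\<in>X \<times> S. g p) = (\<Sum>a\<in>X. \<Sum>s\<in>S. g (a, s))"
  by (simp add: sum.cartesian_product)

text \<open>The row side needs no net, because the squared length of the image of one vector is a
  quadratic form whose exponential moment is known. The union over the net on the column side costs
  \<open>4 * card S\<close> in the exponent, and the Frobenius norm enters through the mean of the
  quadratic form.\<close>

lemma sE_mat_opnorm_sign_matrix_aux:
  fixes B :: "'r \<Rightarrow> 'x \<Rightarrow> real" and S :: "'y set"
  assumes fin: "finite R" "finite X" "finite S" and "S \<noteq> {}" and b: "0 < b" "mat_opnorm R X B \<le> b"
  shows "sE (X \<times> S) (\<lambda>\<eta>. mat_opnorm R S (\<lambda>i s. \<Sum>a\<in>X. B i a * \<eta> (a, s)))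
    \<le> 12 * b * sqrt (real (card S)) + 4 * frobenius R X B"
proof -
  define f where "f = frobenius R X B"
  have f0: "0 \<le> f" by (simp add: f_def frobenius_nonneg)
  define k where "k = real (card S)"
  define M where "M \<eta> i s = (\<Sum>a\<in>X. B i a * \<eta> (a, s))" for \<eta> i and s :: 'y
  \<comment> \<open>The largest parameter that \<open>rademacher_quadratic_mgf\<close> admits for
    the bound \<open>b\<close>.\<close>
  define lam where "lam = 1 / (8 * b\<^sup>2)"
  have lam: "lam > 0" "8 * lam * b\<^sup>2 = 1" using b by (auto simp: lam_def)
  have finK: "finite (X \<times> S)" using fin by simp
  obtain Net :: "('y \<Rightarrow> real) set" where Net: "finite Net" "real (card Net) \<le> 48 ^ card S"
    "\<And>z. z \<in> Net \<Longrightarrow> L2_set z S \<le> 1"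
    "\<And>y. L2_set y S \<le> 1 \<Longrightarrow> \<exists>z\<in>Net. L2_set (\<lambda>l. y l - z l) S \<le> 1/2"
    using unit_ball_net[OF fin(3) assms(4)] by metis
  have mgf: "sE (X \<times> S) (\<lambda>\<eta>. exp (lam * (\<Sum>i\<in>R. (\<Sum>s\<in>S. M \<eta> i s * z s)\<^sup>2))) \<le> exp (3 * lam * f\<^sup>2)"
    if z: "L2_set z S \<le> 1" for z
  proof -
    \<comment> \<open>The tensor of \<open>B\<close> with the vector \<open>z\<close>. As
      \<open>z\<close> lies in the unit ball, neither the operator norm nor the Frobenius norm
      exceeds that of \<open>B\<close>.\<close>
    define T where "T i p = B i (fst p) * z (snd p)" for i and p :: "'x \<times> 'y"
    have zz: "(\<Sum>s\<in>S. (z s)\<^sup>2) \<le> 1" using z by (simp add: L2_set_le_iff)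
    have eq: "(\<Sum>s\<in>S. M \<eta> i s * z s) = (\<Sum>p\<in>X \<times> S. T i p * \<eta> p)" for \<eta> i
    proof -
      have "(\<Sum>p\<in>X \<times> S. T i p * \<eta> p) = (\<Sum>a\<in>X. \<Sum>s\<in>S. B i a * z s * \<eta> (a, s))"
        by (simp add: sum_Times T_def)
      also have "\<dots> = (\<Sum>s\<in>S. \<Sum>a\<in>X. B i a * z s * \<eta> (a, s))" by (rule sum.swap)
      finally show ?thesis by (simp add: M_def sum_distrib_left sum_distrib_right mult_ac)
    qed
    have bd: "L2_set (\<lambda>i. \<Sum>p\<in>X \<times> S. T i p * x p) R \<le> b * L2_set x (X \<times> S)" for x
    proof -
      define w where "w a = (\<Sum>s\<in>S. z s * x (a, s))" for a
      have "(\<Sum>p\<in>X \<times> S. T i p * x p) = (\<Sum>a\<in>X. B i a * w a)" for i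
        by (simp add: sum_Times T_def w_def sum_distrib_left mult_ac)
      then have "L2_set (\<lambda>i. \<Sum>p\<in>X \<times> S. T i p * x p) R = L2_set (\<lambda>i. \<Sum>a\<in>X. B i a * w a) R" by simp
      also have "\<dots> \<le> mat_opnorm R X B * L2_set w X" by (rule mat_opnorm_apply[OF fin(2)])
      also have "\<dots> \<le> b * L2_set x (X \<times> S)"
      proof (intro mult_mono b)
        have "(w a)\<^sup>2 \<le> 1 * (\<Sum>s\<in>S. (x (a, s))\<^sup>2)" for a
          unfolding w_def by (rule order_trans[OF Cauchy_Schwarz_ineq_sum])
            (intro mult_right_mono zz sum_nonneg, auto)
        then have "(\<Sum>a\<in>X. (w a)\<^sup>2) \<le> (\<Sum>a\<in>X. \<Sum>s\<in>S. (x (a, s))\<^sup>2)" by (intro sum_mono) auto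
        also have "\<dots> = (L2_set x (X \<times> S))\<^sup>2"
          by (simp add: L2_set_power2 sum_Times)
        finally show "L2_set w X \<le> L2_set x (X \<times> S)" by (subst L2_set_le_iff) auto
      qed (use b in auto)
      finally show ?thesis .
    qed
    have "(\<Sum>i\<in>R. \<Sum>p\<in>X \<times> S. (T i p)\<^sup>2) = (\<Sum>i\<in>R. \<Sum>a\<in>X. (B i a)\<^sup>2 * (\<Sum>s\<in>S. (z s)\<^sup>2))"
      by (simp add: sum_Times T_def power_mult_distrib sum_distrib_left)
    also have "\<dots> \<le> (\<Sum>i\<in>R. \<Sum>a\<in>X. (B i a)\<^sup>2 * 1)" by (intro sum_mono mult_left_mono zz) auto
    also have "\<dots> = f\<^sup>2" by (simp add: f_def frobenius_power2)
    finally have ff: "(\<Sum>i\<in>R. \<Sum>p\<in>X \<times> S. (T i p)\<^sup>2) \<le> f\<^sup>2" .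
    have "sE (X \<times> S) (\<lambda>\<eta>. exp (lam * (\<Sum>i\<in>R. (\<Sum>p\<in>X \<times> S. T i p * \<eta> p)\<^sup>2))) \<le> exp (3 * lam * (\<Sum>i\<in>R. \<Sum>p\<in>X \<times> S. (T i p)\<^sup>2))"
      by (rule rademacher_quadratic_mgf[where b=b]) (use fin finK b lam bd in auto)
    also have "\<dots> \<le> exp (3 * lam * f\<^sup>2)" using ff lam by simp
    finally show ?thesis by (simp add: eq)
  qed
  let ?n = "\<lambda>\<eta>. mat_opnorm R S (M \<eta>)"
  have "exp (sE (X \<times> S) (\<lambda>\<eta>. lam * (?n \<eta>)\<^sup>2 / 4)) \<le> sE (X \<times> S) (\<lambda>\<eta>. exp (lam * (?n \<eta>)\<^sup>2 / 4))"
    by (rule exp_sE_le[OF finK])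
  also have "\<dots> \<le> sE (X \<times> S) (\<lambda>\<eta>. \<Sum>z\<in>Net. exp (lam * (\<Sum>i\<in>R. (\<Sum>s\<in>S. M \<eta> i s * z s)\<^sup>2)))"
  proof (rule sE_mono[OF finK])
    fix \<eta>
    obtain z where z: "z \<in> Net" "?n \<eta> \<le> 2 * L2_set (\<lambda>i. \<Sum>j\<in>S. M \<eta> i j * z j) R"
      using mat_opnorm_net[OF fin(3) Net(1) Net(4), of R "M \<eta>"] by metis
    have "(?n \<eta>)\<^sup>2 \<le> (2 * L2_set (\<lambda>i. \<Sum>j\<in>S. M \<eta> i j * z j) R)\<^sup>2"
      by (intro power_mono z mat_opnorm_nonneg)
    then have "(?n \<eta>)\<^sup>2 / 4 \<le> (\<Sum>i\<in>R. (\<Sum>s\<in>S. M \<eta> i s * z s)\<^sup>2)"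
      by (simp add: power_mult_distrib L2_set_power2)
    then have "lam * ((?n \<eta>)\<^sup>2 / 4) \<le> lam * (\<Sum>i\<in>R. (\<Sum>s\<in>S. M \<eta> i s * z s)\<^sup>2)"
      using lam by (intro mult_left_mono) auto
    then have "exp (lam * (?n \<eta>)\<^sup>2 / 4) \<le> exp (lam * (\<Sum>i\<in>R. (\<Sum>s\<in>S. M \<eta> i s * z s)\<^sup>2))" by simp
    also have "\<dots> \<le> (\<Sum>z\<in>Net. exp (lam * (\<Sum>i\<in>R. (\<Sum>s\<in>S. M \<eta> i s * z s)\<^sup>2)))"
      by (rule member_le_sum[OF z(1)]) (use Net in auto)
    finally show "exp (lam * (?n \<eta>)\<^sup>2 / 4) \<le> \<dots>" .
  qed
  also have "\<dots> = (\<Sum>z\<in>Net. sE (X \<times> S) (\<lambda>\<eta>. exp (lam * (\<Sum>i\<in>R. (\<Sum>s\<in>S. M \<eta> i s * z s)\<^sup>2))))"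
    by (rule sE_sum[OF finK])
  also have "\<dots> \<le> (\<Sum>z\<in>Net. exp (3 * lam * f\<^sup>2))" by (intro sum_mono mgf Net)
  also have "\<dots> \<le> exp 4 ^ card S * exp (3 * lam * f\<^sup>2)"
    using order_trans[OF Net(2) power_mono[OF exp_4_ge]] by (simp add: mult_right_mono)
  also have "\<dots> = exp (4 * k + 3 * lam * f\<^sup>2)" by (simp add: k_def exp_add mult.commute flip: exp_of_nat_mult)
  finally have "sE (X \<times> S) (\<lambda>\<eta>. lam * (?n \<eta>)\<^sup>2 / 4) \<le> 4 * k + 3 * lam * f\<^sup>2" by simp
  then have "lam / 4 * sE (X \<times> S) (\<lambda>\<eta>. (?n \<eta>)\<^sup>2) \<le> 4 * k + 3 * lam * f\<^sup>2"
    by (simp add: sE_cmult sE_divide)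
  then have "sE (X \<times> S) (\<lambda>\<eta>. (?n \<eta>)\<^sup>2) \<le> 128 * b\<^sup>2 * k + 12 * f\<^sup>2"
    using b by (simp add: lam_def field_simps)
  then have "(sE (X \<times> S) ?n)\<^sup>2 \<le> 128 * b\<^sup>2 * k + 12 * f\<^sup>2"
    using sE_square_le[OF finK, of ?n] by linarith
  \<comment> \<open>128 and 12 are rounded up to the squares 144 and 16; the mixed term is
    nonnegative.\<close>
  also have "\<dots> \<le> (12 * b * sqrt k + 4 * f)\<^sup>2"
  proof -
    have "(12 * b * sqrt k + 4 * f)\<^sup>2 = 144 * b\<^sup>2 * k + 16 * f\<^sup>2 + 96 * (b * sqrt k * f)"
      by (simp add: power2_sum power_mult_distrib k_def)
    moreover have "0 \<le> b * sqrt k * f" "0 \<le> b\<^sup>2 * k" "0 \<le> f\<^sup>2" using b f0 by (auto simp: k_def)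
    ultimately show ?thesis by linarith
  qed
  finally have "sE (X \<times> S) ?n \<le> 12 * b * sqrt k + 4 * f"
    by (rule power2_le_imp_le) (use b f0 in \<open>auto simp: k_def\<close>)
  then show ?thesis by (simp add: M_def[abs_def] k_def f_def)
qed

text \<open>\<open>pos\<close> lets the sign matrix be a piece of a larger family, as the arrays of
  the chain are. An empty \<open>S\<close> and a vanishing \<open>B\<close> are settled
  separately.\<close>

lemma sE_mat_opnorm_sign_matrix:
  fixes B :: "'r \<Rightarrow> 'x \<Rightarrow> real" and S :: "'y set"
  assumes fin: "finite P" "finite R" "finite X" "finite S"
    and inj: "inj_on (\<lambda>(a, s). pos a s) (X \<times> S)" and pos: "\<And>a s. a \<in> X \<Longrightarrow> s \<in> S \<Longrightarrow> pos a s \<in> P"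
  shows "sE P (\<lambda>\<xi>. mat_opnorm R S (\<lambda>i s. \<Sum>a\<in>X. B i a * \<xi> (pos a s)))
    \<le> 12 * mat_opnorm R X B * sqrt (real (card S)) + 4 * frobenius R X B"
proof -
  let ?b = "mat_opnorm R X B"
  have rhs: "0 \<le> 12 * ?b * sqrt (real (card S)) + 4 * frobenius R X B"
    by (intro add_nonneg_nonneg mult_nonneg_nonneg mat_opnorm_nonneg frobenius_nonneg) auto
  consider "S = {}" | "?b = 0" | "S \<noteq> {}" "?b > 0" using mat_opnorm_nonneg[of R X B] by linarith
  then show ?thesis
  proof cases
    case 1
    then have "mat_opnorm R S A = 0" for A :: "'r \<Rightarrow> 'y \<Rightarrow> real"
    proof -
      have "mat_opnorm R S A = mat_opnorm R S (\<lambda>i j. 0)" by (rule mat_opnorm_cong) (use 1 in auto)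
      then show ?thesis by simp
    qed
    then show ?thesis using rhs by simp
  next
    case 2
    then have "B i a = 0" if "i \<in> R" "a \<in> X" for i a
      using mat_opnorm_entry_zero[of R X B i a] fin that by simp
    then have "mat_opnorm R S (\<lambda>i s. \<Sum>a\<in>X. B i a * \<xi> (pos a s)) = mat_opnorm R S (\<lambda>i s. 0)" for \<xi>
      by (intro mat_opnorm_cong sum.neutral) auto
    then show ?thesis using rhs by simp
  next
    case 3
    let ?F = "\<lambda>\<eta>. mat_opnorm R S (\<lambda>i s. \<Sum>a\<in>X. B i a * \<eta> (a, s))"
    have "sE P (\<lambda>\<xi>. ?F (\<lambda>p. \<xi> (case p of (a, s) \<Rightarrow> pos a s))) = sE (X \<times> S) ?F"
    proof (rule sE_reindex'[OF fin(1) inj])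
      show "depends (X \<times> S) ?F" unfolding depends_def
        by (intro allI impI mat_opnorm_cong sum.cong refl) auto
    qed (use pos in auto)
    also have "\<dots> \<le> 12 * ?b * sqrt (real (card S)) + 4 * frobenius R X B"
      by (rule sE_mat_opnorm_sign_matrix_aux) (use fin 3 in auto)
    finally show ?thesis by simp
  qed
qed

section \<open>Layers of a diagonal factor\<close>

lemma clip_sum: "0 \<le> T \<Longrightarrow> (\<Sum>s<m. max 0 (min (x - real s * T) T)) = max 0 (min x (real m * T))"
proof (induction m)
  case (Suc m)
  have "max 0 (min x y) + max 0 (min (x - y) T) = max 0 (min x (y + T))" if "0 \<le> y" for y
    using that \<open>0 \<le> T\<close> by (auto simp: max_def min_def)
  from this[of "real m * T"] show ?case using Suc by (simp add: algebra_simps)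
qed simp

lemma sum_inverse_squares_le: "(\<Sum>s=1..<m. 1 / (real s)\<^sup>2) \<le> 2"
proof -
  have *: "(\<Sum>s=1..<Suc m. 1 / (real s)\<^sup>2) \<le> 2 - 1 / real m" if "m \<ge> 1" for m
    using that
  proof (induction m rule: dec_induct)
    case (step m)
    then have "1 / (real (Suc m))\<^sup>2 \<le> 1 / (real m * real (Suc m))"
      unfolding power2_eq_square by (intro divide_left_mono mult_right_mono mult_pos_pos) auto
    also have "\<dots> = 1 / real m - 1 / real (Suc m)" using step by (simp add: field_simps)
    finally show ?case using step by simp
  qed simp
  show ?thesis
  proof (cases "m \<ge> 2")
    case True
    then have "(\<Sum>s=1..<m. 1 / (real s)\<^sup>2) \<le> 2 - 1 / real (m - 1)" using *[of "m - 1"] by simp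
    also have "\<dots> \<le> 2" by simp
    finally show ?thesis .
  qed (auto simp: not_le)
qed

text \<open>A Chevet type inequality. The diagonal factor is cut into layers of height \<open>T\<close>; the \<open>s\<close>-th layer lives
  on the few columns where \<open>\<bar>d\<bar>\<close> exceeds \<open>s T\<close>, so that summing over the layers loses no logarithm.\<close>

lemma sE_mat_opnorm_sign_matrix_diag:
  fixes B :: "'r \<Rightarrow> 'x \<Rightarrow> real" and d :: "'y \<Rightarrow> real"
  assumes fin: "finite P" "finite R" "finite X" "finite C"
    and inj: "inj_on (\<lambda>(a, s). pos a s) (X \<times> C)" and pos: "\<And>a s. a \<in> X \<Longrightarrow> s \<in> C \<Longrightarrow> pos a s \<in> P"
    and T: "0 < T" and D: "0 \<le> D" "\<And>l. l \<in> C \<Longrightarrow> \<bar>d l\<bar> \<le> D"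
  shows "sE P (\<lambda>\<xi>. mat_opnorm R C (\<lambda>i l. (\<Sum>a\<in>X. B i a * \<xi> (pos a l)) * d l))
    \<le> 4 * frobenius R X B * (D + T)
      + 12 * mat_opnorm R X B * (T * sqrt (real (card C)) + 2 * sqrt (\<Sum>l\<in>C. d l ^ 4) / T)"
proof -
  define m where "m = nat \<lceil>D / T\<rceil>"
  have m1: "D \<le> real m * T" and m2: "real m * T \<le> D + T"
  proof -
    have "D / T \<le> real m" "real m \<le> D / T + 1" using D T by (simp_all add: m_def)
    then show "D \<le> real m * T" "real m * T \<le> D + T" using T by (simp_all add: field_simps)
  qed
  define b where "b = mat_opnorm R X B"
  define f where "f = frobenius R X B"
  have b0: "0 \<le> b" and f0: "0 \<le> f" by (simp_all add: b_def f_def mat_opnorm_nonneg frobenius_nonneg)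
  define S where "S s = {l \<in> C. real s * T < \<bar>d l\<bar>}" for s :: nat
  have finS: "finite (S s)" "S s \<subseteq> C" for s using fin by (auto simp: S_def)
  define e where "e s l = sgn (d l) * max 0 (min (\<bar>d l\<bar> - real s * T) T)" for s l
  define A where "A \<xi> i l = (\<Sum>a\<in>X. B i a * \<xi> (pos a l))" for \<xi> i l
  have dsum: "d l = (\<Sum>s<m. e s l)" if "l \<in> C" for l
  proof -
    have "(\<Sum>s<m. e s l) = sgn (d l) * max 0 (min \<bar>d l\<bar> (real m * T))"
      unfolding e_def using T by (simp add: clip_sum flip: sum_distrib_left)
    also have "max 0 (min \<bar>d l\<bar> (real m * T)) = \<bar>d l\<bar>" using D(2)[OF that] m1 by (auto simp: min_def max_def)
    finally show ?thesis by (simp add: sgn_mult_abs)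
  qed
  have layer: "mat_opnorm R C (\<lambda>i l. A \<xi> i l * d l) \<le> (\<Sum>s<m. T * mat_opnorm R (S s) (A \<xi>))" for \<xi>
  proof -
    have "mat_opnorm R C (\<lambda>i l. A \<xi> i l * d l) = mat_opnorm R C (\<lambda>i l. \<Sum>s<m. A \<xi> i l * e s l)"
      by (intro mat_opnorm_cong) (simp add: dsum flip: sum_distrib_left)
    also have "\<dots> \<le> (\<Sum>s<m. mat_opnorm R C (\<lambda>i l. A \<xi> i l * e s l))" by (rule mat_opnorm_sum[OF fin(4)])
    also have "\<dots> \<le> (\<Sum>s<m. T * mat_opnorm R (S s) (A \<xi>))"
    proof (intro sum_mono mat_opnorm_columns)
      show "\<bar>e s j\<bar> \<le> T" for s j using T by (auto simp: e_def abs_mult sgn_if)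
      show "e s j = 0" if "j \<in> C - S s" for s j using that by (auto simp: e_def S_def)
    qed (use fin finS T in auto)
    finally show ?thesis .
  qed
  have "sE P (\<lambda>\<xi>. mat_opnorm R C (\<lambda>i l. A \<xi> i l * d l)) \<le> sE P (\<lambda>\<xi>. \<Sum>s<m. T * mat_opnorm R (S s) (A \<xi>))"
    by (intro sE_mono fin layer)
  also have "\<dots> = (\<Sum>s<m. T * sE P (\<lambda>\<xi>. mat_opnorm R (S s) (A \<xi>)))" by (simp add: sE_sum fin sE_cmult)
  also have "\<dots> \<le> (\<Sum>s<m. T * (12 * b * sqrt (real (card (S s))) + 4 * f))"
  proof (intro sum_mono mult_left_mono)
    fix s
    show "sE P (\<lambda>\<xi>. mat_opnorm R (S s) (A \<xi>)) \<le> 12 * b * sqrt (real (card (S s))) + 4 * f"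
      unfolding A_def b_def f_def
    proof (rule sE_mat_opnorm_sign_matrix[OF fin(1-3) finS(1)])
      show "inj_on (\<lambda>(a, s). pos a s) (X \<times> S s)" by (rule inj_on_subset[OF inj]) (use finS in auto)
    qed (use pos finS(2)[of s] in blast)
  qed (use T in auto)
  also have "\<dots> = 12 * b * (T * (\<Sum>s<m. sqrt (real (card (S s))))) + 4 * f * (real m * T)"
    by (simp add: sum.distrib sum_distrib_left algebra_simps)
  also have "\<dots> \<le> 12 * b * (T * sqrt (real (card C)) + 2 * sqrt (\<Sum>l\<in>C. d l ^ 4) / T) + 4 * f * (D + T)"
  proof (intro add_mono mult_left_mono m2)
    define q where "q = sqrt (\<Sum>l\<in>C. d l ^ 4)"
    have q0: "0 \<le> q" by (simp add: q_def sum_nonneg)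
    \<comment> \<open>Markov's inequality with the fourth power: the square root of the number of
      columns decays like \<open>1 / s\<^sup>2\<close>, which is summable. Second powers would give
      only \<open>1 / s\<close> and bring back a logarithm.\<close>
    have Ss: "sqrt (real (card (S s))) \<le> q / T\<^sup>2 * (1 / (real s)\<^sup>2)" if "s \<ge> 1" for s
    proof -
      have "real (card (S s)) * (real s * T) ^ 4 = (\<Sum>l\<in>S s. (real s * T) ^ 4)" by simp
      also have "\<dots> \<le> (\<Sum>l\<in>S s. \<bar>d l\<bar> ^ 4)"
        by (intro sum_mono power_mono) (use T in \<open>auto simp: S_def\<close>)
      also have "\<dots> \<le> (\<Sum>l\<in>C. d l ^ 4)"
      proof -
        have "\<bar>d l\<bar> ^ 4 = d l ^ 4" for l by (simp add: power_even_abs)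
        then show ?thesis using fin finS by (auto intro!: sum_mono2)
      qed
      finally have "sqrt (real (card (S s)) * (real s * T) ^ 4) \<le> q" unfolding q_def by simp
      moreover have "sqrt ((real s * T) ^ 4) = (real s * T)\<^sup>2" by (rule real_sqrt_unique) (auto simp flip: power_mult)
      ultimately have "sqrt (real (card (S s))) * (real s * T)\<^sup>2 \<le> q" by (simp add: real_sqrt_mult)
      then show ?thesis using that T by (simp add: field_simps power_mult_distrib)
    qed
    \<comment> \<open>In the lowest layer, where the Markov bound is void, all columns of
      \<open>C\<close> are counted.\<close>
    have "(\<Sum>s<m. sqrt (real (card (S s)))) \<le> (\<Sum>s\<in>insert 0 {1..<m}. sqrt (real (card (S s))))"
      by (intro sum_mono2) auto
    also have "\<dots> = sqrt (real (card (S 0))) + (\<Sum>s=1..<m. sqrt (real (card (S s))))" by simp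
    also have "\<dots> \<le> sqrt (real (card C)) + (\<Sum>s=1..<m. q / T\<^sup>2 * (1 / (real s)\<^sup>2))"
      using card_mono[OF fin(4) finS(2)] by (intro add_mono sum_mono Ss) auto
    also have "(\<Sum>s=1..<m. q / T\<^sup>2 * (1 / (real s)\<^sup>2)) = q / T\<^sup>2 * (\<Sum>s=1..<m. 1 / (real s)\<^sup>2)"
      by (rule sum_distrib_left[symmetric])
    also have "\<dots> \<le> q / T\<^sup>2 * 2" by (intro mult_left_mono sum_inverse_squares_le) (use q0 in auto)
    finally have "T * (\<Sum>s<m. sqrt (real (card (S s)))) \<le> T * (sqrt (real (card C)) + q / T\<^sup>2 * 2)"
      using T by (intro mult_left_mono) auto
    also have "\<dots> = T * sqrt (real (card C)) + 2 * q / T" using T by (simp add: field_simps power2_eq_square)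
    finally show "T * (\<Sum>s<m. sqrt (real (card (S s)))) \<le> T * sqrt (real (card C)) + 2 * sqrt (\<Sum>l\<in>C. d l ^ 4) / T"
      by (simp add: q_def)
  qed (use b0 f0 in auto)
  finally show ?thesis by (simp add: A_def b_def f_def add.commute)
qed

text \<open>Averaging out one more sign leaves even powers of its coefficient, or a factor
  \<open>cosh\<close> in the exponential case. The fourth moment step uses the exact second moment,
  hence the joint induction; 3 is the Gaussian constant.\<close>

lemma linear_form_moments:
  assumes "finite K"
  shows "sE K (\<lambda>\<xi>. (\<Sum>k\<in>K. a k * \<xi> k)\<^sup>2) = (\<Sum>k\<in>K. (a k)\<^sup>2)"
    "sE K (\<lambda>\<xi>. (\<Sum>k\<in>K. a k * \<xi> k) ^ 4) \<le> 3 * (\<Sum>k\<in>K. (a k)\<^sup>2)\<^sup>2"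
    "sE K (\<lambda>\<xi>. exp (t * (\<Sum>k\<in>K. a k * \<xi> k))) \<le> exp (t\<^sup>2 * (\<Sum>k\<in>K. (a k)\<^sup>2) / 2)"
  using assms
proof (induction K rule: finite_induct)
  case empty
  { case 1 then show ?case by simp }
  { case 2 then show ?case by simp }
  { case 3 then show ?case by simp }
next
  case (insert k K)
  let ?S = "\<lambda>\<xi>. \<Sum>k\<in>K. a k * \<xi> k"
  have upd: "(\<Sum>j\<in>insert k K. a j * (\<xi>(k := c)) j) = ?S \<xi> + a k * c" for \<xi> c
  proof -
    have "(\<Sum>j\<in>K. a j * (\<xi>(k := c)) j) = ?S \<xi>" by (intro sum.cong) (use insert in auto)
    then show ?thesis using insert by simp
  qed
  have red: "sE (insert k K) (\<lambda>\<xi>. h (\<Sum>j\<in>insert k K. a j * \<xi> j)) = sE K (\<lambda>\<xi>. (h (?S \<xi> + a k) + h (?S \<xi> - a k)) / 2)" for h :: "real \<Rightarrow> real"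
  proof -
    have "sE (insert k K) (\<lambda>\<xi>. h (\<Sum>j\<in>insert k K. a j * \<xi> j)) = sE (insert k K) (\<lambda>\<xi>. (h (?S \<xi> + a k) + h (?S \<xi> - a k)) / 2)"
      by (subst sE_coordinate[where p=k]) (use insert.hyps in \<open>auto simp only: upd finite_insert\<close>, auto)
    also have "\<dots> = sE K (\<lambda>\<xi>. (h (?S \<xi> + a k) + h (?S \<xi> - a k)) / 2)"
      by (rule sE_subset) (use insert.hyps in \<open>auto simp: depends_def\<close>)
    finally show ?thesis .
  qed
  { case 1
    have "((x + a k)\<^sup>2 + (x - a k)\<^sup>2) / 2 = x\<^sup>2 + (a k)\<^sup>2" for x by (simp add: power2_eq_square field_simps)
    note eq = this
    show ?case using insert by (subst red, simp only: eq) (simp add: sE_add) }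
  note second = this
  { case 2
    have "((x + a k) ^ 4 + (x - a k) ^ 4) / 2 = x ^ 4 + 6 * (a k)\<^sup>2 * x\<^sup>2 + (a k) ^ 4" for x
      by (simp add: power2_eq_square power4_eq_xxxx field_simps)
    note eq = this
    have "sE (insert k K) (\<lambda>\<xi>. (\<Sum>j\<in>insert k K. a j * \<xi> j) ^ 4)
       = sE K (\<lambda>\<xi>. ?S \<xi> ^ 4) + 6 * (a k)\<^sup>2 * (\<Sum>k\<in>K. (a k)\<^sup>2) + (a k) ^ 4"
      using insert by (subst red, simp only: eq) (simp add: sE_add sE_cmult)
    also have "\<dots> \<le> 3 * (\<Sum>k\<in>K. (a k)\<^sup>2)\<^sup>2 + 6 * (a k)\<^sup>2 * (\<Sum>k\<in>K. (a k)\<^sup>2) + 3 * (a k) ^ 4"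
    proof -
      have "0 \<le> a k ^ 4" by simp
      then show ?thesis using insert.IH(2) by linarith
    qed
    also have "\<dots> = 3 * (\<Sum>k\<in>insert k K. (a k)\<^sup>2)\<^sup>2"
      using insert.hyps by (simp add: power2_eq_square power4_eq_xxxx algebra_simps)
    finally show ?case . }
  { case 3
    have "(exp (t * (x + a k)) + exp (t * (x - a k))) / 2 = cosh (t * a k) * exp (t * x)" for x
      by (simp add: cosh_field_def ring_distribs exp_add[symmetric] right_diff_distrib add_divide_distrib add.commute)
    note eq = this
    have "sE (insert k K) (\<lambda>\<xi>. exp (t * (\<Sum>j\<in>insert k K. a j * \<xi> j))) = cosh (t * a k) * sE K (\<lambda>\<xi>. exp (t * ?S \<xi>))"
      by (subst red, simp only: eq) (simp add: sE_cmult)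
    also have "\<dots> \<le> exp ((t * a k)\<^sup>2 / 2) * exp (t\<^sup>2 * (\<Sum>k\<in>K. (a k)\<^sup>2) / 2)"
      by (intro mult_mono cosh_le_exp_half_square insert.IH insert.hyps) (use insert.hyps in \<open>auto intro!: sE_nonneg\<close>)
    also have "\<dots> = exp (t\<^sup>2 * (\<Sum>k\<in>insert k K. (a k)\<^sup>2) / 2)"
      using insert.hyps by (simp add: exp_add[symmetric] power_mult_distrib ring_distribs add_divide_distrib)
    finally show ?case . }
qed

lemma sE_linear_form_reindex:
  fixes h :: "real \<Rightarrow> real"
  assumes "finite P" "inj_on g K" "g ` K \<subseteq> P"
  shows "sE P (\<lambda>\<xi>. h (\<Sum>k\<in>K. a k * \<xi> (g k))) = sE K (\<lambda>\<xi>. h (\<Sum>k\<in>K. a k * \<xi> k))"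
  by (rule sE_reindex'[OF assms, of "\<lambda>\<xi>. h (\<Sum>k\<in>K. a k * \<xi> k)"], unfold depends_def)
    (intro allI impI arg_cong[where f=h] sum.cong, auto)

text \<open>Method of two moments: for the sum divided by \<open>s\<close> the second moment is 1
  and the fourth at most 3, so integrating \<open>x\<^sup>2 - x ^ 4 / 6 \<le> \<bar>x\<bar>\<close>
  gives \<open>1 - 3/6\<close>.\<close>

lemma khintchine_lower:
  assumes "finite P" "inj_on g K" "g ` K \<subseteq> P"
  shows "L2_set a K / 2 \<le> sE P (\<lambda>\<xi>. \<bar>\<Sum>k\<in>K. a k * \<xi> (g k)\<bar>)"
proof -
  have fK: "finite K" using assms finite_subset finite_imageD by blast
  define s where "s = L2_set a K"
  have s0: "0 \<le> s" by (simp add: s_def)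
  have "s / 2 \<le> sE K (\<lambda>\<xi>. \<bar>\<Sum>k\<in>K. a k * \<xi> k\<bar>)"
  proof (cases "s = 0")
    case True then show ?thesis by (simp add: sE_nonneg fK)
  next
    case False
    then have s: "s > 0" using s0 by simp
    have ineq: "x\<^sup>2 - x ^ 4 / 6 \<le> \<bar>x\<bar>" for x :: real
    proof -
      define y where "y = \<bar>x\<bar>"
      have y: "0 \<le> y" by (simp add: y_def)
      \<comment> \<open>\<open>71/50\<close> approximates \<open>sqrt 2\<close>, where
        \<open>y - y ^ 3 / 6\<close> has its maximum of about 0.943 on the nonnegative axis. The
        cubic is built to have a double root there, and the slack up to 1 pays for the rational
        approximation.\<close>
      have "0 \<le> (y - 71/50)\<^sup>2 * (y + 71/25)" using y by (intro mult_nonneg_nonneg) auto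
      also have "\<dots> = y ^ 3 - 15123/2500 * y + 357911/62500" by (simp add: power2_eq_square power3_eq_cube field_simps)
      finally have "y - y ^ 3 / 6 \<le> 1" using y by linarith
      then have "y * (y - y ^ 3 / 6) \<le> y * 1" using y by (intro mult_left_mono)
      then show ?thesis by (simp add: y_def algebra_simps power2_eq_square power4_eq_xxxx power3_eq_cube)
    qed
    have ss: "(\<Sum>k\<in>K. (a k)\<^sup>2) = s\<^sup>2" by (simp add: s_def L2_set_power2)
    have "s / 2 = s * (1 - 3 / 6)" by simp
    also have "\<dots> \<le> s * (sE K (\<lambda>\<xi>. (\<Sum>k\<in>K. a k * \<xi> k)\<^sup>2) / s\<^sup>2 - sE K (\<lambda>\<xi>. (\<Sum>k\<in>K. a k * \<xi> k) ^ 4) / s ^ 4 / 6)"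
    proof (intro mult_left_mono diff_mono)
      show "1 \<le> sE K (\<lambda>\<xi>. (\<Sum>k\<in>K. a k * \<xi> k)\<^sup>2) / s\<^sup>2" using linear_form_moments(1)[OF fK, of a] s by (simp add: ss)
      have "sE K (\<lambda>\<xi>. (\<Sum>k\<in>K. a k * \<xi> k) ^ 4) \<le> 3 * s ^ 4" using linear_form_moments(2)[OF fK, of a] by (simp add: ss flip: power_mult)
      then show "sE K (\<lambda>\<xi>. (\<Sum>k\<in>K. a k * \<xi> k) ^ 4) / s ^ 4 / 6 \<le> 3 / 6" using s by (simp add: field_simps)
    qed (use s in auto)
    also have "\<dots> = s * sE K (\<lambda>\<xi>. ((\<Sum>k\<in>K. a k * \<xi> k) / s)\<^sup>2 - ((\<Sum>k\<in>K. a k * \<xi> k) / s) ^ 4 / 6)"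
      by (simp add: sE_diff fK sE_divide power_divide)
    also have "\<dots> \<le> s * sE K (\<lambda>\<xi>. \<bar>(\<Sum>k\<in>K. a k * \<xi> k) / s\<bar>)"
      by (intro mult_left_mono sE_mono fK ineq s0)
    also have "\<dots> = sE K (\<lambda>\<xi>. \<bar>\<Sum>k\<in>K. a k * \<xi> k\<bar>)" using s by (simp add: abs_divide sE_divide)
    finally show ?thesis .
  qed
  then show ?thesis using sE_linear_form_reindex[OF assms, of abs a] by (simp add: s_def)
qed

section \<open>Linear forms in independent signs\<close>

lemma Max_insert_0_nonneg: "finite A \<Longrightarrow> (0::real) \<le> Max (insert 0 A)"
  by (rule Max_ge) auto

text \<open>There are at most \<open>2 * N\<close> signed forms, each with exponential moment at
  most \<open>sqrt N\<close> at the parameter \<open>t\<close>, so the logarithm of their sum is of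
  order \<open>ln N\<close>. \<open>insert 0\<close> gives the maximum a meaning for empty
  \<open>X\<close>.\<close>

lemma sE_Max_linear_forms_le:
  fixes N :: real
  assumes fin: "finite P" "finite X" and inj: "\<And>l. l \<in> X \<Longrightarrow> inj_on (g l) Y" "\<And>l. l \<in> X \<Longrightarrow> g l ` Y \<subseteq> P"
    and N: "N \<ge> 2" "real (card X) \<le> N" "real (card Y) \<le> N"
  shows "sE P (\<lambda>\<xi>. Max (insert 0 ((\<lambda>l. \<bar>\<Sum>m\<in>Y. \<xi> (g l m)\<bar>) ` X))) \<le> 4 * (sqrt N * sqrt (ln N))"
proof -
  \<comment> \<open>Chosen so that \<open>t\<^sup>2 * N = ln N\<close>: the variance term balances
    the logarithm of the number of forms.\<close>
  define t where "t = sqrt (ln N) / sqrt N"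
  have lnN: "ln N > 0" using N by simp
  have t: "t > 0" using lnN N by (simp add: t_def)
  have tN: "t\<^sup>2 * N = ln N" using lnN N by (simp add: t_def power_divide)
  define S where "S l \<xi> = (\<Sum>m\<in>Y. \<xi> (g l m))" for l and \<xi> :: "'a \<Rightarrow> real"
  let ?M = "\<lambda>\<xi>. Max (insert 0 ((\<lambda>l. \<bar>S l \<xi>\<bar>) ` X))"
  have mgf: "sE P (\<lambda>\<xi>. exp (c * S l \<xi>)) \<le> exp (ln N / 2)" if "c\<^sup>2 = t\<^sup>2" "l \<in> X" for c l
  proof -
    have fY: "finite Y" using inj[OF that(2)] fin finite_subset finite_imageD by blast
    have "sE P (\<lambda>\<xi>. exp (c * S l \<xi>)) = sE Y (\<lambda>\<xi>. exp (c * (\<Sum>m\<in>Y. 1 * \<xi> m)))"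
      using sE_linear_form_reindex[OF fin(1) inj[OF that(2)], of "\<lambda>x. exp (c * x)" "\<lambda>_. 1"] by (simp add: S_def)
    also have "\<dots> \<le> exp (c\<^sup>2 * (\<Sum>m\<in>Y. 1\<^sup>2) / 2)" by (rule linear_form_moments(3)[OF fY])
    also have "\<dots> \<le> exp (ln N / 2)"
      using mult_left_mono[OF N(3), of "t\<^sup>2"] tN that by simp
    finally show ?thesis .
  qed
  have "exp (sE P (\<lambda>\<xi>. t * ?M \<xi>)) \<le> sE P (\<lambda>\<xi>. exp (t * ?M \<xi>))" by (rule exp_sE_le[OF fin(1)])
  also have "\<dots> \<le> sE P (\<lambda>\<xi>. 1 + (\<Sum>l\<in>X. exp (t * S l \<xi>) + exp (- t * S l \<xi>)))"
  proof (rule sE_mono[OF fin(1)])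
    fix \<xi>
    have "?M \<xi> \<in> insert 0 ((\<lambda>l. \<bar>S l \<xi>\<bar>) ` X)" by (rule Max_in) (use fin in auto)
    then consider "?M \<xi> = 0" | l where "l \<in> X" "?M \<xi> = \<bar>S l \<xi>\<bar>" by auto
    then show "exp (t * ?M \<xi>) \<le> 1 + (\<Sum>l\<in>X. exp (t * S l \<xi>) + exp (- t * S l \<xi>))"
    proof cases
      case 1 then show ?thesis by (simp add: sum_nonneg add_nonneg_nonneg)
    next
      case 2
      have "exp (t * ?M \<xi>) \<le> exp (t * S l \<xi>) + exp (- t * S l \<xi>)" unfolding 2(2) by (auto simp: abs_if)
      also have "\<dots> \<le> (\<Sum>l\<in>X. exp (t * S l \<xi>) + exp (- t * S l \<xi>))"
        by (rule member_le_sum[OF 2(1)]) (use fin in \<open>auto intro!: add_nonneg_nonneg\<close>)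
      finally show ?thesis by simp
    qed
  qed
  also have "\<dots> = 1 + (\<Sum>l\<in>X. sE P (\<lambda>\<xi>. exp (t * S l \<xi>)) + sE P (\<lambda>\<xi>. exp (- t * S l \<xi>)))"
    by (simp add: sE_add sE_sum fin)
  also have "\<dots> \<le> 1 + (\<Sum>l\<in>X. exp (ln N / 2) + exp (ln N / 2))"
    by (intro add_mono sum_mono mgf) auto
  also have "\<dots> = 1 + real (card X) * (2 * exp (ln N / 2))" by simp
  also have "\<dots> \<le> exp (ln N / 2) + N * (2 * exp (ln N / 2))"
    using N lnN by (intro add_mono mult_right_mono) auto
  also have "\<dots> = (1 + 2 * N) * exp (ln N / 2)" by (simp add: algebra_simps)
  also have "\<dots> \<le> N ^ 3 * exp (ln N / 2)"
  proof (rule mult_right_mono)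
    have "4 * N \<le> N\<^sup>2 * N" using power_mono[OF N(1), of 2] N by (intro mult_right_mono) auto
    moreover have "1 + 2 * N \<le> 4 * N" using N by simp
    ultimately have "1 + 2 * N \<le> N\<^sup>2 * N" by linarith
    then show "1 + 2 * N \<le> N ^ 3" by (simp add: power3_eq_cube power2_eq_square)
  qed simp
  also have "N ^ 3 = exp (3 * ln N)" using N by (simp add: exp_of_nat_mult[of 3, simplified])
  also have "exp (3 * ln N) * exp (ln N / 2) = exp (7/2 * ln N)" by (simp flip: exp_add)
  finally have "t * sE P ?M \<le> 7/2 * ln N" by (simp add: sE_cmult)
  then have "sE P ?M \<le> (7/2 * ln N) / t" using t by (simp add: field_simps)
  also have "\<dots> = 7/2 * (sqrt N * sqrt (ln N))"
  proof -
    have "7/2 * ln N = 7/2 * (sqrt N * sqrt (ln N)) * t" using lnN N by (simp add: t_def)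
    then show ?thesis using t by (simp only: nonzero_mult_div_cancel_right)
  qed
  also have "\<dots> \<le> 4 * (sqrt N * sqrt (ln N))" using lnN N by (intro mult_right_mono) auto
  finally show ?thesis by (simp add: S_def)
qed

section \<open>Lower tails of sums of independent signs\<close>

lemma rademacher_symmetric:
  assumes "finite K"
  shows "sE K (\<lambda>\<xi>. h (- (\<Sum>k\<in>K. \<xi> k))) = sE K (\<lambda>\<xi>. h (\<Sum>k\<in>K. \<xi> k))"
  using sE_flip[OF assms, of "\<lambda>_. -1" "\<lambda>\<xi>. h (\<Sum>k\<in>K. \<xi> k)"] by (simp add: sum_negf)

text \<open>Paley-Zygmund: the second and fourth moments give \<open>3/16\<close> for the absolute
  value of the sum, and symmetry halves this.\<close>

lemma rademacher_block_prob:
  assumes fK: "finite K"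
  shows "3/32 \<le> sE K (\<lambda>\<xi>. of_bool (sqrt (real (card K)) / 2 \<le> (\<Sum>k\<in>K. \<xi> k)))"
proof (cases "K = {}")
  case False
  define M where "M = real (card K)"
  have M: "M > 0" using False fK by (simp add: M_def card_gt_0_iff)
  let ?S = "\<lambda>\<xi>. \<Sum>k\<in>K. \<xi> k"
  let ?p = "sE K (\<lambda>\<xi>. of_bool (sqrt M / 2 \<le> \<bar>?S \<xi>\<bar>))"
  have m2: "sE K (\<lambda>\<xi>. (?S \<xi>)\<^sup>2) = M" and m4: "sE K (\<lambda>\<xi>. (?S \<xi>) ^ 4) \<le> 3 * M\<^sup>2"
    using linear_form_moments(1,2)[OF fK, of "\<lambda>_. 1"] by (simp_all add: M_def)
  \<comment> \<open>Pointwise substitute for the Cauchy-Schwarz step; for large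
    \<open>\<bar>x\<bar>\<close> it is the nonnegativity of the square of
    \<open>x\<^sup>2 / (4 * M) - 1\<close>. In expectation, after division by \<open>M\<close>, it
    reads \<open>1 \<le> 1/4 + 3/8 + 2 * p\<close>.\<close>
  have pw: "x\<^sup>2 \<le> M / 4 + (x ^ 4 / (8 * M) + 2 * M * of_bool (sqrt M / 2 \<le> \<bar>x\<bar>))" for x
  proof (cases "sqrt M / 2 \<le> \<bar>x\<bar>")
    case True
    have "0 \<le> (x\<^sup>2 / (4 * M) - 1)\<^sup>2 * (2 * M)" using M by simp
    also have "\<dots> = x ^ 4 / (8 * M) - x\<^sup>2 + 2 * M"
      using M by (simp add: field_simps power2_eq_square power4_eq_xxxx)
    finally show ?thesis using True M by simp
  next
    case False
    then have "\<bar>x\<bar>\<^sup>2 \<le> (sqrt M / 2)\<^sup>2" by (intro power_mono) auto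
    then have "x\<^sup>2 \<le> M / 4" using M by (simp add: power_divide)
    moreover have "0 \<le> x ^ 4 / (8 * M)" using M by simp
    ultimately show ?thesis using False by simp
  qed
  have "M = sE K (\<lambda>\<xi>. (?S \<xi>)\<^sup>2)" by (rule m2[symmetric])
  also have "\<dots> \<le> sE K (\<lambda>\<xi>. M / 4 + ((?S \<xi>) ^ 4 / (8 * M) + 2 * M * of_bool (sqrt M / 2 \<le> \<bar>?S \<xi>\<bar>)))"
    by (rule sE_mono[OF fK], rule pw)
  also have "\<dots> = M / 4 + (sE K (\<lambda>\<xi>. (?S \<xi>) ^ 4) / (8 * M) + 2 * M * ?p)"
    by (simp add: sE_add fK sE_divide sE_cmult)
  also have "sE K (\<lambda>\<xi>. (?S \<xi>) ^ 4) / (8 * M) \<le> 3 * M\<^sup>2 / (8 * M)" using m4 M by (intro divide_right_mono) auto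
  also have "3 * M\<^sup>2 / (8 * M) = 3 * M / 8" using M by (simp add: power2_eq_square)
  finally have "M \<le> M / 4 + (3 * M / 8 + 2 * M * ?p)" by simp
  moreover have "2 * M * ?p = 2 * (?p * M)" by (simp only: mult.assoc mult.commute[of M])
  ultimately have "3 / 16 * M \<le> ?p * M" by linarith
  then have "3 / 16 \<le> ?p" using M by simp
  also have "?p \<le> sE K (\<lambda>\<xi>. of_bool (sqrt M / 2 \<le> ?S \<xi>) + of_bool (sqrt M / 2 \<le> - ?S \<xi>))"
    by (intro sE_mono fK) auto
  also have "\<dots> = 2 * sE K (\<lambda>\<xi>. of_bool (sqrt M / 2 \<le> ?S \<xi>))"
    using rademacher_symmetric[OF fK, of "\<lambda>x. of_bool (sqrt M / 2 \<le> x)"] by (simp add: sE_add fK)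
  finally show ?thesis by (simp add: M_def)
qed simp

text \<open>Each of \<open>r\<close> disjoint blocks of size \<open>M\<close> contributes \<open>sqrt M / 2\<close> with constant probability.\<close>

lemma rademacher_tail_lower:
  assumes "finite K" "r * M \<le> card K"
  shows "1/2 * (3/32) ^ r \<le> sE K (\<lambda>\<xi>. of_bool (real r * sqrt (real M) / 2 \<le> (\<Sum>k\<in>K. \<xi> k)))"
  using assms
proof (induction r arbitrary: K)
  case 0
  \<comment> \<open>\<open>K\<close> may be nonempty here: of the signs left over by the blocks only
    a nonnegative sum is demanded, which by symmetry costs the factor \<open>1/2\<close>.\<close>
  have "1 \<le> sE K (\<lambda>\<xi>. of_bool (0 \<le> (\<Sum>k\<in>K. \<xi> k)) + of_bool (0 \<le> - (\<Sum>k\<in>K. \<xi> k)))"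
    by (subst sE_const[of K 1, symmetric], intro sE_mono 0) auto
  also have "\<dots> = 2 * sE K (\<lambda>\<xi>. of_bool (0 \<le> (\<Sum>k\<in>K. \<xi> k)))"
    using rademacher_symmetric[OF 0(1), of "\<lambda>x. of_bool (0 \<le> x)"] by (simp add: sE_add 0)
  finally show ?case by simp
next
  case (Suc r)
  have "M \<le> card K" using Suc.prems by simp
  then obtain K1 where K1: "K1 \<subseteq> K" "card K1 = M" "finite K1" using obtain_subset_with_card_n by metis
  define K2 where "K2 = K - K1"
  have K2: "K2 \<subseteq> K" "finite K2" "K1 \<inter> K2 = {}" "r * M \<le> card K2"
    using Suc.prems K1 by (auto simp: K2_def card_Diff_subset)
  let ?F = "\<lambda>\<xi>. of_bool (sqrt (real M) / 2 \<le> (\<Sum>k\<in>K1. \<xi> k)) :: real"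
  let ?G = "\<lambda>\<xi>. of_bool (real r * sqrt (real M) / 2 \<le> (\<Sum>k\<in>K2. \<xi> k)) :: real"
  have dF: "depends K1 ?F" and dG: "depends K2 ?G" by (auto simp: depends_def cong: sum.cong)
  have "1/2 * (3/32) ^ Suc r = 3/32 * (1/2 * (3/32::real) ^ r)" by simp
  also have "\<dots> \<le> sE K1 ?F * sE K2 ?G"
    using rademacher_block_prob[OF K1(3)] Suc.IH[OF K2(2,4)] K1(2) by (intro mult_mono) auto
  also have "\<dots> = sE K ?F * sE K ?G"
    using sE_subset[OF Suc.prems(1) K1(1) dF] sE_subset[OF Suc.prems(1) K2(1) dG] by simp
  also have "\<dots> = sE K (\<lambda>\<xi>. ?F \<xi> * ?G \<xi>)"
    by (rule sE_indep[OF Suc.prems(1) dF dG K2(3), symmetric])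
  also have "\<dots> \<le> sE K (\<lambda>\<xi>. of_bool (real (Suc r) * sqrt (real M) / 2 \<le> (\<Sum>k\<in>K. \<xi> k)))"
  proof (rule sE_mono[OF Suc.prems(1)])
    fix \<xi> :: "'a \<Rightarrow> real"
    have "(\<Sum>k\<in>K. \<xi> k) = (\<Sum>k\<in>K1. \<xi> k) + (\<Sum>k\<in>K2. \<xi> k)"
      using sum.subset_diff[OF K1(1) Suc.prems(1), of \<xi>] by (simp add: K2_def add.commute)
    then show "?F \<xi> * ?G \<xi> \<le> of_bool (real (Suc r) * sqrt (real M) / 2 \<le> (\<Sum>k\<in>K. \<xi> k))"
      by (auto simp: field_simps)
  qed
  finally show ?case .
qed

section \<open>Conditioning on a block of signs\<close>

lemma sE_condition_le:
  assumes "finite P" "Y \<subseteq> P" "\<And>\<xi>. \<xi> \<in> signs P \<Longrightarrow> sE Y (\<lambda>\<eta>. F (\<lambda>p. if p \<in> Y then \<eta> p else \<xi> p)) \<le> G \<xi>"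
  shows "sE P F \<le> sE P G"
  by (subst sE_resample[OF assms(1,2)]) (intro sE_mono assms)

lemma sE_condition_ge:
  assumes "finite P" "Y \<subseteq> P" "\<And>\<xi>. \<xi> \<in> signs P \<Longrightarrow> G \<xi> \<le> sE Y (\<lambda>\<eta>. F (\<lambda>p. if p \<in> Y then \<eta> p else \<xi> p))"
  shows "sE P G \<le> sE P F"
  by (subst sE_resample[OF assms(1,2)]) (intro sE_mono assms)

lemma sE_linear_form_square:
  assumes "finite P" "inj_on g K" "g ` K \<subseteq> P" "\<And>k. k \<in> K \<Longrightarrow> depends Z (c k)" "Z \<inter> g ` K = {}"
  shows "sE P (\<lambda>\<xi>. (\<Sum>k\<in>K. c k \<xi> * \<xi> (g k))\<^sup>2) = (\<Sum>k\<in>K. sE P (\<lambda>\<xi>. (c k \<xi>)\<^sup>2))"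
proof -
  have fK: "finite K" using assms finite_subset finite_imageD by blast
  have "sE P (\<lambda>\<xi>. (\<Sum>k\<in>K. c k \<xi> * \<xi> (g k))\<^sup>2) = sE P (\<lambda>\<xi>. sE (g ` K) (\<lambda>\<eta>. (\<Sum>k\<in>K. c k \<xi> * \<eta> (g k))\<^sup>2))"
  proof (subst sE_resample[OF assms(1,3)], intro sE_cong assms(1))
    fix \<xi> \<eta>
    have "c k (\<lambda>p. if p \<in> g ` K then \<eta> p else \<xi> p) = c k \<xi>" if "k \<in> K" for k
      by (rule dependsD[OF assms(4)[OF that]]) (use assms(5) in auto)
    then show "(\<Sum>k\<in>K. c k (\<lambda>p. if p \<in> g ` K then \<eta> p else \<xi> p) * (if g k \<in> g ` K then \<eta> (g k) else \<xi> (g k)))\<^sup>2 = (\<Sum>k\<in>K. c k \<xi> * \<eta> (g k))\<^sup>2"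
      by (intro arg_cong[where f="\<lambda>x. x\<^sup>2"] sum.cong) auto
  qed (use fK in auto)
  also have "\<dots> = sE P (\<lambda>\<xi>. \<Sum>k\<in>K. (c k \<xi>)\<^sup>2)"
    using sE_linear_form_reindex[OF _ assms(2) subset_refl, of "\<lambda>x. x\<^sup>2"] linear_form_moments(1)[OF fK] fK by simp
  finally show ?thesis by (simp add: sE_sum assms)
qed

text \<open>Khintchine with frozen coefficients: they read only \<open>Z\<close>, so resampling the
  signs of the linear form leaves them unchanged.\<close>

lemma sE_linear_form_abs:
  assumes "finite P" "inj_on g K" "g ` K \<subseteq> P" "\<And>k. k \<in> K \<Longrightarrow> depends Z (c k)" "Z \<inter> g ` K = {}"
  shows "sE P (\<lambda>\<xi>. L2_set (\<lambda>k. c k \<xi>) K) / 2 \<le> sE P (\<lambda>\<xi>. \<bar>\<Sum>k\<in>K. c k \<xi> * \<xi> (g k)\<bar>)"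
proof -
  have fK: "finite K" using assms finite_subset finite_imageD by blast
  have "sE P (\<lambda>\<xi>. L2_set (\<lambda>k. c k \<xi>) K / 2) \<le> sE P (\<lambda>\<xi>. \<bar>\<Sum>k\<in>K. c k \<xi> * \<xi> (g k)\<bar>)"
  proof (rule sE_condition_ge[OF assms(1,3)])
    fix \<xi>
    have c: "c k (\<lambda>p. if p \<in> g ` K then \<eta> p else \<xi> p) = c k \<xi>" if "k \<in> K" for k \<eta>
      by (rule dependsD[OF assms(4)[OF that]]) (use assms(5) in auto)
    have "L2_set (\<lambda>k. c k \<xi>) K / 2 \<le> sE (g ` K) (\<lambda>\<eta>. \<bar>\<Sum>k\<in>K. c k \<xi> * \<eta> (g k)\<bar>)"
      by (rule khintchine_lower) (use fK assms in auto)
    also have "\<dots> = sE (g ` K) (\<lambda>\<eta>. \<bar>\<Sum>k\<in>K. c k (\<lambda>p. if p \<in> g ` K then \<eta> p else \<xi> p) * (if g k \<in> g ` K then \<eta> (g k) else \<xi> (g k))\<bar>)"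
      by (intro sE_cong arg_cong[where f=abs] sum.cong) (use fK c in auto)
    finally show "L2_set (\<lambda>k. c k \<xi>) K / 2 \<le> \<dots>" .
  qed
  then show ?thesis by (simp add: sE_divide)
qed

section \<open>The chain as a product of random matrices\<close>

text \<open>\<open>Sp j a b\<close> addresses the sign of the edge \<open>x\<^sub>j x\<^bsub>j+1\<^esub>\<close> at the labels \<open>a, b\<close>, and \<open>Lf j k a m\<close> that of
  the edge from \<open>x\<^sub>j\<close> (label \<open>a\<close>) to its \<open>k\<close>-th leaf (label \<open>m\<close>). With \<open>A\<^sub>j a b = \<xi> (Sp j a b)\<close> and the
  diagonal matrices \<open>D\<^sub>j\<close> of products of leaf sums, \<open>M \<xi> s t\<close> below is
  \<open>A\<^sub>s D\<^bsub>s+1\<^esub> A\<^bsub>s+1\<^esub> \<dots> D\<^bsub>s+t\<^esub> A\<^bsub>s+t\<^esub>\<close>. Demanding \<open>q (Suc L) = 0\<close> makes the factor \<open>D\<^bsub>L+1\<^esub>\<close> trivial.\<close>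

datatype 'l pos = Sp nat 'l 'l | Lf nat nat 'l 'l

locale chain_model =
  fixes L :: nat and q :: "nat \<Rightarrow> nat" and X :: "nat \<Rightarrow> 'l set" and Y :: "nat \<Rightarrow> nat \<Rightarrow> 'l set"
  assumes finX: "j \<le> Suc L \<Longrightarrow> finite (X j)" and finY: "1 \<le> j \<Longrightarrow> j \<le> L \<Longrightarrow> k < q j \<Longrightarrow> finite (Y j k)"
    and q_end: "q (Suc L) = 0"
begin

definition P :: "'l pos set" where
  "P = (\<Union>j\<in>{..L}. (\<lambda>(a, b). Sp j a b) ` (X j \<times> X (Suc j)))
     \<union> (\<Union>j\<in>{1..L}. \<Union>k\<in>{..<q j}. (\<lambda>(a, m). Lf j k a m) ` (X j \<times> Y j k))"

lemma finP: "finite P"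
  unfolding P_def by (intro finite_UnI finite_UN_I finite_imageI finite_cartesian_product) (auto intro: finX finY)

lemma Sp_in_P: "j \<le> L \<Longrightarrow> a \<in> X j \<Longrightarrow> b \<in> X (Suc j) \<Longrightarrow> Sp j a b \<in> P"
  by (auto simp: P_def)

lemma Lf_in_P: "1 \<le> j \<Longrightarrow> j \<le> L \<Longrightarrow> k < q j \<Longrightarrow> a \<in> X j \<Longrightarrow> m \<in> Y j k \<Longrightarrow> Lf j k a m \<in> P"
  unfolding P_def by (intro UnI2 UN_I[of j] UN_I[of k]) auto

definition leafsum :: "nat \<Rightarrow> nat \<Rightarrow> 'l \<Rightarrow> ('l pos \<Rightarrow> real) \<Rightarrow> real" where
  "leafsum j k a \<xi> = (\<Sum>m\<in>Y j k. \<xi> (Lf j k a m))"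

definition D :: "('l pos \<Rightarrow> real) \<Rightarrow> nat \<Rightarrow> 'l \<Rightarrow> real" where
  "D \<xi> j a = (\<Prod>k<q j. leafsum j k a \<xi>)"

fun M :: "('l pos \<Rightarrow> real) \<Rightarrow> nat \<Rightarrow> nat \<Rightarrow> 'l \<Rightarrow> 'l \<Rightarrow> real" where
  "M \<xi> s 0 i b = \<xi> (Sp s i b)"
| "M \<xi> s (Suc t) i b = (\<Sum>a\<in>X (Suc (s + t)). M \<xi> s t i a * D \<xi> (Suc (s + t)) a * \<xi> (Sp (Suc (s + t)) a b))"

definition leafblock :: "nat \<Rightarrow> 'l pos set" where
  "leafblock j = {Lf j k a m | k a m. True}"

text \<open>Leaf positions start strictly above level \<open>s\<close>, as
  \<open>M \<xi> s t\<close> contains no factor \<open>D \<xi> s\<close>. The left factor, the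
  diagonal factor and the right factor of a split therefore read disjoint blocks.\<close>

definition spineblock :: "nat \<Rightarrow> nat \<Rightarrow> 'l pos set" where
  "spineblock s t = {Sp j a b | j a b. s \<le> j \<and> j \<le> t} \<union> {Lf j k a m | j k a m. s < j \<and> j \<le> t}"

lemma depends_leafsum: "depends (range (Lf j k a)) (leafsum j k a)"
  unfolding depends_def leafsum_def by (auto intro!: sum.cong)

lemma depends_D: "depends (leafblock j) (\<lambda>\<xi>. D \<xi> j a)"
  unfolding depends_def D_def leafsum_def by (auto intro!: sum.cong prod.cong simp: leafblock_def)

lemma depends_M: "depends (spineblock s (s + t)) (\<lambda>\<xi>. M \<xi> s t i b)"
proof (induction t arbitrary: b)
  case 0 show ?case by (auto simp: depends_def spineblock_def)
next
  case (Suc t)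
  show ?case unfolding depends_def
  proof (intro allI impI)
    fix \<xi> \<xi>' :: "'l pos \<Rightarrow> real" assume eq: "\<forall>p\<in>spineblock s (s + Suc t). \<xi> p = \<xi>' p"
    have 1: "M \<xi> s t i a = M \<xi>' s t i a" for a
      by (rule dependsD[OF Suc]) (use eq in \<open>auto simp: spineblock_def\<close>)
    have 2: "D \<xi> (Suc (s + t)) a = D \<xi>' (Suc (s + t)) a" for a
      by (rule dependsD[OF depends_D]) (use eq in \<open>auto simp: spineblock_def leafblock_def\<close>)
    have 3: "\<xi> (Sp (Suc (s + t)) a b) = \<xi>' (Sp (Suc (s + t)) a b)" for a
      using eq by (auto simp: spineblock_def)
    show "M \<xi> s (Suc t) i b = M \<xi>' s (Suc t) i b" by (simp add: 1 2 3)
  qed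
qed

text \<open>Associativity: it exposes a diagonal factor anywhere in the product, while the recursion
  exposes only the last one.\<close>

lemma M_split:
  "M \<xi> s (Suc (t + t')) i b = (\<Sum>l\<in>X (Suc (s + t)). M \<xi> s t i l * D \<xi> (Suc (s + t)) l * M \<xi> (Suc (s + t)) t' l b)"
proof (induction t' arbitrary: b)
  case (Suc t')
  have "M \<xi> s (Suc (t + Suc t')) i b = (\<Sum>a\<in>X (Suc (Suc (s + t + t'))).
      (\<Sum>l\<in>X (Suc (s + t)). M \<xi> s t i l * D \<xi> (Suc (s + t)) l * M \<xi> (Suc (s + t)) t' l a)
       * D \<xi> (Suc (Suc (s + t + t'))) a * \<xi> (Sp (Suc (Suc (s + t + t'))) a b))"
    using Suc by (simp add: add.assoc)
  also have "\<dots> = (\<Sum>l\<in>X (Suc (s + t)). \<Sum>a\<in>X (Suc (Suc (s + t + t'))).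
      M \<xi> s t i l * D \<xi> (Suc (s + t)) l * (M \<xi> (Suc (s + t)) t' l a
       * D \<xi> (Suc (Suc (s + t + t'))) a * \<xi> (Sp (Suc (Suc (s + t + t'))) a b)))"
    by (subst sum.swap) (simp add: sum_distrib_left sum_distrib_right mult_ac)
  finally show ?case by (simp add: sum_distrib_left add.assoc)
qed simp

end

section \<open>Upper bound for the chain\<close>

locale chain_upper = chain_model L q X Y for L q and X :: "nat \<Rightarrow> 'l set" and Y +
  fixes N :: real and qm :: nat
  assumes N: "N \<ge> 3" and cardX: "j \<le> Suc L \<Longrightarrow> real (card (X j)) \<le> N"
    and cardY: "1 \<le> j \<Longrightarrow> j \<le> L \<Longrightarrow> k < q j \<Longrightarrow> real (card (Y j k)) \<le> N"
    and qm: "j \<le> Suc L \<Longrightarrow> q j \<le> qm"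
begin

definition rN :: real where "rN = sqrt N"
definition sN :: real where "sN = sqrt (ln N)"

lemma rN: "rN \<ge> 1" "rN\<^sup>2 = N"
  using N by (auto simp: rN_def)

text \<open>This is where \<open>N \<ge> 3\<close> enters: powers of \<open>sN\<close> may then be
  raised to the common exponent \<open>qm\<close>.\<close>

lemma sN: "sN \<ge> 1"
proof -
  have "exp 1 \<le> (3::real)" by (rule exp_le)
  then have "1 \<le> ln N" using N by (subst ln_ge_iff) auto
  then show ?thesis by (simp add: sN_def)
qed

lemma leafsum_bounds:
  assumes "1 \<le> j" "j \<le> L" "k < q j" "a \<in> X j"
  shows "sE P (\<lambda>\<xi>. (leafsum j k a \<xi>)\<^sup>2) \<le> N" "sE P (\<lambda>\<xi>. (leafsum j k a \<xi>) ^ 4) \<le> 3 * N\<^sup>2"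
proof -
  have f: "finite (Y j k)" using finY assms by auto
  have i: "inj_on (Lf j k a) (Y j k)" "Lf j k a ` Y j k \<subseteq> P" using assms by (auto simp: inj_on_def intro: Lf_in_P)
  have c: "real (card (Y j k)) \<le> N" using cardY assms by auto
  have 1: "sE P (\<lambda>\<xi>. h (leafsum j k a \<xi>)) = sE (Y j k) (\<lambda>\<xi>. h (\<Sum>m\<in>Y j k. 1 * \<xi> m))" for h
    using sE_linear_form_reindex[OF finP i, of h "\<lambda>_. 1"] by (simp add: leafsum_def)
  show "sE P (\<lambda>\<xi>. (leafsum j k a \<xi>)\<^sup>2) \<le> N"
    unfolding 1[of "\<lambda>x. x\<^sup>2"] linear_form_moments(1)[OF f] using c by simp
  have "(real (card (Y j k)))\<^sup>2 \<le> N\<^sup>2" by (intro power_mono c) auto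
  then show "sE P (\<lambda>\<xi>. (leafsum j k a \<xi>) ^ 4) \<le> 3 * N\<^sup>2"
    unfolding 1[of "\<lambda>x. x ^ 4"] using linear_form_moments(2)[OF f, of "\<lambda>_. 1"] by simp
qed

lemma sE_D_power:
  "sE P (\<lambda>\<xi>. (D \<xi> j a) ^ e) = (\<Prod>k<q j. sE P (\<lambda>\<xi>. (leafsum j k a \<xi>) ^ e))"
  unfolding D_def prod_power_distrib
proof (rule sE_indep_prod[OF finP])
  show "depends (range (Lf j k a)) (\<lambda>\<xi>. (leafsum j k a \<xi>) ^ e)" for k
    using depends_leafsum[of j k a] unfolding depends_def by metis
qed auto

lemma D_bounds:
  assumes "j \<le> L" "a \<in> X (Suc j)"
  shows "sE P (\<lambda>\<xi>. (D \<xi> (Suc j) a)\<^sup>2) \<le> rN ^ (2 * q (Suc j))"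
    "sE P (\<lambda>\<xi>. (D \<xi> (Suc j) a) ^ 4) \<le> (3 * N\<^sup>2) ^ q (Suc j)"
proof -
  \<comment> \<open>At level \<open>Suc L\<close> there is no such \<open>k\<close>, because
    \<open>q (Suc L) = 0\<close>.\<close>
  have j: "Suc j \<le> L" if "k < q (Suc j)" for k using that assms q_end by (cases "j = L") auto
  have "sE P (\<lambda>\<xi>. (D \<xi> (Suc j) a)\<^sup>2) \<le> (\<Prod>k<q (Suc j). N)"
    unfolding sE_D_power by (intro prod_mono) (use j assms leafsum_bounds finP in \<open>auto intro!: sE_nonneg\<close>)
  then show "sE P (\<lambda>\<xi>. (D \<xi> (Suc j) a)\<^sup>2) \<le> rN ^ (2 * q (Suc j))" by (simp add: power_mult rN)
  have "sE P (\<lambda>\<xi>. (D \<xi> (Suc j) a) ^ 4) \<le> (\<Prod>k<q (Suc j). 3 * N\<^sup>2)"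
    unfolding sE_D_power by (intro prod_mono) (use j assms leafsum_bounds finP in \<open>auto intro!: sE_nonneg\<close>)
  then show "sE P (\<lambda>\<xi>. (D \<xi> (Suc j) a) ^ 4) \<le> (3 * N\<^sup>2) ^ q (Suc j)" by simp
qed

text \<open>A product of maxima instead of the maximum of the products: the leaf families are
  independent, so the expectation factorises and first moments of the single maxima suffice.\<close>

definition Dmax :: "('l pos \<Rightarrow> real) \<Rightarrow> nat \<Rightarrow> real" where
  "Dmax \<xi> j = (\<Prod>k<q j. Max (insert 0 ((\<lambda>a. \<bar>leafsum j k a \<xi>\<bar>) ` X j)))"

lemma Dmax_nonneg: "j \<le> Suc L \<Longrightarrow> 0 \<le> Dmax \<xi> j"
  unfolding Dmax_def by (intro prod_nonneg ballI Max_insert_0_nonneg) (auto intro: finX)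

lemma D_le_Dmax: "j \<le> Suc L \<Longrightarrow> a \<in> X j \<Longrightarrow> \<bar>D \<xi> j a\<bar> \<le> Dmax \<xi> j"
  unfolding Dmax_def D_def abs_prod by (intro prod_mono) (auto intro!: Max_ge finX)

lemma depends_Dmax: "depends (leafblock j) (\<lambda>\<xi>. Dmax \<xi> j)"
  unfolding depends_def
proof (intro allI impI)
  fix \<xi> \<xi>' :: "'l pos \<Rightarrow> real" assume eq: "\<forall>p\<in>leafblock j. \<xi> p = \<xi>' p"
  have "leafsum j k a \<xi> = leafsum j k a \<xi>'" for k a
    by (rule dependsD[OF depends_leafsum]) (use eq in \<open>auto simp: leafblock_def\<close>)
  then show "Dmax \<xi> j = Dmax \<xi>' j" by (simp add: Dmax_def)
qed

lemma sE_Dmax_le: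
  assumes "j \<le> L" shows "sE P (\<lambda>\<xi>. Dmax \<xi> (Suc j)) \<le> (4 * (rN * sN)) ^ q (Suc j)"
proof -
  let ?j = "Suc j"
  have j: "Suc j \<le> L" if "k < q (Suc j)" for k using that assms q_end by (cases "j = L") auto
  have fX: "finite (X ?j)" using assms finX by simp
  let ?m = "\<lambda>k \<xi>. Max (insert 0 ((\<lambda>a. \<bar>leafsum ?j k a \<xi>\<bar>) ` X ?j))"
  have "sE P (\<lambda>\<xi>. Dmax \<xi> ?j) = (\<Prod>k<q ?j. sE P (?m k))"
    unfolding Dmax_def
  proof (rule sE_indep_prod[OF finP])
    show "depends {Lf ?j k a m | a m. True} (?m k)" for k
      unfolding depends_def
    proof (intro allI impI)
      fix \<xi> \<xi>' :: "'l pos \<Rightarrow> real" assume eq: "\<forall>p\<in>{Lf ?j k a m | a m. True}. \<xi> p = \<xi>' p"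
      have "leafsum ?j k a \<xi> = leafsum ?j k a \<xi>'" for a
        by (rule dependsD[OF depends_leafsum]) (use eq in auto)
      then show "?m k \<xi> = ?m k \<xi>'" by simp
    qed
  qed auto
  also have "\<dots> \<le> (\<Prod>k<q ?j. 4 * (rN * sN))"
  proof (intro prod_mono conjI)
    fix k assume k: "k \<in> {..<q ?j}"
    show "0 \<le> sE P (?m k)" by (intro sE_nonneg finP Max_insert_0_nonneg finite_imageI fX)
    show "sE P (?m k) \<le> 4 * (rN * sN)"
      unfolding leafsum_def rN_def sN_def
      by (rule sE_Max_linear_forms_le[OF finP fX])
        (use N cardX[of ?j] cardY[of ?j k] j[of k] k assms in \<open>auto simp: inj_on_def intro: Lf_in_P\<close>)
  qed
  finally show ?thesis by simp
qed

text \<open>Only the array \<open>Sp j\<close> is resampled, with \<open>B\<close> and the diagonal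
  frozen. Afterwards the norms of \<open>B\<close> separate from the diagonal by independence, since
  they read disjoint blocks. The factor \<open>4 * sN\<close>, the source of the logarithm, meets
  only the Frobenius norm.\<close>

lemma chevet_step:
  assumes j: "j \<le> L" and depends: "\<And>i a. depends Z (\<lambda>\<xi>. B \<xi> i a)" and disj: "Z \<inter> (range (\<lambda>(a, b). Sp j a b) \<union> leafblock (Suc j)) = {}"
  shows "sE P (\<lambda>\<xi>. mat_opnorm (X 0) (X (Suc j)) (\<lambda>i b. (\<Sum>a\<in>X j. B \<xi> i a * \<xi> (Sp j a b)) * D \<xi> (Suc j) b))
    \<le> 4 * sE P (\<lambda>\<xi>. frobenius (X 0) (X j) (B \<xi>)) * (rN ^ q (Suc j) * ((4 * sN) ^ q (Suc j) + 1))
      + 12 * sE P (\<lambda>\<xi>. mat_opnorm (X 0) (X j) (B \<xi>)) * (rN ^ Suc (q (Suc j)) * (1 + 2 * 2 ^ q (Suc j)))"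
proof -
  define e where "e = q (Suc j)"
  \<comment> \<open>The layer height is the root mean square bound of a diagonal entry, so that both
    operator norm terms of the Chevet bound have the same order.\<close>
  define T where "T = rN ^ e"
  have T: "T > 0" using rN by (simp add: T_def)
  have fin: "finite (X 0)" "finite (X j)" "finite (X (Suc j))" using finX j by auto
  define Yb where "Yb = (\<lambda>(a, b). Sp j a b) ` (X j \<times> X (Suc j))"
  have Yb: "Yb \<subseteq> P" using j by (auto simp: Yb_def intro: Sp_in_P)
  define R where "R \<xi> = T * sqrt (real (card (X (Suc j)))) + 2 * sqrt (\<Sum>l\<in>X (Suc j). D \<xi> (Suc j) l ^ 4) / T" for \<xi>
  let ?f = "\<lambda>\<xi>. frobenius (X 0) (X j) (B \<xi>)" and ?n = "\<lambda>\<xi>. mat_opnorm (X 0) (X j) (B \<xi>)"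
  have Beq: "B \<xi> = B \<xi>'" if "\<forall>p\<in>Z. \<xi> p = \<xi>' p" for \<xi> \<xi>'
    by (intro ext dependsD[OF depends]) (use that in auto)
  have depf: "depends Z ?f" and depn: "depends Z ?n"
    unfolding depends_def by (intro allI impI, drule Beq, simp)+
  have depR: "depends (leafblock (Suc j)) R"
    unfolding depends_def
  proof (intro allI impI)
    fix \<xi> \<xi>' :: "'l pos \<Rightarrow> real" assume eq: "\<forall>p\<in>leafblock (Suc j). \<xi> p = \<xi>' p"
    have "D \<xi> (Suc j) l = D \<xi>' (Suc j) l" for l by (rule dependsD[OF depends_D]) (use eq in auto)
    then show "R \<xi> = R \<xi>'" by (simp add: R_def)
  qed
  have "sE P (\<lambda>\<xi>. mat_opnorm (X 0) (X (Suc j)) (\<lambda>i b. (\<Sum>a\<in>X j. B \<xi> i a * \<xi> (Sp j a b)) * D \<xi> (Suc j) b))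
     \<le> sE P (\<lambda>\<xi>. 4 * ?f \<xi> * (Dmax \<xi> (Suc j) + T) + 12 * ?n \<xi> * R \<xi>)"
  proof (rule sE_condition_le[OF finP Yb])
    fix \<xi> :: "'l pos \<Rightarrow> real"
    let ?mix = "\<lambda>\<eta> p. if p \<in> Yb then \<eta> p else \<xi> p"
    have 1: "B (?mix \<eta>) i a = B \<xi> i a" for \<eta> i a
      by (rule dependsD[OF depends]) (use disj in \<open>auto simp: Yb_def\<close>)
    have 2: "D (?mix \<eta>) (Suc j) b = D \<xi> (Suc j) b" for \<eta> b
      by (rule dependsD[OF depends_D]) (auto simp: Yb_def leafblock_def)
    have "sE Yb (\<lambda>\<eta>. mat_opnorm (X 0) (X (Suc j)) (\<lambda>i b. (\<Sum>a\<in>X j. B (?mix \<eta>) i a * (if Sp j a b \<in> Yb then \<eta> (Sp j a b) else \<xi> (Sp j a b))) * D (?mix \<eta>) (Suc j) b))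
      = sE Yb (\<lambda>\<eta>. mat_opnorm (X 0) (X (Suc j)) (\<lambda>i b. (\<Sum>a\<in>X j. B \<xi> i a * \<eta> (Sp j a b)) * D \<xi> (Suc j) b))"
      unfolding 1 2
      by (intro sE_cong mat_opnorm_cong arg_cong2[where f="(*)"] sum.cong refl) (use fin in \<open>auto simp: Yb_def\<close>)
    also have "\<dots> \<le> 4 * ?f \<xi> * (Dmax \<xi> (Suc j) + T) + 12 * ?n \<xi> * R \<xi>"
      unfolding R_def
      by (rule sE_mat_opnorm_sign_matrix_diag[where D="Dmax \<xi> (Suc j)"])
        (use fin T j Dmax_nonneg[of "Suc j" \<xi>] D_le_Dmax[of "Suc j" _ \<xi>] in \<open>auto simp: Yb_def inj_on_def\<close>)
    finally show "sE Yb (\<lambda>\<eta>. mat_opnorm (X 0) (X (Suc j)) (\<lambda>i b. (\<Sum>a\<in>X j. B (?mix \<eta>) i a * (if Sp j a b \<in> Yb then \<eta> (Sp j a b) else \<xi> (Sp j a b))) * D (?mix \<eta>) (Suc j) b)) \<le> \<dots>" .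
  qed
  also have "\<dots> = 4 * (sE P (\<lambda>\<xi>. ?f \<xi> * Dmax \<xi> (Suc j)) + sE P ?f * T) + 12 * sE P (\<lambda>\<xi>. ?n \<xi> * R \<xi>)"
    by (simp add: sE_add finP sE_cmult sE_cmult_right ring_distribs mult.assoc)
  also have "sE P (\<lambda>\<xi>. ?f \<xi> * Dmax \<xi> (Suc j)) = sE P ?f * sE P (\<lambda>\<xi>. Dmax \<xi> (Suc j))"
    by (rule sE_indep[OF finP depf depends_Dmax]) (use disj in auto)
  also have "sE P (\<lambda>\<xi>. ?n \<xi> * R \<xi>) = sE P ?n * sE P R"
    by (rule sE_indep[OF finP depn depR]) (use disj in auto)
  also have "4 * (sE P ?f * sE P (\<lambda>\<xi>. Dmax \<xi> (Suc j)) + sE P ?f * T) + 12 * (sE P ?n * sE P R)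
    = 4 * sE P ?f * (sE P (\<lambda>\<xi>. Dmax \<xi> (Suc j)) + T) + 12 * sE P ?n * sE P R" by (simp add: algebra_simps)
  also have "\<dots> \<le> 4 * sE P ?f * (rN ^ e * ((4 * sN) ^ e + 1)) + 12 * sE P ?n * (rN ^ Suc e * (1 + 2 * 2 ^ e))"
  proof (intro add_mono mult_left_mono)
    show "sE P (\<lambda>\<xi>. Dmax \<xi> (Suc j)) + T \<le> rN ^ e * ((4 * sN) ^ e + 1)"
      using sE_Dmax_le[OF j] by (simp add: T_def e_def power_mult_distrib algebra_simps)
    have "sE P (\<lambda>\<xi>. sqrt (\<Sum>l\<in>X (Suc j). D \<xi> (Suc j) l ^ 4)) \<le> sqrt (sE P (\<lambda>\<xi>. \<Sum>l\<in>X (Suc j). D \<xi> (Suc j) l ^ 4))"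
      by (intro sE_sqrt_le finP sum_nonneg) auto
    also have "\<dots> \<le> sqrt (N * (3 * N\<^sup>2) ^ e)"
    proof (rule real_sqrt_le_mono)
      have "sE P (\<lambda>\<xi>. \<Sum>l\<in>X (Suc j). D \<xi> (Suc j) l ^ 4) \<le> (\<Sum>l\<in>X (Suc j). (3 * N\<^sup>2) ^ e)"
        unfolding sE_sum[OF finP] e_def by (intro sum_mono D_bounds j)
      also have "\<dots> \<le> N * (3 * N\<^sup>2) ^ e" using cardX[of "Suc j"] j by (simp add: mult_right_mono)
      finally show "sE P (\<lambda>\<xi>. \<Sum>l\<in>X (Suc j). D \<xi> (Suc j) l ^ 4) \<le> N * (3 * N\<^sup>2) ^ e" .
    qed
    also have "\<dots> \<le> rN * (2 * rN\<^sup>2) ^ e"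
    proof (rule real_le_lsqrt)
      \<comment> \<open>The fourth moment constant 3 is enlarged to the square 4 before taking
        roots.\<close>
      have "(3 * N\<^sup>2) ^ e \<le> (4 * N\<^sup>2) ^ e" by (intro power_mono) auto
      then have "N * (3 * N\<^sup>2) ^ e \<le> N * (4 * N\<^sup>2) ^ e" using N by (intro mult_left_mono) auto
      also have "\<dots> = (rN * (2 * rN\<^sup>2) ^ e)\<^sup>2"
      proof -
        have "((2 * N) ^ e)\<^sup>2 = ((2 * N)\<^sup>2) ^ e" by (simp only: power_mult[symmetric] mult.commute)
        then show ?thesis by (simp add: rN(2) power_mult_distrib)
      qed
      finally show "N * (3 * N\<^sup>2) ^ e \<le> (rN * (2 * rN\<^sup>2) ^ e)\<^sup>2" .
    qed (use N rN in auto)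
    finally have q4: "sE P (\<lambda>\<xi>. sqrt (\<Sum>l\<in>X (Suc j). D \<xi> (Suc j) l ^ 4)) \<le> rN * (2 * rN\<^sup>2) ^ e" .
    have "sqrt (real (card (X (Suc j)))) \<le> rN" unfolding rN_def using cardX[of "Suc j"] j by simp
    then have "sE P R \<le> T * rN + 2 * (rN * (2 * rN\<^sup>2) ^ e) / T"
      unfolding R_def using q4 T finP by (simp add: sE_add sE_divide sE_cmult) (intro add_mono mult_left_mono divide_right_mono, auto)
    also have "\<dots> = rN ^ Suc e * (1 + 2 * 2 ^ e)"
      using rN(1) by (simp add: T_def power_mult_distrib field_simps power2_eq_square)
    finally show "sE P R \<le> rN ^ Suc e * (1 + 2 * 2 ^ e)" .
  qed (use finP in \<open>auto intro!: mult_nonneg_nonneg sE_nonneg frobenius_nonneg mat_opnorm_nonneg\<close>)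
  finally show ?thesis by (simp add: e_def)
qed

end

lemma depends_comp: "depends Z F \<Longrightarrow> depends Z (\<lambda>\<xi>. h (F \<xi>))"
proof (unfold depends_def[of _ "\<lambda>\<xi>. h (F \<xi>)"], intro allI impI)
  fix \<xi> \<xi>' :: "_ \<Rightarrow> real" assume "depends Z F" "\<forall>p\<in>Z. \<xi> p = \<xi>' p"
  then have "F \<xi> = F \<xi>'" by (intro dependsD[of Z F]) auto
  then show "h (F \<xi>) = h (F \<xi>')" by simp
qed

lemma depends_comp2: "depends Z F \<Longrightarrow> depends Z' G \<Longrightarrow> depends (Z \<union> Z') (\<lambda>\<xi>. h (F \<xi>) (G \<xi>))"
proof (unfold depends_def[of _ "\<lambda>\<xi>. h (F \<xi>) (G \<xi>)"], intro allI impI)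
  fix \<xi> \<xi>' :: "_ \<Rightarrow> real" assume "depends Z F" "depends Z' G" "\<forall>p\<in>Z \<union> Z'. \<xi> p = \<xi>' p"
  then have "F \<xi> = F \<xi>'" "G \<xi> = G \<xi>'" by (auto intro: dependsD[of Z F] dependsD[of Z' G])
  then show "h (F \<xi>) (G \<xi>) = h (F \<xi>') (G \<xi>')" by simp
qed

text \<open>The recursion that \<open>chevet_step\<close> imposes on the constant: the Frobenius
  term contributes afresh at each level, the operator norm term multiplies the previous
  constant.\<close>

primrec upper_const :: "(nat \<Rightarrow> nat) \<Rightarrow> nat \<Rightarrow> real" where
  "upper_const q 0 = 4 * (4 ^ q 1 + 1) + 12 * (1 + 2 * 2 ^ q 1)"
| "upper_const q (Suc t) = 4 * (4 ^ q (Suc (Suc t)) + 1) + 12 * upper_const q t * (1 + 2 * 2 ^ q (Suc (Suc t)))"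

lemma upper_const_pos: "upper_const q t > 0"
  by (induction t) (auto intro!: add_pos_pos mult_pos_pos)

context chain_upper
begin

lemma N_mult: "N * x = rN\<^sup>2 * x"
  by (simp add: rN(2))

text \<open>The signs of the last array are independent of all earlier factors, so the cross terms
  vanish and each level contributes the number of its labels times the second moment of the
  diagonal.\<close>

lemma sE_M_square_le:
  assumes "t \<le> L" "i \<in> X 0" "b \<in> X (Suc t)"
  shows "sE P (\<lambda>\<xi>. (M \<xi> 0 t i b)\<^sup>2) \<le> rN ^ (2 * (t + sum q {1..t}))"
  using assms
proof (induction t arbitrary: b)
  case 0
  have "sE P (\<lambda>\<xi>. (M \<xi> 0 0 i b)\<^sup>2) = sE P (\<lambda>\<xi>. 1)"
    using 0 Sp_in_P[of 0 i b] by (intro sE_cong finP) (simp add: power2_eq_square signs_square)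
  then show ?case by simp
next
  case (Suc t)
  let ?c = "\<lambda>a \<xi>. M \<xi> 0 t i a * D \<xi> (Suc t) a"
  have dM: "depends (spineblock 0 t) (\<lambda>\<xi>. (M \<xi> 0 t i a)\<^sup>2)" for a
    by (rule depends_comp) (use depends_M[of 0 t i a] in simp)
  have dD: "depends (leafblock (Suc t)) (\<lambda>\<xi>. (D \<xi> (Suc t) a)\<^sup>2)" for a
    by (rule depends_comp[OF depends_D])
  have "sE P (\<lambda>\<xi>. (M \<xi> 0 (Suc t) i b)\<^sup>2) = (\<Sum>a\<in>X (Suc t). sE P (\<lambda>\<xi>. (?c a \<xi>)\<^sup>2))"
    unfolding M.simps add_0
  proof (rule sE_linear_form_square[OF finP, where Z="spineblock 0 t \<union> leafblock (Suc t)"])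
    show "depends (spineblock 0 t \<union> leafblock (Suc t)) (?c a)" for a
      by (rule depends_comp2[OF _ depends_D]) (use depends_M[of 0 t i a] in simp)
  qed (use Suc.prems in \<open>auto simp: inj_on_def spineblock_def leafblock_def intro: Sp_in_P\<close>)
  also have "\<dots> = (\<Sum>a\<in>X (Suc t). sE P (\<lambda>\<xi>. (M \<xi> 0 t i a)\<^sup>2) * sE P (\<lambda>\<xi>. (D \<xi> (Suc t) a)\<^sup>2))"
    unfolding power_mult_distrib
    by (intro sum.cong refl sE_indep[OF finP dM dD]) (auto simp: spineblock_def leafblock_def)
  also have "\<dots> \<le> (\<Sum>a\<in>X (Suc t). rN ^ (2 * (t + sum q {1..t})) * rN ^ (2 * q (Suc t)))"
    using Suc rN by (intro sum_mono mult_mono D_bounds Suc.IH) (auto intro!: sE_nonneg finP)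
  also have "\<dots> \<le> N * (rN ^ (2 * (t + sum q {1..t})) * rN ^ (2 * q (Suc t)))"
    using cardX[of "Suc t"] Suc.prems rN by (simp add: mult_right_mono)
  also have "\<dots> = rN ^ (2 + (2 * (t + sum q {1..t}) + 2 * q (Suc t)))"
    by (simp only: N_mult power_add)
  also have "2 + (2 * (t + sum q {1..t}) + 2 * q (Suc t)) = 2 * (Suc t + sum q {1..Suc t})" by simp
  finally show ?case .
qed

text \<open>A pure second moment computation, hence no logarithm; this keeps the logarithms of
  different levels from multiplying.\<close>

lemma sE_frobenius_le:
  assumes "t \<le> L"
  shows "sE P (\<lambda>\<xi>. frobenius (X 0) (X (Suc t)) (\<lambda>i a. M \<xi> 0 t i a * D \<xi> (Suc t) a)) \<le> rN ^ (t + 2 + sum q {1..Suc t})"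
proof -
  have dM: "depends (spineblock 0 t) (\<lambda>\<xi>. (M \<xi> 0 t i a)\<^sup>2)" for i a
    by (rule depends_comp) (use depends_M[of 0 t i a] in simp)
  have dD: "depends (leafblock (Suc t)) (\<lambda>\<xi>. (D \<xi> (Suc t) a)\<^sup>2)" for a
    by (rule depends_comp[OF depends_D])
  let ?b = "rN ^ (2 * (t + sum q {1..t})) * rN ^ (2 * q (Suc t))"
  have "sE P (\<lambda>\<xi>. frobenius (X 0) (X (Suc t)) (\<lambda>i a. M \<xi> 0 t i a * D \<xi> (Suc t) a))
    \<le> sqrt (sE P (\<lambda>\<xi>. \<Sum>i\<in>X 0. \<Sum>a\<in>X (Suc t). (M \<xi> 0 t i a * D \<xi> (Suc t) a)\<^sup>2))"
    unfolding frobenius_def by (intro sE_sqrt_le finP) (auto intro!: sum_nonneg)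
  also have "\<dots> \<le> sqrt (N * (N * ?b))"
  proof (rule real_sqrt_le_mono)
    have "sE P (\<lambda>\<xi>. \<Sum>i\<in>X 0. \<Sum>a\<in>X (Suc t). (M \<xi> 0 t i a * D \<xi> (Suc t) a)\<^sup>2)
      = (\<Sum>i\<in>X 0. \<Sum>a\<in>X (Suc t). sE P (\<lambda>\<xi>. (M \<xi> 0 t i a)\<^sup>2) * sE P (\<lambda>\<xi>. (D \<xi> (Suc t) a)\<^sup>2))"
      unfolding power_mult_distrib sE_sum[OF finP]
      by (intro sum.cong refl sE_indep[OF finP dM dD]) (auto simp: spineblock_def leafblock_def)
    also have "\<dots> \<le> (\<Sum>i\<in>X 0. \<Sum>a\<in>X (Suc t). ?b)"
      using assms rN by (intro sum_mono mult_mono D_bounds sE_M_square_le) (auto intro!: sE_nonneg finP)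
    also have "\<dots> = real (card (X 0)) * (real (card (X (Suc t))) * ?b)" by simp
    also have "\<dots> \<le> N * (N * ?b)"
      using cardX[of 0] cardX[of "Suc t"] assms N rN by (intro mult_mono) auto
    finally show "sE P (\<lambda>\<xi>. \<Sum>i\<in>X 0. \<Sum>a\<in>X (Suc t). (M \<xi> 0 t i a * D \<xi> (Suc t) a)\<^sup>2) \<le> N * (N * ?b)" .
  qed
  also have "N * (N * ?b) = rN ^ (2 + (2 + (2 * (t + sum q {1..t}) + 2 * q (Suc t))))"
    by (simp only: N_mult power_add)
  also have "2 + (2 + (2 * (t + sum q {1..t}) + 2 * q (Suc t))) = (t + 2 + sum q {1..Suc t}) * 2" by simp
  also have "rN ^ \<dots> = (rN ^ (t + 2 + sum q {1..Suc t}))\<^sup>2" by (rule power_mult)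
  also have "sqrt \<dots> = rN ^ (t + 2 + sum q {1..Suc t})" using rN by simp
  finally show ?thesis .
qed

lemma power_bound_aux:
  assumes "j \<le> Suc L" shows "(4 * sN) ^ q j + 1 \<le> (4 ^ q j + 1) * sN ^ qm"
proof -
  have 1: "1 \<le> sN ^ qm" "sN ^ q j \<le> sN ^ qm" using sN qm[OF assms] by (auto intro: power_increasing)
  have "(4 * sN) ^ q j + 1 = 4 ^ q j * sN ^ q j + 1" by (simp add: power_mult_distrib)
  also have "\<dots> \<le> 4 ^ q j * sN ^ qm + sN ^ qm" using 1 by (intro add_mono mult_left_mono) auto
  finally show ?thesis by (simp add: algebra_simps)
qed

text \<open>The invariant ends with a diagonal factor, so that each step appends a sign matrix and
  the next diagonal, as the Chevet bound demands. One power \<open>sN ^ qm\<close> suffices: in each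
  summand the logarithm is either inherited or new. For \<open>t = L\<close> the last diagonal is
  1.\<close>

lemma sE_opnorm_MD_le:
  assumes "t \<le> L"
  shows "sE P (\<lambda>\<xi>. mat_opnorm (X 0) (X (Suc t)) (\<lambda>i a. M \<xi> 0 t i a * D \<xi> (Suc t) a))
    \<le> upper_const q t * (rN ^ (t + 1 + sum q {1..Suc t}) * sN ^ qm)"
  using assms
proof (induction t)
  case 0
  have s1: "1 \<le> sN ^ qm" using sN by simp
  \<comment> \<open>The induction starts from the identity matrix as \<open>B\<close>, with operator
    norm at most 1 and Frobenius norm at most \<open>rN\<close>.\<close>
  let ?I = "\<lambda>i a. if i = a then 1 else 0 :: real"
  have fX: "finite (X 0)" using finX by simp
  have "sE P (\<lambda>\<xi>. mat_opnorm (X 0) (X (Suc 0)) (\<lambda>i a. M \<xi> 0 0 i a * D \<xi> (Suc 0) a))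
    = sE P (\<lambda>\<xi>. mat_opnorm (X 0) (X (Suc 0)) (\<lambda>i b. (\<Sum>a\<in>X 0. ?I i a * \<xi> (Sp 0 a b)) * D \<xi> (Suc 0) b))"
    by (intro sE_cong finP mat_opnorm_cong) (simp add: mult_delta_left fX)
  also have "\<dots> \<le> 4 * sE P (\<lambda>\<xi>. frobenius (X 0) (X 0) ?I) * (rN ^ q (Suc 0) * ((4 * sN) ^ q (Suc 0) + 1))
      + 12 * sE P (\<lambda>\<xi>. mat_opnorm (X 0) (X 0) ?I) * (rN ^ Suc (q (Suc 0)) * (1 + 2 * 2 ^ q (Suc 0)))"
    by (rule chevet_step[where Z="{}"]) (auto simp: depends_def)
  also have "\<dots> \<le> 4 * rN * (rN ^ q (Suc 0) * ((4 ^ q (Suc 0) + 1) * sN ^ qm))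
      + 12 * 1 * (rN ^ Suc (q (Suc 0)) * ((1 + 2 * 2 ^ q (Suc 0)) * sN ^ qm))"
  proof (intro add_mono mult_mono power_bound_aux)
    show "sE P (\<lambda>\<xi>. frobenius (X 0) (X 0) ?I) \<le> rN"
      using cardX[of 0] by (simp add: frobenius_id fX rN_def)
    show "sE P (\<lambda>\<xi>. mat_opnorm (X 0) (X 0) ?I) \<le> 1" by (simp add: mat_opnorm_id_le fX)
    show "1 + 2 * 2 ^ q (Suc 0) \<le> (1 + 2 * 2 ^ q (Suc 0)) * sN ^ qm"
      using mult_left_mono[OF s1, of "1 + 2 * 2 ^ q (Suc 0)"] by simp
  qed (use rN sN in \<open>auto intro!: mult_nonneg_nonneg simp: mat_opnorm_nonneg frobenius_nonneg\<close>)
  also have "\<dots> = upper_const q 0 * (rN ^ (0 + 1 + sum q {1..Suc 0}) * sN ^ qm)" by (simp add: algebra_simps)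
  finally show ?case by simp
next
  case (Suc t)
  define e where "e = q (Suc (Suc t))"
  have s1: "1 \<le> sN ^ qm" using sN by simp
  let ?B = "\<lambda>\<xi> i a. M \<xi> 0 t i a * D \<xi> (Suc t) a"
  have "sE P (\<lambda>\<xi>. mat_opnorm (X 0) (X (Suc (Suc t))) (\<lambda>i a. M \<xi> 0 (Suc t) i a * D \<xi> (Suc (Suc t)) a))
    \<le> 4 * sE P (\<lambda>\<xi>. frobenius (X 0) (X (Suc t)) (?B \<xi>)) * (rN ^ e * ((4 * sN) ^ e + 1))
      + 12 * sE P (\<lambda>\<xi>. mat_opnorm (X 0) (X (Suc t)) (?B \<xi>)) * (rN ^ Suc e * (1 + 2 * 2 ^ e))"
    unfolding e_def M.simps add_0
  proof (rule chevet_step[where Z="spineblock 0 t \<union> leafblock (Suc t)"])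
    show "depends (spineblock 0 t \<union> leafblock (Suc t)) (\<lambda>\<xi>. ?B \<xi> i a)" for i a
      by (rule depends_comp2[OF _ depends_D]) (use depends_M[of 0 t i a] in simp)
  qed (use Suc.prems in \<open>auto simp: spineblock_def leafblock_def\<close>)
  also have "\<dots> \<le> 4 * rN ^ (t + 2 + sum q {1..Suc t}) * (rN ^ e * ((4 ^ e + 1) * sN ^ qm))
      + 12 * (upper_const q t * (rN ^ (t + 1 + sum q {1..Suc t}) * sN ^ qm)) * (rN ^ Suc e * (1 + 2 * 2 ^ e))"
    unfolding e_def
    by (intro add_mono mult_mono power_bound_aux sE_frobenius_le Suc.IH)
      (use rN sN Suc.prems upper_const_pos[of q t] in \<open>auto intro!: mult_nonneg_nonneg sE_nonneg finP simp: mat_opnorm_nonneg frobenius_nonneg\<close>)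
  also have "\<dots> = upper_const q (Suc t) * (rN ^ (Suc t + 1 + sum q {1..Suc (Suc t)}) * sN ^ qm)"
    by (simp add: e_def power_add algebra_simps)
  finally show ?case .
qed

theorem sE_opnorm_upper:
  "sE P (\<lambda>\<xi>. mat_opnorm (X 0) (X (Suc L)) (M \<xi> 0 L)) \<le> upper_const q L * (rN ^ (L + 1 + sum q {1..L}) * sN ^ qm)"
  using sE_opnorm_MD_le[of L] by (simp add: D_def q_end)

end

section \<open>The lower bound for the chain\<close>

lemma sE_swap:
  assumes "finite A" "finite B"
  shows "sE A (\<lambda>\<epsilon>. sE B (\<lambda>\<xi>. F \<epsilon> \<xi>)) = sE B (\<lambda>\<xi>. sE A (\<lambda>\<epsilon>. F \<epsilon> \<xi>))"
proof -
  have "sE A (\<lambda>\<epsilon>. sE B (F \<epsilon>)) = sE A (\<lambda>\<epsilon>. \<Sum>\<xi>\<in>signs B. F \<epsilon> \<xi> * pmf (iid_signs B) \<xi>)"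
    by (simp add: sE_eq_sum[OF assms(2)])
  also have "\<dots> = (\<Sum>\<xi>\<in>signs B. sE A (\<lambda>\<epsilon>. F \<epsilon> \<xi>) * pmf (iid_signs B) \<xi>)"
    by (simp add: sE_sum[OF assms(1)] sE_cmult_right)
  also have "\<dots> = sE B (\<lambda>\<xi>. sE A (\<lambda>\<epsilon>. F \<epsilon> \<xi>))"
    by (simp add: sE_eq_sum[OF assms(2)])
  finally show ?thesis .
qed

lemma sE_two_coordinates:
  assumes "finite A" "x \<in> A" "y \<in> A"
  shows "sE A (\<lambda>\<epsilon>. \<epsilon> x * \<epsilon> y) = (if x = y then 1 else 0)"
proof (cases "x = y")
  case True
  have "sE A (\<lambda>\<epsilon>. \<epsilon> x * \<epsilon> y) = sE A (\<lambda>_. 1)"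
    by (rule sE_cong[OF assms(1)]) (use True assms signs_square in auto)
  then show ?thesis using True by simp
next
  case False
  then show ?thesis by (subst sE_coordinate[OF assms(1,2)]) simp
qed

text \<open>Multiplication by the single sign \<open>\<epsilon> l\<close> leaves the norm alone,
  while averaging afterwards kills every term except the one of \<open>l\<close>; Jensen for the
  norm concludes.\<close>

lemma opnorm_random_signs_ge:
  assumes fin: "finite R" "finite C" "finite X" and l: "l \<in> X"
  shows "\<bar>d l\<bar> * (L2_set (\<lambda>i. p i l) R * L2_set (r l) C)
    \<le> sE X (\<lambda>\<epsilon>. mat_opnorm R C (\<lambda>i b. \<Sum>l\<in>X. \<epsilon> l * p i l * d l * r l b))"
proof -
  have "\<bar>d l\<bar> * (L2_set (\<lambda>i. p i l) R * L2_set (r l) C) = L2_set (\<lambda>i. d l * p i l) R * L2_set (r l) C"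
    by (simp add: L2_set_cmult)
  also have "\<dots> \<le> mat_opnorm R C (\<lambda>i b. d l * p i l * r l b)" by (rule mat_opnorm_rank_one[OF fin(2)])
  also have "(\<lambda>i b. d l * p i l * r l b) = (\<lambda>i b. sE X (\<lambda>\<epsilon>. \<epsilon> l * (\<Sum>l'\<in>X. \<epsilon> l' * p i l' * d l' * r l' b)))"
  proof (intro ext)
    fix i b
    have "sE X (\<lambda>\<epsilon>. \<epsilon> l * (\<Sum>l'\<in>X. \<epsilon> l' * p i l' * d l' * r l' b))
      = sE X (\<lambda>\<epsilon>. \<Sum>l'\<in>X. (p i l' * d l' * r l' b) * (\<epsilon> l * \<epsilon> l'))"
      by (simp add: sum_distrib_left mult_ac)
    also have "\<dots> = (\<Sum>l'\<in>X. (p i l' * d l' * r l' b) * (if l = l' then 1 else 0))"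
      using fin l by (simp add: sE_sum sE_cmult sE_two_coordinates)
    also have "\<dots> = d l * p i l * r l b" using fin l by (simp add: mult_delta_right mult_ac)
    finally show "d l * p i l * r l b = sE X (\<lambda>\<epsilon>. \<epsilon> l * (\<Sum>l'\<in>X. \<epsilon> l' * p i l' * d l' * r l' b))" by simp
  qed
  also have "mat_opnorm R C (\<lambda>i b. sE X (\<lambda>\<epsilon>. \<epsilon> l * (\<Sum>l'\<in>X. \<epsilon> l' * p i l' * d l' * r l' b)))
    \<le> sE X (\<lambda>\<epsilon>. mat_opnorm R C (\<lambda>i b. \<epsilon> l * (\<Sum>l'\<in>X. \<epsilon> l' * p i l' * d l' * r l' b)))"
    by (rule mat_opnorm_sE_le) (use fin in auto)
  also have "\<dots> \<le> sE X (\<lambda>\<epsilon>. mat_opnorm R C (\<lambda>i b. \<Sum>l\<in>X. \<epsilon> l * p i l * d l * r l b))"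
  proof (rule sE_mono[OF fin(3)])
    fix \<epsilon> assume "\<epsilon> \<in> signs X"
    from signs_abs[OF this l] show "mat_opnorm R C (\<lambda>i b. \<epsilon> l * (\<Sum>l'\<in>X. \<epsilon> l' * p i l' * d l' * r l' b))
      \<le> mat_opnorm R C (\<lambda>i b. \<Sum>l\<in>X. \<epsilon> l * p i l * d l * r l b)"
      using mat_opnorm_cmult_le[OF fin(2), of R "\<epsilon> l" "\<lambda>i b. \<Sum>l\<in>X. \<epsilon> l * p i l * d l * r l b"] by simp
  qed
  finally show ?thesis .
qed

locale chain_lower = chain_model L q X Y for L q and X :: "nat \<Rightarrow> 'l set" and Y +
  fixes N :: real
  assumes N: "N > 0" and cardX: "j \<le> Suc L \<Longrightarrow> N \<le> real (card (X j))"
    and cardY: "1 \<le> j \<Longrightarrow> j \<le> L \<Longrightarrow> k < q j \<Longrightarrow> N \<le> real (card (Y j k))"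
begin

definition rN :: real where "rN = sqrt N"

lemma rN: "rN > 0" using N by (simp add: rN_def)

lemma sE_D_abs_ge:
  assumes "1 \<le> j" "j \<le> L" "a \<in> X j"
  shows "(rN / 2) ^ q j \<le> sE P (\<lambda>\<xi>. \<bar>D \<xi> j a\<bar>)"
proof -
  have "(rN / 2) ^ q j = (\<Prod>k<q j. rN / 2)" by simp
  also have "\<dots> \<le> (\<Prod>k<q j. sE P (\<lambda>\<xi>. \<bar>leafsum j k a \<xi>\<bar>))"
  proof (intro prod_mono conjI)
    fix k assume k: "k \<in> {..<q j}"
    have "rN / 2 \<le> L2_set (\<lambda>_. 1) (Y j k) / 2"
      unfolding rN_def using cardY[OF assms(1,2), of k] k by (simp add: L2_set_constant)
    also have "\<dots> \<le> sE P (\<lambda>\<xi>. \<bar>\<Sum>m\<in>Y j k. 1 * \<xi> (Lf j k a m)\<bar>)"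
      by (rule khintchine_lower[OF finP]) (use k assms in \<open>auto simp: inj_on_def intro: Lf_in_P\<close>)
    finally show "rN / 2 \<le> sE P (\<lambda>\<xi>. \<bar>leafsum j k a \<xi>\<bar>)" by (simp add: leafsum_def)
  qed (use rN in auto)
  also have "\<dots> = sE P (\<lambda>\<xi>. \<bar>D \<xi> j a\<bar>)"
    unfolding D_def abs_prod
    by (rule sE_indep_prod[OF finP, symmetric, where Y="\<lambda>k. range (Lf j k a)"]) (auto intro: depends_comp depends_leafsum)
  finally show ?thesis .
qed

lemma L2_set_const_ge: "j \<le> Suc L \<Longrightarrow> 0 \<le> c \<Longrightarrow> rN * c \<le> L2_set (\<lambda>_. c) (X j)"
  unfolding rN_def using cardX[of j] by (simp add: L2_set_constant mult_right_mono)

text \<open>Khintchine, conditionally on all but the last array, bounds the absolute value below by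
  half a Euclidean norm; Jensen moves the expectation inside that norm, where the factors separate.
  Each spine level and each leaf gains \<open>rN / 2\<close>.\<close>

lemma sE_M_abs_ge:
  assumes "s + t \<le> L" "i \<in> X s" "b \<in> X (Suc (s + t))"
  shows "(rN / 2) ^ (t + sum q {Suc s..s + t}) \<le> sE P (\<lambda>\<xi>. \<bar>M \<xi> s t i b\<bar>)"
  using assms
proof (induction t arbitrary: b)
  case 0
  have "sE P (\<lambda>\<xi>. \<bar>M \<xi> s 0 i b\<bar>) = sE P (\<lambda>\<xi>. 1)"
    using 0 Sp_in_P[of s i b] by (intro sE_cong finP) (simp add: signs_abs)
  then show ?case by simp
next
  case (Suc t)
  define j where "j = Suc (s + t)"
  define e where "e = (rN / 2) ^ (t + sum q {Suc s..s + t})"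
  have e0: "0 \<le> e" using rN by (simp add: e_def)
  let ?c = "\<lambda>a \<xi>. M \<xi> s t i a * D \<xi> j a"
  have dM: "depends (spineblock s (s + t)) (\<lambda>\<xi>. \<bar>M \<xi> s t i a\<bar>)" for a by (rule depends_comp[OF depends_M])
  have dD: "depends (leafblock j) (\<lambda>\<xi>. \<bar>D \<xi> j a\<bar>)" for a by (rule depends_comp[OF depends_D])
  have "(rN / 2) ^ (Suc t + sum q {Suc s..s + Suc t}) = rN * (e * (rN / 2) ^ q j) / 2"
    by (simp add: e_def j_def power_add)
  also have "rN * (e * (rN / 2) ^ q j) \<le> L2_set (\<lambda>_. e * (rN / 2) ^ q j) (X j)"
    by (rule L2_set_const_ge) (use Suc.prems e0 rN in \<open>auto simp: j_def\<close>)
  also have "\<dots> \<le> L2_set (\<lambda>a. sE P (\<lambda>\<xi>. \<bar>?c a \<xi>\<bar>)) (X j)"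
  proof (rule L2_set_mono)
    fix a assume a: "a \<in> X j"
    have "e * (rN / 2) ^ q j \<le> sE P (\<lambda>\<xi>. \<bar>M \<xi> s t i a\<bar>) * sE P (\<lambda>\<xi>. \<bar>D \<xi> j a\<bar>)"
      using Suc.prems a rN e0 unfolding e_def j_def
      by (intro mult_mono Suc.IH sE_D_abs_ge) (auto intro!: sE_nonneg finP)
    also have "\<dots> = sE P (\<lambda>\<xi>. \<bar>?c a \<xi>\<bar>)" unfolding abs_mult
      by (rule sE_indep[OF finP dM dD, symmetric]) (auto simp: spineblock_def leafblock_def j_def)
    finally show "e * (rN / 2) ^ q j \<le> sE P (\<lambda>\<xi>. \<bar>?c a \<xi>\<bar>)" .
  qed (use e0 rN in auto)
  also have "\<dots> \<le> sE P (\<lambda>\<xi>. L2_set (\<lambda>a. \<bar>?c a \<xi>\<bar>) (X j))"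
    by (rule L2_set_sE_le) (use finP finX Suc.prems in \<open>auto simp: j_def\<close>)
  also have "\<dots> / 2 \<le> sE P (\<lambda>\<xi>. \<bar>\<Sum>a\<in>X j. ?c a \<xi> * \<xi> (Sp j a b)\<bar>)"
    unfolding L2_set_abs
  proof (rule sE_linear_form_abs[OF finP, where Z="spineblock s (s + t) \<union> leafblock j"])
    show "depends (spineblock s (s + t) \<union> leafblock j) (?c a)" for a by (rule depends_comp2[OF depends_M depends_D])
  qed (use Suc.prems in \<open>auto simp: inj_on_def spineblock_def leafblock_def j_def intro: Sp_in_P\<close>)
  finally show ?case by (simp add: j_def divide_right_mono)
qed

lemma sE_column_norm_ge:
  assumes "t \<le> L" "l \<in> X (Suc t)"
  shows "rN * (rN / 2) ^ (t + sum q {1..t}) \<le> sE P (\<lambda>\<xi>. L2_set (\<lambda>i. M \<xi> 0 t i l) (X 0))"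
proof -
  have "rN * (rN / 2) ^ (t + sum q {1..t}) \<le> L2_set (\<lambda>_. (rN / 2) ^ (t + sum q {1..t})) (X 0)"
    by (rule L2_set_const_ge) (use rN in auto)
  also have "\<dots> \<le> L2_set (\<lambda>i. sE P (\<lambda>\<xi>. \<bar>M \<xi> 0 t i l\<bar>)) (X 0)"
    using sE_M_abs_ge[of 0 t _ l] assms rN by (intro L2_set_mono) auto
  also have "\<dots> \<le> sE P (\<lambda>\<xi>. L2_set (\<lambda>i. \<bar>M \<xi> 0 t i l\<bar>) (X 0))"
    by (rule L2_set_sE_le) (use finP finX in auto)
  finally show ?thesis by simp
qed

lemma sE_row_norm_ge:
  assumes "s + t = L" "l \<in> X s"
  shows "rN * (rN / 2) ^ (t + sum q {Suc s..L}) \<le> sE P (\<lambda>\<xi>. L2_set (M \<xi> s t l) (X (Suc L)))"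
proof -
  have "rN * (rN / 2) ^ (t + sum q {Suc s..L}) \<le> L2_set (\<lambda>_. (rN / 2) ^ (t + sum q {Suc s..L})) (X (Suc L))"
    by (rule L2_set_const_ge) (use rN in auto)
  also have "\<dots> \<le> L2_set (\<lambda>b. sE P (\<lambda>\<xi>. \<bar>M \<xi> s t l b\<bar>)) (X (Suc L))"
    using sE_M_abs_ge[of s t l] assms rN by (intro L2_set_mono) auto
  also have "\<dots> \<le> sE P (\<lambda>\<xi>. L2_set (\<lambda>b. \<bar>M \<xi> s t l b\<bar>) (X (Suc L)))"
    by (rule L2_set_sE_le) (use finP finX in auto)
  finally show ?thesis by simp
qed

text \<open>At a given label all \<open>q j\<close> leaf sums reach the threshold together with
  probability at least \<open>(1/2 * (3/32) ^ r) ^ q j\<close>. Different labels read different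
  signs, so the probability that no label succeeds is a product. \<open>r\<close> and
  \<open>m\<close>, the number and size of the blocks, stay free until \<open>n\<close> is
  known.\<close>

lemma sE_Max_D_ge:
  fixes r m :: nat
  assumes j: "1 \<le> j" "j \<le> L" and rm: "\<And>k. k < q j \<Longrightarrow> r * m \<le> card (Y j k)"
  shows "(real r * sqrt (real m) / 2) ^ q j * (1 - (1 - (1/2 * (3/32) ^ r) ^ q j) ^ card (X j))
    \<le> sE P (\<lambda>\<xi>. Max ((\<lambda>l. \<bar>D \<xi> j l\<bar>) ` X j))"
proof -
  define \<tau> where "\<tau> = real r * sqrt (real m) / 2"
  have \<tau>: "0 \<le> \<tau>" by (simp add: \<tau>_def)
  define p0 :: real where "p0 = 1/2 * (3/32) ^ r"
  define G where "G l k \<xi> = (of_bool (\<tau> \<le> leafsum j k l \<xi>) :: real)" for l k \<xi>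
  define A where "A l \<xi> = (\<Prod>k<q j. G l k \<xi>)" for l \<xi>
  have fX: "finite (X j)" and neX: "X j \<noteq> {}" using finX cardX[of j] N j by auto
  have A01: "0 \<le> A l \<xi>" "A l \<xi> \<le> 1" for l \<xi> unfolding A_def G_def by (auto intro!: prod_nonneg prod_le_1)
  have EA: "p0 ^ q j \<le> sE P (A l)" if l: "l \<in> X j" for l
  proof -
    have "p0 ^ q j = (\<Prod>k<q j. p0)" by simp
    also have "\<dots> \<le> (\<Prod>k<q j. sE P (G l k))"
    proof (intro prod_mono conjI)
      fix k assume k: "k \<in> {..<q j}"
      show "0 \<le> p0" by (simp add: p0_def)
      have "p0 \<le> sE (Y j k) (\<lambda>\<xi>. of_bool (\<tau> \<le> (\<Sum>k\<in>Y j k. \<xi> k)))"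
        unfolding p0_def \<tau>_def using k j by (intro rademacher_tail_lower finY rm) auto
      also have "\<dots> = sE P (G l k)"
        using sE_linear_form_reindex[OF finP, of "Lf j k l" "Y j k" "\<lambda>x. of_bool (\<tau> \<le> x)" "\<lambda>_. 1"] k j l
        by (simp add: G_def[abs_def] leafsum_def inj_on_def image_subset_iff Lf_in_P)
      finally show "p0 \<le> sE P (G l k)" .
    qed
    also have "\<dots> = sE P (A l)" unfolding A_def
    proof (rule sE_indep_prod[OF finP, symmetric, where Y="\<lambda>k. range (Lf j k l)"])
      show "depends (range (Lf j k l)) (G l k)" for k
        unfolding G_def by (rule depends_comp[OF depends_leafsum])
    qed auto
    finally show ?thesis .
  qed
  have dA: "depends {Lf j k l m | k m. True} (\<lambda>\<xi>. 1 - A l \<xi>)" for l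
    unfolding depends_def
  proof (intro allI impI)
    fix \<xi> \<xi>' :: "'l pos \<Rightarrow> real" assume eq: "\<forall>p\<in>{Lf j k l m | k m. True}. \<xi> p = \<xi>' p"
    have "leafsum j k l \<xi> = leafsum j k l \<xi>'" for k by (rule dependsD[OF depends_leafsum]) (use eq in auto)
    then show "1 - A l \<xi> = 1 - A l \<xi>'" by (simp add: A_def G_def)
  qed
  have "\<tau> ^ q j * (1 - (1 - p0 ^ q j) ^ card (X j)) \<le> \<tau> ^ q j * (1 - (\<Prod>l\<in>X j. 1 - sE P (A l)))"
  proof (intro mult_left_mono diff_left_mono)
    have le1: "sE P (A l) \<le> 1" for l using sE_mono[OF finP, of "A l" "\<lambda>_. 1"] A01 by simp
    have "(\<Prod>l\<in>X j. 1 - sE P (A l)) \<le> (\<Prod>l\<in>X j. 1 - p0 ^ q j)"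
      using EA le1 by (intro prod_mono) auto
    then show "(\<Prod>l\<in>X j. 1 - sE P (A l)) \<le> (1 - p0 ^ q j) ^ card (X j)" by simp
  qed (use \<tau> in auto)
  also have "(\<Prod>l\<in>X j. 1 - sE P (A l)) = sE P (\<lambda>\<xi>. \<Prod>l\<in>X j. 1 - A l \<xi>)"
    by (subst sE_indep_prod[OF finP fX dA]) (auto simp: sE_diff finP)
  also have "\<tau> ^ q j * (1 - sE P (\<lambda>\<xi>. \<Prod>l\<in>X j. 1 - A l \<xi>)) = sE P (\<lambda>\<xi>. \<tau> ^ q j * (1 - (\<Prod>l\<in>X j. 1 - A l \<xi>)))"
    by (simp add: sE_cmult sE_diff finP)
  also have "\<dots> \<le> sE P (\<lambda>\<xi>. Max ((\<lambda>l. \<bar>D \<xi> j l\<bar>) ` X j))"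
  proof (rule sE_mono[OF finP])
    fix \<xi>
    let ?M = "Max ((\<lambda>l. \<bar>D \<xi> j l\<bar>) ` X j)"
    show "\<tau> ^ q j * (1 - (\<Prod>l\<in>X j. 1 - A l \<xi>)) \<le> ?M"
    proof (cases "\<exists>l\<in>X j. \<forall>k<q j. \<tau> \<le> leafsum j k l \<xi>")
      case True
      then obtain l where l: "l \<in> X j" "\<forall>k<q j. \<tau> \<le> leafsum j k l \<xi>" by blast
      have "\<tau> ^ q j * (1 - (\<Prod>l\<in>X j. 1 - A l \<xi>)) \<le> \<tau> ^ q j * 1"
        using \<tau> A01 by (intro mult_left_mono) (auto intro!: prod_nonneg)
      also have "\<tau> ^ q j * 1 \<le> (\<Prod>k<q j. \<bar>leafsum j k l \<xi>\<bar>)"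
      proof -
        have "(\<Prod>k<q j. \<tau>) \<le> (\<Prod>k<q j. \<bar>leafsum j k l \<xi>\<bar>)"
          by (intro prod_mono) (use l \<tau> in \<open>auto intro: order_trans\<close>)
        then show ?thesis by simp
      qed
      also have "\<dots> = \<bar>D \<xi> j l\<bar>" by (simp add: D_def abs_prod)
      also have "\<dots> \<le> ?M" using l fX by (intro Max_ge) auto
      finally show ?thesis .
    next
      case False
      have "A l \<xi> = 0" if "l \<in> X j" for l
      proof -
        have "\<not> (\<forall>k<q j. \<tau> \<le> leafsum j k l \<xi>)" using False that by (metis (no_types))
        then obtain k where "k < q j" "\<not> \<tau> \<le> leafsum j k l \<xi>" by auto
        then show ?thesis unfolding A_def G_def by (intro prod_zero bexI[of _ k]) simp_all
      qed
      then have "(\<Prod>l\<in>X j. 1 - A l \<xi>) = 1" by (intro prod.neutral) auto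
      moreover obtain l where "l \<in> X j" using neX by blast
      then have "\<bar>D \<xi> j l\<bar> \<le> ?M" using fX by (intro Max_ge) auto
      then have "0 \<le> ?M" using abs_ge_zero[of "D \<xi> j l"] by linarith
      ultimately show ?thesis by simp
    qed
  qed
  finally show ?thesis by (simp add: \<tau>_def p0_def)
qed

text \<open>The sign sits on the column index of the last array of the left factor and comes out as
  \<open>e l\<close>; the diagonal and the right factor do not read that array.\<close>

lemma M_flip:
  assumes "\<epsilon> = (\<lambda>p. case p of Sp j a b \<Rightarrow> if j = t then e b else 1 | Lf j k a m \<Rightarrow> 1)"
  shows "M (\<lambda>p. \<epsilon> p * \<xi> p) 0 t i l = e l * M \<xi> 0 t i l"
    "D (\<lambda>p. \<epsilon> p * \<xi> p) (Suc t) l = D \<xi> (Suc t) l"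
    "M (\<lambda>p. \<epsilon> p * \<xi> p) (Suc t) t' i b = M \<xi> (Suc t) t' i b"
proof -
  show 1: "D (\<lambda>p. \<epsilon> p * \<xi> p) j l = D \<xi> j l" for j l
    by (rule dependsD[OF depends_D]) (auto simp: assms leafblock_def)
  show "M (\<lambda>p. \<epsilon> p * \<xi> p) (Suc t) t' i b = M \<xi> (Suc t) t' i b"
    by (rule dependsD[OF depends_M]) (auto simp: assms spineblock_def)
  show "M (\<lambda>p. \<epsilon> p * \<xi> p) 0 t i l = e l * M \<xi> 0 t i l"
  proof (cases t)
    case (Suc t'')
    have 2: "M (\<lambda>p. \<epsilon> p * \<xi> p) 0 t'' i a = M \<xi> 0 t'' i a" for a
      by (rule dependsD[OF depends_M]) (auto simp: assms spineblock_def Suc)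
    show ?thesis unfolding Suc M.simps 1 2 by (simp add: assms Suc sum_distrib_left mult_ac)
  qed (simp add: assms)
qed

text \<open>Multiplying column \<open>l\<close> of \<open>A\<^sub>t\<close> by a sign \<open>e l\<close> does not change the distribution; averaging over \<open>e\<close>
  isolates the rank one contribution of a single label \<open>l\<close>, and \<open>l\<close> is chosen to maximise \<open>\<bar>D \<xi> (Suc t) l\<bar>\<close>.\<close>

theorem sE_opnorm_lower:
  fixes r m :: nat
  assumes L: "L = Suc (t + t')" and rm: "\<And>k. k < q (Suc t) \<Longrightarrow> r * m \<le> card (Y (Suc t) k)"
  shows "(rN * (rN / 2) ^ (t + sum q {1..t})) * (rN * (rN / 2) ^ (t' + sum q {Suc (Suc t)..L}))
    * ((real r * sqrt (real m) / 2) ^ q (Suc t) * (1 - (1 - (1/2 * (3/32) ^ r) ^ q (Suc t)) ^ card (X (Suc t))))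
    \<le> sE P (\<lambda>\<xi>. mat_opnorm (X 0) (X (Suc L)) (M \<xi> 0 L))"
proof -
  define j where "j = Suc t"
  have j: "1 \<le> j" "j \<le> L" using L by (auto simp: j_def)
  have fX: "finite (X j)" and neX: "X j \<noteq> {}" using finX cardX[of j] N j by auto
  define cc where "cc = (rN * (rN / 2) ^ (t + sum q {1..t})) * (rN * (rN / 2) ^ (t' + sum q {Suc (Suc t)..L}))"
  have cc0: "0 \<le> cc" using rN by (simp add: cc_def)
  define p where "p \<xi> l = L2_set (\<lambda>i. M \<xi> 0 t i l) (X 0)" for \<xi> l
  define w where "w \<xi> l = L2_set (M \<xi> j t' l) (X (Suc L))" for \<xi> l
  \<comment> \<open>The maximising label is a function of the diagonal alone, hence independent of
    the norms \<open>p\<close> and \<open>w\<close>, whose lower bounds in expectation are uniform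
    in the label.\<close>
  define lm where "lm d = (SOME l. l \<in> X j \<and> \<bar>d l\<bar> = Max ((\<lambda>l. \<bar>d l\<bar>) ` X j))" for d :: "'l \<Rightarrow> real"
  have lm: "lm d \<in> X j \<and> \<bar>d (lm d)\<bar> = Max ((\<lambda>l. \<bar>d l\<bar>) ` X j)" for d
    unfolding lm_def
  proof (rule someI_ex)
    have "Max ((\<lambda>l. \<bar>d l\<bar>) ` X j) \<in> (\<lambda>l. \<bar>d l\<bar>) ` X j" using fX neX by (intro Max_in) auto
    then show "\<exists>l. l \<in> X j \<and> \<bar>d l\<bar> = Max ((\<lambda>l. \<bar>d l\<bar>) ` X j)" by force
  qed
  have dp: "depends (spineblock 0 t) (\<lambda>\<xi>. p \<xi> l)" for l
    unfolding depends_def p_def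
  proof (intro allI impI L2_set_cong refl)
    fix \<xi> \<xi>' :: "'l pos \<Rightarrow> real" and i assume "\<forall>x\<in>spineblock 0 t. \<xi> x = \<xi>' x"
    then show "M \<xi> 0 t i l = M \<xi>' 0 t i l" by (intro dependsD[OF depends_M]) auto
  qed
  have dw: "depends (spineblock j L) (\<lambda>\<xi>. w \<xi> l)" for l
    unfolding depends_def w_def
  proof (intro allI impI L2_set_cong refl)
    fix \<xi> \<xi>' :: "'l pos \<Rightarrow> real" and b assume "\<forall>x\<in>spineblock j L. \<xi> x = \<xi>' x"
    then show "M \<xi> j t' l b = M \<xi>' j t' l b" by (intro dependsD[OF depends_M]) (auto simp: L j_def)
  qed
  have dpw: "depends (spineblock 0 t \<union> spineblock j L) (\<lambda>\<xi>. p \<xi> l * w \<xi> l)" for l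
    by (rule depends_comp2[OF dp dw])
  have "cc * ((real r * sqrt (real m) / 2) ^ q j * (1 - (1 - (1/2 * (3/32) ^ r) ^ q j) ^ card (X j)))
    \<le> cc * sE P (\<lambda>\<xi>. Max ((\<lambda>l. \<bar>D \<xi> j l\<bar>) ` X j))"
    using rm by (intro mult_left_mono sE_Max_D_ge j cc0) (simp add: j_def)
  also have "\<dots> = cc * sE P (\<lambda>\<xi>. \<Sum>l\<in>X j. of_bool (lm (D \<xi> j) = l) * \<bar>D \<xi> j l\<bar>)"
  proof -
    have "(\<Sum>l\<in>X j. of_bool (lm d = l) * \<bar>d l\<bar>) = Max ((\<lambda>l. \<bar>d l\<bar>) ` X j)" for d :: "'l \<Rightarrow> real"
      using fX lm[of d] by (simp add: of_bool_def mult_delta_left)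
    then show ?thesis by simp
  qed
  also have "\<dots> = (\<Sum>l\<in>X j. sE P (\<lambda>\<xi>. of_bool (lm (D \<xi> j) = l) * \<bar>D \<xi> j l\<bar>) * cc)"
    by (simp add: sE_sum finP sum_distrib_left mult_ac)
  also have "\<dots> \<le> (\<Sum>l\<in>X j. sE P (\<lambda>\<xi>. of_bool (lm (D \<xi> j) = l) * \<bar>D \<xi> j l\<bar>) * sE P (\<lambda>\<xi>. p \<xi> l * w \<xi> l))"
  proof (intro sum_mono mult_left_mono)
    fix l assume l: "l \<in> X j"
    have "cc \<le> sE P (\<lambda>\<xi>. p \<xi> l) * sE P (\<lambda>\<xi>. w \<xi> l)"
    proof -
      have "rN * (rN / 2) ^ (t + sum q {1..t}) \<le> sE P (\<lambda>\<xi>. p \<xi> l)"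
        unfolding p_def by (rule sE_column_norm_ge) (use l L in \<open>auto simp: j_def\<close>)
      moreover have "rN * (rN / 2) ^ (t' + sum q {Suc (Suc t)..L}) \<le> sE P (\<lambda>\<xi>. w \<xi> l)"
        using sE_row_norm_ge[of j t' l] l L unfolding w_def j_def by simp
      moreover have "0 \<le> sE P (\<lambda>\<xi>. p \<xi> l)" unfolding p_def by (intro sE_nonneg finP) auto
      ultimately show ?thesis unfolding cc_def using rN by (intro mult_mono) auto
    qed
    also have "\<dots> = sE P (\<lambda>\<xi>. p \<xi> l * w \<xi> l)"
      by (rule sE_indep[OF finP dp dw, symmetric]) (auto simp: spineblock_def j_def)
    finally show "cc \<le> sE P (\<lambda>\<xi>. p \<xi> l * w \<xi> l)" .
  qed (auto intro!: sE_nonneg finP)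
  also have "\<dots> = (\<Sum>l\<in>X j. sE P (\<lambda>\<xi>. (of_bool (lm (D \<xi> j) = l) * \<bar>D \<xi> j l\<bar>) * (p \<xi> l * w \<xi> l)))"
  proof (intro sum.cong refl sE_indep[symmetric, OF finP _ dpw])
    show "depends (leafblock j) (\<lambda>\<xi>. of_bool (lm (D \<xi> j) = l) * \<bar>D \<xi> j l\<bar>)" for l
    proof -
      have "depends (leafblock j) (\<lambda>\<xi>. D \<xi> j)"
        unfolding depends_def by (intro allI impI ext dependsD[OF depends_D]) auto
      then show ?thesis by (rule depends_comp)
    qed
  qed (auto simp: spineblock_def leafblock_def j_def)
  also have "\<dots> = sE P (\<lambda>\<xi>. \<Sum>l\<in>X j. of_bool (lm (D \<xi> j) = l) * (\<bar>D \<xi> j l\<bar> * (p \<xi> l * w \<xi> l)))"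
    by (simp add: sE_sum finP mult_ac)
  also have "\<dots> = sE P (\<lambda>\<xi>. \<bar>D \<xi> j (lm (D \<xi> j))\<bar> * (p \<xi> (lm (D \<xi> j)) * w \<xi> (lm (D \<xi> j))))"
    using fX lm by (simp add: of_bool_def mult_delta_left)
  also have "\<dots> \<le> sE P (\<lambda>\<xi>. sE (X j) (\<lambda>e. mat_opnorm (X 0) (X (Suc L)) (\<lambda>i b. \<Sum>l\<in>X j. e l * M \<xi> 0 t i l * D \<xi> j l * M \<xi> j t' l b)))"
    unfolding p_def w_def by (intro sE_mono finP opnorm_random_signs_ge) (use finX fX lm in auto)
  also have "\<dots> = sE (X j) (\<lambda>e. sE P (\<lambda>\<xi>. mat_opnorm (X 0) (X (Suc L)) (\<lambda>i b. \<Sum>l\<in>X j. e l * M \<xi> 0 t i l * D \<xi> j l * M \<xi> j t' l b)))"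
    by (rule sE_swap[OF finP fX])
  also have "\<dots> = sE (X j) (\<lambda>e. sE P (\<lambda>\<xi>. mat_opnorm (X 0) (X (Suc L)) (M \<xi> 0 L)))"
  proof (rule sE_cong[OF fX])
    fix e assume e: "e \<in> signs (X j)"
    define \<epsilon> where "\<epsilon> = (\<lambda>p. case p of Sp j a b \<Rightarrow> if j = t then e b else 1 | Lf j k a m \<Rightarrow> (1::real))"
    have sg: "\<epsilon> p = -1 \<or> \<epsilon> p = 1" if "p \<in> P" for p
      using that signsD[OF e] by (auto simp: P_def \<epsilon>_def j_def split: pos.splits)
    have "M (\<lambda>p. \<epsilon> p * \<xi> p) 0 L = (\<lambda>i b. \<Sum>l\<in>X j. e l * M \<xi> 0 t i l * D \<xi> j l * M \<xi> j t' l b)" for \<xi>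
      unfolding L M_split j_def add_0 by (simp add: M_flip[OF \<epsilon>_def])
    then show "sE P (\<lambda>\<xi>. mat_opnorm (X 0) (X (Suc L)) (\<lambda>i b. \<Sum>l\<in>X j. e l * M \<xi> 0 t i l * D \<xi> j l * M \<xi> j t' l b))
       = sE P (\<lambda>\<xi>. mat_opnorm (X 0) (X (Suc L)) (M \<xi> 0 L))"
      using sE_flip[OF finP, of \<epsilon> "\<lambda>\<xi>. mat_opnorm (X 0) (X (Suc L)) (M \<xi> 0 L)"] sg by simp
  qed
  finally show ?thesis by (simp add: cc_def j_def)
qed

end

section \<open>The typed model\<close>

text \<open>The value \<open>undefined\<close> elsewhere makes the labeling extensional, as are the
  \<open>PiE\<close> positions of the typed arrays.\<close>

definition pair_labeling :: "'v \<Rightarrow> 'l \<Rightarrow> 'v \<Rightarrow> 'l \<Rightarrow> 'v \<Rightarrow> 'l" where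
  "pair_labeling x a y b = (\<lambda>z. if z = x then a else if z = y then b else undefined)"

lemma restrict_eq_pair_labeling: "x \<noteq> y \<Longrightarrow> restrict l {x, y} = pair_labeling x (l x) y (l y)"
  by (auto simp: pair_labeling_def restrict_def)

lemma pair_labeling_eq_iff: "x \<noteq> y \<Longrightarrow> pair_labeling x a y b = pair_labeling x a' y b' \<longleftrightarrow> a = a' \<and> b = b'"
proof
  assume xy: "x \<noteq> y" and eq: "pair_labeling x a y b = pair_labeling x a' y b'"
  from fun_cong[OF eq, of x] fun_cong[OF eq, of y] xy show "a = a' \<and> b = b'" by (simp add: pair_labeling_def)
qed simp

fun typed_pos :: "'l pos \<Rightarrow> role set \<times> (role \<Rightarrow> 'l)" where
  "typed_pos (Sp j a b) = ({Spine j, Spine (Suc j)}, pair_labeling (Spine j) a (Spine (Suc j)) b)"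
| "typed_pos (Lf j k a m) = ({Spine j, Leaf j k}, pair_labeling (Spine j) a (Leaf j k) m)"

lemma inj_typed_pos: "inj typed_pos"
proof (rule injI)
  fix p p' :: "'a pos" assume "typed_pos p = typed_pos p'"
  then show "p = p'"
    by (cases p; cases p') (auto simp: doubleton_eq_iff pair_labeling_eq_iff)
qed

lemma finite_chain_verts: "finite (chain_verts L q)"
proof -
  have "chain_verts L q = Spine ` {..Suc L} \<union> (\<Union>j\<in>{1..L}. Leaf j ` {..<q j})"
    by (auto simp: chain_verts_def)
  then show ?thesis by simp
qed

lemma chain_edges_eq:
  "chain_edges L q = (\<lambda>j. {Spine j, Spine (Suc j)}) ` {..L} \<union> (\<Union>j\<in>{1..L}. (\<lambda>k. {Spine j, Leaf j k}) ` {..<q j})"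
proof -
  have "{{Spine j, Spine (j + 1)} |j. j \<le> L} = (\<lambda>j. {Spine j, Spine (Suc j)}) ` {..L}"
    unfolding image_def by auto
  moreover have "{{Spine j, Leaf j k} |j k. 1 \<le> j \<and> j \<le> L \<and> k < q j}
      = (\<Union>j\<in>{1..L}. (\<lambda>k. {Spine j, Leaf j k}) ` {..<q j})"
    unfolding image_def by (intro set_eqI) (simp only: UN_iff mem_Collect_eq Bex_def atLeastAtMost_iff lessThan_iff, blast)
  ultimately show ?thesis unfolding chain_edges_def by simp
qed

lemma finite_chain_edges: "finite (chain_edges L q)"
  unfolding chain_edges_eq by simp

lemma chain_edges_subset: "e \<in> chain_edges L q \<Longrightarrow> e \<subseteq> chain_verts L q"
  by (auto simp: chain_edges_def chain_verts_def)

lemma chain_verts_0: "chain_verts 0 q = {Spine 0, Spine 1}"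
proof -
  have "{Spine j |j. j \<le> 0 + 1} = {Spine 0, Spine 1}" by (auto simp: le_Suc_eq)
  then show ?thesis by (auto simp: chain_verts_def)
qed

lemma chain_edges_0: "chain_edges 0 q = {{Spine 0, Spine 1}}"
  by (auto simp: chain_edges_def)

lemma chain_verts_Suc: "chain_verts (Suc t) q = chain_verts t q \<union> Leaf (Suc t) ` {..<q (Suc t)} \<union> {Spine (Suc (Suc t))}"
  by (auto simp: chain_verts_def le_Suc_eq)

lemma chain_edges_Suc: "chain_edges (Suc t) q = chain_edges t q \<union> (\<lambda>k. {Spine (Suc t), Leaf (Suc t) k}) ` {..<q (Suc t)} \<union> {{Spine (Suc t), Spine (Suc (Suc t))}}"
  by (auto simp: chain_edges_def le_Suc_eq)

locale typed_chain =
  fixes L :: nat and q :: "nat \<Rightarrow> nat" and I :: "role \<Rightarrow> 'l set"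
  assumes finI: "x \<in> chain_verts L q \<Longrightarrow> finite (I x)" and q_end: "q (Suc L) = 0"
begin

sublocale chain_model L q "\<lambda>j. I (Spine j)" "\<lambda>j k. I (Leaf j k)"
  by unfold_locales (auto simp: chain_verts_def q_end intro: finI)

text \<open>At stage \<open>t\<close> the vertex \<open>Spine (Suc t)\<close> is an endpoint without
  leaves; at the next stage it becomes interior, receives its leaves and its label is summed over.
  Distributivity turns the product of leaf sums into a sum over labelings of the leaves.\<close>

lemma typed_matrix_eq_M:
  assumes "t \<le> L" "i \<in> I (Spine 0)" "b \<in> I (Spine (Suc t))"
  shows "typed_matrix (chain_verts t q) (chain_edges t q) (Spine 0) (Spine (Suc t)) I \<xi> i b
     = M (\<lambda>p. \<xi> (typed_pos p)) 0 t i b"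
  using assms
proof (induction t arbitrary: b)
  case 0
  have "{l \<in> PiE {Spine 0, Spine 1} I. l (Spine 0) = i \<and> l (Spine 1) = b} = {pair_labeling (Spine 0) i (Spine 1) b}"
    using 0 by (auto simp: PiE_def Pi_def extensional_def pair_labeling_def fun_eq_iff)
  then show ?case
    unfolding typed_matrix_def chain_verts_0 chain_edges_0
    by (simp add: restrict_eq_pair_labeling) (simp add: pair_labeling_def)
next
  case (Suc t)
  define W where "W = chain_verts t q"
  define E where "E = chain_edges t q"
  define n where "n = q (Suc t)"
  define v where "v = Spine (Suc t)"
  define v' where "v' = Spine (Suc (Suc t))"
  define lf where "lf = Leaf (Suc t)"
  define F where "F = PiE {..<n} (\<lambda>k. I (lf k))"
  \<comment> \<open>Only the first label is fixed; grouping by the label of \<open>v\<close> is the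
    sum over the inner index of the matrix product.\<close>
  define Z where "Z = {l \<in> PiE W I. l (Spine 0) = i}"
  have vW: "v \<in> W" "Spine 0 \<in> W" by (auto simp: W_def v_def chain_verts_def)
  have nW: "v' \<notin> W" "lf k \<notin> W" "v' \<noteq> lf k" "v \<noteq> lf k" "v \<noteq> v'" "Spine 0 \<noteq> v'" "lf k \<noteq> Spine j" for k j
    by (auto simp: W_def v'_def v_def lf_def chain_verts_def)
  have subW: "W \<subseteq> chain_verts L q" using Suc.prems(1) by (auto simp: W_def chain_verts_def)
  have finW: "finite W" unfolding W_def by (rule finite_chain_verts)
  have "finite (PiE W I)" by (intro finite_PiE finW finI) (use subW in auto)
  then have finZ: "finite Z" by (auto simp: Z_def)
  have finIl: "finite (I (lf k))" if "k < n" for k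
    using that Suc.prems(1) by (intro finI) (auto simp: lf_def chain_verts_def n_def)
  have finE: "finite E" unfolding E_def by (rule finite_chain_edges)
  have W': "chain_verts (Suc t) q = W \<union> lf ` {..<n} \<union> {v'}"
    by (simp add: chain_verts_Suc W_def lf_def n_def v'_def)
  have prodE: "(\<Prod>e\<in>chain_edges (Suc t) q. \<xi> (e, restrict l e))
    = (\<Prod>e\<in>E. \<xi> (e, restrict l e)) * (\<Prod>k<n. \<xi> (typed_pos (Lf (Suc t) k (l v) (l (lf k))))) * \<xi> (typed_pos (Sp (Suc t) (l v) (l v')))" for l
  proof -
    have inj: "inj_on (\<lambda>k. {v, lf k}) {..<n}" by (auto simp: inj_on_def doubleton_eq_iff lf_def v_def)
    have EW: "e \<subseteq> W" if "e \<in> E" for e using that chain_edges_subset by (auto simp: E_def W_def)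
    have d1: "E \<inter> (\<lambda>k. {v, lf k}) ` {..<n} = {}" using EW nW by auto
    have d2: "(E \<union> (\<lambda>k. {v, lf k}) ` {..<n}) \<inter> {{v, v'}} = {}" using EW nW by (auto simp: doubleton_eq_iff)
    have "chain_edges (Suc t) q = (E \<union> (\<lambda>k. {v, lf k}) ` {..<n}) \<union> {{v, v'}}"
      by (simp add: chain_edges_Suc E_def v_def lf_def n_def v'_def)
    then have "(\<Prod>e\<in>chain_edges (Suc t) q. \<xi> (e, restrict l e))
      = (\<Prod>e\<in>E. \<xi> (e, restrict l e)) * (\<Prod>e\<in>(\<lambda>k. {v, lf k}) ` {..<n}. \<xi> (e, restrict l e)) * \<xi> ({v, v'}, restrict l {v, v'})"
      using finE d1 d2 by (simp add: prod.union_disjoint)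
    also have "(\<Prod>e\<in>(\<lambda>k. {v, lf k}) ` {..<n}. \<xi> (e, restrict l e)) = (\<Prod>k<n. \<xi> ({v, lf k}, restrict l {v, lf k}))"
      by (simp add: prod.reindex[OF inj])
    finally have *: "(\<Prod>e\<in>chain_edges (Suc t) q. \<xi> (e, restrict l e))
      = (\<Prod>e\<in>E. \<xi> (e, restrict l e)) * (\<Prod>k<n. \<xi> ({v, lf k}, restrict l {v, lf k})) * \<xi> ({v, v'}, restrict l {v, v'})" .
    show ?thesis unfolding * restrict_eq_pair_labeling[OF nW(4)] restrict_eq_pair_labeling[OF nW(5)]
      by (simp only: typed_pos.simps v_def v'_def lf_def)
  qed
  have "M (\<lambda>p. \<xi> (typed_pos p)) 0 (Suc t) i b
    = (\<Sum>a\<in>I v. (\<Sum>l\<in>{l \<in> Z. l v = a}. \<Prod>e\<in>E. \<xi> (e, restrict l e))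
       * (\<Prod>k<n. \<Sum>m\<in>I (lf k). \<xi> (typed_pos (Lf (Suc t) k a m))) * \<xi> (typed_pos (Sp (Suc t) a b)))"
  proof -
    have "M (\<lambda>p. \<xi> (typed_pos p)) 0 t i a = (\<Sum>l\<in>{l \<in> Z. l v = a}. \<Prod>e\<in>E. \<xi> (e, restrict l e))" if "a \<in> I v" for a
      using Suc.IH[of a] Suc.prems that unfolding typed_matrix_def Z_def v_def W_def E_def
      by (simp add: conj_assoc)
    then show ?thesis unfolding M.simps D_def leafsum_def add_0 n_def lf_def v_def
      by (intro sum.cong refl arg_cong2[where f="(*)"]) auto
  qed
  also have "\<dots> = (\<Sum>a\<in>I v. \<Sum>l\<in>{l \<in> Z. l v = a}. \<Sum>f\<in>F. (\<Prod>e\<in>E. \<xi> (e, restrict l e))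
       * (\<Prod>k<n. \<xi> (typed_pos (Lf (Suc t) k (l v) (f k)))) * \<xi> (typed_pos (Sp (Suc t) (l v) b)))"
  proof (rule sum.cong[OF refl])
    fix a
    have *: "(\<Prod>k<n. \<Sum>m\<in>I (lf k). \<xi> (typed_pos (Lf (Suc t) k a m))) = (\<Sum>f\<in>F. \<Prod>k<n. \<xi> (typed_pos (Lf (Suc t) k a (f k))))"
      unfolding F_def by (rule prod_sum_PiE) (use finIl in auto)
    show "(\<Sum>l\<in>{l \<in> Z. l v = a}. \<Prod>e\<in>E. \<xi> (e, restrict l e))
       * (\<Prod>k<n. \<Sum>m\<in>I (lf k). \<xi> (typed_pos (Lf (Suc t) k a m))) * \<xi> (typed_pos (Sp (Suc t) a b))
      = (\<Sum>l\<in>{l \<in> Z. l v = a}. \<Sum>f\<in>F. (\<Prod>e\<in>E. \<xi> (e, restrict l e))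
       * (\<Prod>k<n. \<xi> (typed_pos (Lf (Suc t) k (l v) (f k)))) * \<xi> (typed_pos (Sp (Suc t) (l v) b)))"
      unfolding * sum_product sum_distrib_right
      by (intro sum.cong refl) (auto simp: sum_distrib_left sum_distrib_right)
  qed
  also have "\<dots> = (\<Sum>l\<in>Z. \<Sum>f\<in>F. (\<Prod>e\<in>E. \<xi> (e, restrict l e))
       * (\<Prod>k<n. \<xi> (typed_pos (Lf (Suc t) k (l v) (f k)))) * \<xi> (typed_pos (Sp (Suc t) (l v) b)))"
  proof (rule sum.group[OF finZ])
    show "finite (I v)" using vW subW by (intro finI) auto
    show "(\<lambda>l. l v) ` Z \<subseteq> I v" using vW by (auto simp: Z_def)
  qed
  also have "\<dots> = (\<Sum>(l, f)\<in>Z \<times> F. (\<Prod>e\<in>E. \<xi> (e, restrict l e))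
       * (\<Prod>k<n. \<xi> (typed_pos (Lf (Suc t) k (l v) (f k)))) * \<xi> (typed_pos (Sp (Suc t) (l v) b)))"
    by (rule sum.cartesian_product)
  also have "\<dots> = typed_matrix (chain_verts (Suc t) q) (chain_edges (Suc t) q) (Spine 0) v' I \<xi> i b"
    unfolding typed_matrix_def prodE
  \<comment> \<open>A labeling of the longer chain is one of the shorter chain together with labels
    of the new leaves, the label \<open>b\<close> of the new endpoint being prescribed.\<close>
  proof (rule sum.reindex_bij_witness[where
      j = "\<lambda>(l, f) x. if x \<in> W then l x else if x = v' then b else if x \<in> lf ` {..<n} then f (THE k. x = lf k) else undefined"
      and i = "\<lambda>l. (restrict l W, \<lambda>k\<in>{..<n}. l (lf k))"])
    have the: "(THE k'. lf k = lf k') = k" for k by (auto simp: lf_def)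
    let ?j = "\<lambda>(l, f) x. if x \<in> W then l x else if x = v' then b else if x \<in> lf ` {..<n} then f (THE k. x = lf k) else undefined"
    fix p assume "p \<in> Z \<times> F"
    then obtain l f where p: "p = (l, f)" and l: "l \<in> PiE W I" "l (Spine 0) = i" and f: "f \<in> F" by (auto simp: Z_def)
    have jlf: "?j p (lf k) = f k" if "k < n" for k using that nW by (auto simp: p the)
    have jv': "?j p v' = b" using nW by (simp add: p)
    have jv: "?j p v = l v" using vW by (simp add: p)
    have jW: "restrict (?j p) W = l" using l by (auto simp: p fun_eq_iff PiE_def extensional_def)
    show "(restrict (?j p) W, \<lambda>k\<in>{..<n}. ?j p (lf k)) = p"
      using jW jlf f by (auto simp: p fun_eq_iff F_def PiE_def extensional_def)
    have "?j p \<in> PiE (W \<union> lf ` {..<n} \<union> {v'}) I"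
    proof (rule PiE_I)
      fix x assume "x \<in> W \<union> lf ` {..<n} \<union> {v'}"
      then consider "x \<in> W" | "x = v'" | k where "k < n" "x = lf k" by auto
      then show "?j p x \<in> I x"
      proof cases
        case 1 then show ?thesis using l by (auto simp: p)
      next
        case 2 then show ?thesis using Suc.prems(3) jv' by (simp add: v'_def)
      next
        case 3 then show ?thesis using jlf f by (auto simp: F_def)
      qed
    qed (auto simp: p)
    then show "?j p \<in> {l \<in> PiE (chain_verts (Suc t) q) I. l (Spine 0) = i \<and> l v' = b}"
      unfolding W' using jv' vW l by (simp add: p)
    have "restrict (?j p) e = restrict l e" if "e \<in> E" for e
      using chain_edges_subset[of e t q] that by (auto simp: p E_def W_def fun_eq_iff restrict_def)
    then show "(\<Prod>e\<in>E. \<xi> (e, restrict (?j p) e)) * (\<Prod>k<n. \<xi> (typed_pos (Lf (Suc t) k (?j p v) (?j p (lf k))))) * \<xi> (typed_pos (Sp (Suc t) (?j p v) (?j p v')))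
      = (case p of (l, f) \<Rightarrow> (\<Prod>e\<in>E. \<xi> (e, restrict l e))
       * (\<Prod>k<n. \<xi> (typed_pos (Lf (Suc t) k (l v) (f k)))) * \<xi> (typed_pos (Sp (Suc t) (l v) b)))"
      unfolding jv jv' using jlf by (simp add: p)
  next
    let ?j = "\<lambda>(l, f) x. if x \<in> W then l x else if x = v' then b else if x \<in> lf ` {..<n} then f (THE k. x = lf k) else undefined"
    have the: "(THE k'. lf k = lf k') = k" for k by (auto simp: lf_def)
    fix l assume "l \<in> {l \<in> PiE (chain_verts (Suc t) q) I. l (Spine 0) = i \<and> l v' = b}"
    then have l: "l \<in> PiE (W \<union> lf ` {..<n} \<union> {v'}) I" "l (Spine 0) = i" "l v' = b" unfolding W' by auto
    show "?j (restrict l W, \<lambda>k\<in>{..<n}. l (lf k)) = l"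
    proof
      fix x
      consider "x \<in> W" | "x \<notin> W" "x = v'" | k where "x \<notin> W" "x \<noteq> v'" "k < n" "x = lf k" | "x \<notin> W \<union> lf ` {..<n} \<union> {v'}" by auto
      then show "?j (restrict l W, \<lambda>k\<in>{..<n}. l (lf k)) x = l x"
      proof cases
        case 4 then show ?thesis using l(1) by (auto simp: PiE_def extensional_def)
      qed (use l the in auto)
    qed
    show "(restrict l W, \<lambda>k\<in>{..<n}. l (lf k)) \<in> Z \<times> F"
      using l vW by (auto simp: Z_def F_def PiE_def Pi_def)
  qed
  finally show ?case by (simp add: v'_def)
qed

text \<open>Sharper than \<open>depends_M\<close>: for boundary labels in their sets only the
  finitely many positions in \<open>P\<close> are read, which the transport of signs
  requires.\<close>

lemma M_cong:
  assumes "\<And>p. p \<in> P \<Longrightarrow> \<xi> p = \<xi>' p" "s + t \<le> L" "i \<in> I (Spine s)" "b \<in> I (Spine (Suc (s + t)))"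
  shows "M \<xi> s t i b = M \<xi>' s t i b"
  using assms(2-)
proof (induction t arbitrary: b)
  case 0 then show ?case using assms(1)[OF Sp_in_P] by simp
next
  case (Suc t)
  have D: "D \<xi> (Suc (s + t)) a = D \<xi>' (Suc (s + t)) a" if "a \<in> I (Spine (Suc (s + t)))" for a
    unfolding D_def leafsum_def using that Suc.prems by (intro prod.cong sum.cong refl assms(1) Lf_in_P) auto
  show ?case unfolding M.simps
    using Suc.prems by (intro sum.cong refl arg_cong2[where f="(*)"] Suc.IH D assms(1) Sp_in_P) auto
qed

lemma finite_typed_positions: "finite (typed_positions (chain_edges L q) I)"
  unfolding typed_positions_def
proof (intro finite_SigmaI finite_chain_edges finite_PiE)
  fix e x assume e: "e \<in> chain_edges L q"
  show "finite e" using chain_edges_subset[OF e] finite_chain_verts finite_subset by blast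
  show "x \<in> e \<Longrightarrow> finite (I x)" using chain_edges_subset[OF e] finI by blast
qed

lemma typed_expected_norm_eq:
  "typed_expected_norm (chain_verts L q) (chain_edges L q) (Spine 0) (Spine (Suc L)) I
    = sE P (\<lambda>\<xi>. mat_opnorm (I (Spine 0)) (I (Spine (Suc L))) (M \<xi> 0 L))"
proof -
  let ?F = "\<lambda>\<xi>. mat_opnorm (I (Spine 0)) (I (Spine (Suc L))) (M \<xi> 0 L)"
  have "typed_expected_norm (chain_verts L q) (chain_edges L q) (Spine 0) (Spine (Suc L)) I
    = sE (typed_positions (chain_edges L q) I) (\<lambda>\<xi>. ?F (\<lambda>p. \<xi> (typed_pos p)))"
    unfolding typed_expected_norm_def sE_def[symmetric]
    by (intro sE_cong finite_typed_positions mat_opnorm_cong typed_matrix_eq_M) auto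
  also have "\<dots> = sE P ?F"
  proof (rule sE_reindex'[OF finite_typed_positions])
    show "inj_on typed_pos P" using inj_typed_pos by (rule inj_on_subset) auto
    show "typed_pos ` P \<subseteq> typed_positions (chain_edges L q) I"
      by (auto simp: P_def typed_positions_def chain_edges_def pair_labeling_def PiE_def extensional_def)
    show "depends P ?F" unfolding depends_def
      by (intro allI impI mat_opnorm_cong M_cong) auto
  qed
  finally show ?thesis .
qed

end

section \<open>Constants for the typed model\<close>

definition chain_rate :: "nat \<Rightarrow> nat \<Rightarrow> nat \<Rightarrow> real" where
  "chain_rate k qm n = real n powr (real k / 2) * ln (real n) powr (real qm / 2)"

lemma powr_half_nat: "0 < x \<Longrightarrow> x powr (real k / 2) = sqrt x ^ k"
  using powr_powr[of x "1/2" "real k"] by (simp add: powr_half_sqrt powr_realpow)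

lemma chain_rate_eq:
  assumes "1 < real n" shows "chain_rate k qm n = sqrt (real n) ^ k * sqrt (ln (real n)) ^ qm"
  unfolding chain_rate_def using assms by (subst (1 2) powr_half_nat) auto

lemma typed_upper:
  fixes q :: "nat \<Rightarrow> nat" and C :: real
  assumes q_end: "q (Suc L) = 0" and qm: "\<And>j. j \<le> Suc L \<Longrightarrow> q j \<le> qm" and C: "C \<ge> 1"
  obtains b where "b > 0"
    "\<And>n I. real n \<ge> max 3 C \<Longrightarrow> (\<And>x. x \<in> chain_verts L q \<Longrightarrow> finite (I x) \<and> real (card (I x)) \<le> C * real n)
      \<Longrightarrow> typed_expected_norm (chain_verts L q) (chain_edges L q) (Spine 0) (Spine (Suc L)) (I :: role \<Rightarrow> 'l set)
         \<le> b * chain_rate (L + 1 + sum q {1..L}) qm n"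
proof
  let ?k = "L + 1 + sum q {1..L}"
  let ?b = "upper_const q L * (sqrt C ^ ?k * sqrt 2 ^ qm)"
  show "?b > 0" using C by (intro mult_pos_pos upper_const_pos) auto
  fix n :: nat and I :: "role \<Rightarrow> 'l set"
  assume n: "real n \<ge> max 3 C" and I: "\<And>x. x \<in> chain_verts L q \<Longrightarrow> finite (I x) \<and> real (card (I x)) \<le> C * real n"
  interpret tc: typed_chain L q I
    by unfold_locales (use I q_end in auto)
  have nn: "real n \<ge> 3" "real n \<ge> C" using n by auto
  have N3: "C * real n \<ge> 3" using C nn mult_mono[of 1 C 3 "real n"] by simp
  interpret cu: chain_upper L q "\<lambda>j. I (Spine j)" "\<lambda>j k. I (Leaf j k)" "C * real n" qm
    by unfold_locales (use N3 I qm in \<open>auto simp: chain_verts_def\<close>)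
  have rNe: "cu.rN = sqrt C * sqrt (real n)" by (simp add: cu.rN_def real_sqrt_mult)
  have "ln (C * real n) = ln C + ln (real n)" using C nn by (simp add: ln_mult)
  \<comment> \<open>By \<open>real n \<ge> C\<close> the constant inside the logarithm costs only a
    factor 2.\<close>
  also have "ln C \<le> ln (real n)" using C nn by simp
  finally have "ln (C * real n) \<le> 2 * ln (real n)" by simp
  then have sNe: "cu.sN \<le> sqrt 2 * sqrt (ln (real n))"
    unfolding cu.sN_def by (simp flip: real_sqrt_mult)
  have "typed_expected_norm (chain_verts L q) (chain_edges L q) (Spine 0) (Spine (Suc L)) I
    \<le> upper_const q L * (cu.rN ^ ?k * cu.sN ^ qm)"
    unfolding tc.typed_expected_norm_eq by (rule cu.sE_opnorm_upper)
  also have "\<dots> \<le> upper_const q L * (cu.rN ^ ?k * (sqrt 2 * sqrt (ln (real n))) ^ qm)"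
    using cu.rN cu.sN sNe upper_const_pos[of q L] by (intro mult_left_mono power_mono) auto
  also have "\<dots> = ?b * chain_rate ?k qm n"
    using nn by (simp add: chain_rate_eq rNe power_mult_distrib mult_ac)
  finally show "typed_expected_norm (chain_verts L q) (chain_edges L q) (Spine 0) (Spine (Suc L)) I
    \<le> ?b * chain_rate ?k qm n" .
qed

lemma floor_half_le: "1 \<le> (x::real) \<Longrightarrow> x / 2 \<le> real (nat \<lfloor>x\<rfloor>)"
proof -
  assume "1 \<le> x"
  then have "1 \<le> \<lfloor>x\<rfloor>" by simp
  then have "real (nat \<lfloor>x\<rfloor>) = real_of_int \<lfloor>x\<rfloor>" "1 \<le> real_of_int \<lfloor>x\<rfloor>" by simp_all
  moreover have "x < real_of_int \<lfloor>x\<rfloor> + 1" by linarith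
  ultimately show ?thesis by linarith
qed

text \<open>With \<open>r\<close> at most \<open>ln n / (8 * (e + 1))\<close> the success
  probability of one label is at least \<open>n\<close> to the power -5/8, against at least
  \<open>c * n\<close> labels; the expected number of successes is thus at least 1 and failure has
  probability at most \<open>exp (- 1)\<close>.\<close>

lemma max_block_prob_ge_half:
  fixes c :: real and r e card :: nat
  assumes c: "0 < c" and n: "0 < (n::real)" "8 / (3 * c) \<le> ln n"
    and r: "1 \<le> r" "real r * (8 * (real e + 1)) \<le> ln n" and cd: "c * n \<le> real card"
  shows "1/2 \<le> 1 - (1 - (1/2 * (3/32) ^ r) ^ e :: real) ^ card"
proof -
  define p :: real where "p = (1/2 * (3/32) ^ r) ^ e"
  have "(3/32::real) ^ r \<le> 1" by (rule power_le_one) auto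
  then have "1/2 * (3/32::real) ^ r \<le> 1" by simp
  then have p01: "0 \<le> p" "p \<le> 1" unfolding p_def by (auto intro: power_le_one)
  \<comment> \<open>The factor \<open>1/2\<close> of each leaf sum is absorbed into a second power
    of \<open>(3/32) ^ r\<close>, so \<open>p\<close> is at least
    \<open>((3/32)\<^sup>2) ^ (r * e)\<close>, and each base is compared with
    \<open>exp (-5)\<close>.\<close>
  have e1: "exp (-5) \<le> (3/32::real)\<^sup>2"
  proof -
    have "(8/3::real) \<le> exp 1" using e_approx_32 by (simp add: abs_if split: if_splits)
    then have "(8/3::real) ^ 5 \<le> exp 1 ^ 5" by (intro power_mono) auto
    also have "exp 1 ^ 5 = exp (5::real)" by (simp flip: exp_of_nat_mult)
    finally have "(1024/9::real) \<le> exp 5" by (simp add: power_divide)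
    then show ?thesis by (simp add: exp_minus field_simps power2_eq_square)
  qed
  have "exp (- 5/8 * ln n) \<le> exp (- (5 * (real r * real e)))"
  proof -
    have "real r * real e * 8 \<le> real r * (8 * (real e + 1))" by (simp add: algebra_simps)
    then have "5 * (real r * real e) \<le> 5/8 * ln n" using r by linarith
    then show ?thesis by simp
  qed
  also have "\<dots> = exp (-5) ^ (r * e)" by (simp add: exp_of_nat_mult[symmetric] mult_ac)
  also have "\<dots> \<le> ((3/32)\<^sup>2) ^ (r * e)" by (intro power_mono e1) auto
  also have "\<dots> = ((3/32) ^ (r + r)) ^ e" unfolding mult_2[symmetric] power_mult[symmetric] by (simp add: mult_ac)
  also have "\<dots> \<le> p" unfolding p_def
  proof (rule power_mono)
    have "(3/32::real) ^ r \<le> 1/2" using power_decreasing[of 1 r "3/32::real"] r by simp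
    then show "(3/32::real) ^ (r + r) \<le> 1/2 * (3/32) ^ r" unfolding power_add by (intro mult_right_mono) auto
  qed auto
  finally have p_ge: "exp (- 5/8 * ln n) \<le> p" .
  have "1 \<le> c * exp (3/8 * ln n)"
  proof -
    have "1 / c \<le> 3/8 * ln n" using n c by (simp add: field_simps)
    also have "\<dots> \<le> exp (3/8 * ln n)" using exp_ge_add_one_self[of "3/8 * ln n"] by linarith
    finally show ?thesis using c by (simp add: field_simps)
  qed
  also have "c * exp (3/8 * ln n) = exp (- 5/8 * ln n) * (c * exp (ln n))"
    by (simp add: exp_add[symmetric] mult.left_commute[of _ c])
  also have "\<dots> \<le> p * real card" using p_ge p01 cd n c by (intro mult_mono) auto
  finally have pc: "1 \<le> p * real card" .
  have "(1 - p) ^ card \<le> exp (- p) ^ card"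
    using p01 exp_ge_add_one_self[of "- p"] by (intro power_mono) auto
  also have "\<dots> = exp (- (p * real card))" by (simp add: exp_of_nat_mult[symmetric] mult_ac)
  also have "\<dots> \<le> exp (- 1)" using pc by simp
  also have "\<dots> \<le> 1/2" using exp_ge_add_one_self[of "1::real"] by (simp add: exp_minus field_simps)
  finally show ?thesis by (simp add: p_def)
qed

lemma typed_lower:
  fixes q :: "nat \<Rightarrow> nat" and c :: real
  assumes q_end: "q (Suc L) = 0" and j: "1 \<le> j" "j \<le> L" and c: "c > 0"
  obtains a A where "a > 0"
    "\<And>n I. ln (real n) \<ge> A \<Longrightarrow> n \<ge> 2 \<Longrightarrow> (\<And>x. x \<in> chain_verts L q \<Longrightarrow> finite (I x) \<and> c * real n \<le> real (card (I x)))
      \<Longrightarrow> a * chain_rate (L + 1 + sum q {1..L}) (q j) n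
        \<le> typed_expected_norm (chain_verts L q) (chain_edges L q) (Spine 0) (Spine (Suc L)) (I :: role \<Rightarrow> 'l set)"
proof
  define e where "e = q j"
  \<comment> \<open>\<open>\<delta> \<le> c\<close> guarantees blocks of size at least 1, as
    \<open>ln n \<le> n\<close>; the other bound is the restriction on \<open>r\<close> in
    \<open>max_block_prob_ge_half\<close>.\<close>
  define \<delta> where "\<delta> = min c (1 / (8 * (real e + 1)))"
  have \<delta>: "\<delta> > 0" "\<delta> \<le> c" "\<delta> * (8 * (real e + 1)) \<le> 1"
    using c by (auto simp: \<delta>_def min_def field_simps)
  let ?k = "L + 1 + sum q {1..L}"
  define t where "t = j - 1"
  define t' where "t' = L - j"
  have tt: "j = Suc t" "L = Suc (t + t')" using j by (auto simp: t_def t'_def)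
  define s1 where "s1 = sum q {1..t}"
  define s2 where "s2 = sum q {Suc (Suc t)..L}"
  have qsum: "sum q {1..L} = s1 + e + s2"
  proof -
    have "{1..L} = {1..t} \<union> {Suc t} \<union> {Suc (Suc t)..L}" using tt by auto
    moreover have "sum q ({1..t} \<union> {Suc t} \<union> {Suc (Suc t)..L}) = s1 + e + s2"
      by (subst sum.union_disjoint; (subst sum.union_disjoint)?) (auto simp: s1_def s2_def e_def tt)
    ultimately show ?thesis by simp
  qed
  let ?a = "sqrt c ^ ?k * ((1/2) ^ (t + t' + s1 + s2) * sqrt (\<delta> / 16) ^ e / 2)"
  let ?A = "max 1 (max (1 / \<delta>) (8 / (3 * c)))"
  show "?a > 0" using c \<delta> by simp
  fix n :: nat and I :: "role \<Rightarrow> 'l set"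
  assume A: "ln (real n) \<ge> ?A" and n2: "n \<ge> 2"
    and I: "\<And>x. x \<in> chain_verts L q \<Longrightarrow> finite (I x) \<and> c * real n \<le> real (card (I x))"
  define N where "N = c * real n"
  have N: "N > 0" using c n2 by (simp add: N_def)
  have lnn: "ln (real n) \<ge> 1" "1 / \<delta> \<le> ln (real n)" "8 / (3 * c) \<le> ln (real n)" using A by auto
  interpret tc: typed_chain L q I
    by unfold_locales (use I q_end in auto)
  interpret cl: chain_lower L q "\<lambda>j. I (Spine j)" "\<lambda>j k. I (Leaf j k)" N
    by unfold_locales (use N I in \<open>auto simp: chain_verts_def N_def\<close>)
  \<comment> \<open>About \<open>\<delta> * ln n\<close> blocks of size \<open>m\<close> near
    \<open>N / r\<close>: the threshold \<open>r * sqrt m\<close> is then of order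
    \<open>sqrt (N * r)\<close>, which produces the factor \<open>sqrt (ln n)\<close>.\<close>
  define r where "r = nat \<lfloor>\<delta> * ln (real n)\<rfloor>"
  have x1: "1 \<le> \<delta> * ln (real n)" using lnn \<delta> by (simp add: field_simps)
  have r1: "1 \<le> r" using x1 unfolding r_def by (simp add: le_nat_iff)
  have r2: "real r \<le> \<delta> * ln (real n)" using x1 unfolding r_def by simp
  have r3: "\<delta> * ln (real n) / 2 \<le> real r" unfolding r_def by (rule floor_half_le[OF x1])
  define m where "m = nat \<lfloor>N / real r\<rfloor>"
  have "\<delta> * ln (real n) \<le> c * real n"
    using \<delta> c lnn ln_le_minus_one[of "real n"] n2 by (intro mult_mono) auto
  then have "real r \<le> N" using r2 by (simp add: N_def)
  then have y1: "1 \<le> N / real r" using r1 by simp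
  have m1: "real r * real m \<le> N"
  proof -
    have "real m \<le> N / real r" unfolding m_def using y1 by simp
    then show ?thesis using r1 by (simp add: field_simps)
  qed
  have m2: "N / real r / 2 \<le> real m" unfolding m_def by (rule floor_half_le[OF y1])
  have rm: "r * m \<le> card (I (Leaf (Suc t) k))" if "k < q (Suc t)" for k
  proof -
    have "Leaf (Suc t) k \<in> chain_verts L q" using that tt by (auto simp: chain_verts_def)
    then have "N \<le> real (card (I (Leaf (Suc t) k)))" using I by (simp add: N_def)
    then have "real (r * m) \<le> real (card (I (Leaf (Suc t) k)))" using m1 by simp
    then show ?thesis by linarith
  qed
  \<comment> \<open>The 16 collects a factor 2 from each of the two floors and 4 from the squared
    division by 2.\<close>
  have tau: "cl.rN * (sqrt (ln (real n)) * sqrt (\<delta> / 16)) \<le> real r * sqrt (real m) / 2"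
  proof -
    have "cl.rN * (sqrt (ln (real n)) * sqrt (\<delta> / 16)) = sqrt (N * (\<delta> * ln (real n) / 2) / 8)"
      by (simp add: cl.rN_def real_sqrt_mult[symmetric] mult_ac)
    also have "\<dots> \<le> sqrt (N * real r / 8)"
      using r3 N by (intro real_sqrt_le_mono divide_right_mono mult_left_mono) auto
    also have "\<dots> = sqrt ((real r)\<^sup>2 * (N / real r / 2) / 4)"
      using r1 by (simp add: power2_eq_square field_simps)
    also have "\<dots> \<le> sqrt ((real r)\<^sup>2 * real m / 4)"
      using m2 by (intro real_sqrt_le_mono divide_right_mono mult_left_mono) auto
    also have "\<dots> = real r * sqrt (real m) / 2" by (simp add: real_sqrt_mult real_sqrt_divide)
    finally show ?thesis .
  qed
  have half: "1/2 \<le> 1 - (1 - (1/2 * (3/32) ^ r) ^ q (Suc t) :: real) ^ card (I (Spine (Suc t)))"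
  proof (rule max_block_prob_ge_half[OF c _ lnn(3) r1])
    have "real r * (8 * (real e + 1)) \<le> (\<delta> * ln (real n)) * (8 * (real e + 1))" using r2 by (intro mult_right_mono) auto
    also have "\<dots> = \<delta> * (8 * (real e + 1)) * ln (real n)" by simp
    also have "\<dots> \<le> 1 * ln (real n)" using \<delta> lnn by (intro mult_right_mono) auto
    finally show "real r * (8 * (real (q (Suc t)) + 1)) \<le> ln (real n)" by (simp add: e_def tt)
    show "c * real n \<le> real (card (I (Spine (Suc t))))" using I[of "Spine (Suc t)"] tt by (auto simp: chain_verts_def)
  qed (use n2 in auto)
  let ?X = "(cl.rN * (cl.rN / 2) ^ (t + s1)) * (cl.rN * (cl.rN / 2) ^ (t' + s2))"
  have "?a * chain_rate ?k (q j) n = ?X * ((cl.rN * (sqrt (ln (real n)) * sqrt (\<delta> / 16))) ^ e * (1/2))"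
  proof -
    have "cl.rN = sqrt c * sqrt (real n)" unfolding cl.rN_def by (simp add: N_def real_sqrt_mult)
    then have "sqrt c ^ ?k * sqrt (real n) ^ ?k = cl.rN ^ ?k" by (simp add: power_mult_distrib)
    also have "\<dots> = cl.rN * cl.rN * cl.rN ^ (t + s1) * cl.rN ^ (t' + s2) * cl.rN ^ e"
    proof -
      have "?k = 1 + 1 + (t + s1) + (t' + s2) + e" unfolding qsum using tt(2) by linarith
      then show ?thesis by (simp only: power_add power_one_right)
    qed
    finally have "?a * chain_rate ?k (q j) n = (cl.rN * cl.rN * cl.rN ^ (t + s1) * cl.rN ^ (t' + s2) * cl.rN ^ e) * ((1/2) ^ (t + t' + s1 + s2) * sqrt (\<delta> / 16) ^ e / 2) * sqrt (ln (real n)) ^ e"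
      using n2 by (simp add: chain_rate_eq e_def mult_ac)
    also have "\<dots> = ?X * ((cl.rN * (sqrt (ln (real n)) * sqrt (\<delta> / 16))) ^ e * (1/2))"
      by (simp add: power_mult_distrib power_divide power_add mult_ac)
    finally show ?thesis .
  qed
  also have "\<dots> \<le> ?X * ((real r * sqrt (real m) / 2) ^ q (Suc t) * (1 - (1 - (1/2 * (3/32) ^ r) ^ q (Suc t)) ^ card (I (Spine (Suc t)))))"
  proof (intro mult_left_mono mult_mono half)
    show "(cl.rN * (sqrt (ln (real n)) * sqrt (\<delta> / 16))) ^ e \<le> (real r * sqrt (real m) / 2) ^ q (Suc t)"
      unfolding e_def tt using cl.rN lnn \<delta> tau by (intro power_mono) auto
  qed (use cl.rN in auto)
  also have "\<dots> \<le> sE tc.P (\<lambda>\<xi>. mat_opnorm (I (Spine 0)) (I (Spine (Suc L))) (tc.M \<xi> 0 L))"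
    unfolding s1_def s2_def by (rule cl.sE_opnorm_lower[OF tt(2) rm])
  finally show "?a * chain_rate ?k (q j) n
    \<le> typed_expected_norm (chain_verts L q) (chain_edges L q) (Spine 0) (Spine (Suc L)) I"
    unfolding tc.typed_expected_norm_eq .
qed

section \<open>The injective model\<close>

text \<open>If \<open>g\<close> permutes \<open>E\<close>, every sign occurs squared. Otherwise, by
  counting, \<open>g\<close> misses some \<open>e0\<close> in \<open>E\<close>; flipping that sign
  alone negates the product.\<close>

lemma sE_prod_matching:
  assumes fin: "finite T" and E: "E \<subseteq> T" "g ` E \<subseteq> T"
  shows "sE T (\<lambda>\<epsilon>. (\<Prod>e\<in>E. \<epsilon> e) * (\<Prod>e\<in>E. \<epsilon> (g e))) = of_bool (g ` E = E)"
proof (cases "g ` E = E")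
  case True
  have fE: "finite E" using fin E finite_subset by blast
  have inj: "inj_on g E" using True fE by (simp add: eq_card_imp_inj_on)
  have "sE T (\<lambda>\<epsilon>. (\<Prod>e\<in>E. \<epsilon> e) * (\<Prod>e\<in>E. \<epsilon> (g e))) = sE T (\<lambda>\<epsilon>. 1)"
  proof (rule sE_cong[OF fin])
    fix \<epsilon> assume \<epsilon>: "\<epsilon> \<in> signs T"
    have "(\<Prod>e\<in>E. \<epsilon> (g e)) = (\<Prod>e\<in>E. \<epsilon> e)"
      by (rule prod.reindex_bij_betw) (simp add: bij_betw_def inj True)
    then have "(\<Prod>e\<in>E. \<epsilon> e) * (\<Prod>e\<in>E. \<epsilon> (g e)) = (\<Prod>e\<in>E. \<epsilon> e * \<epsilon> e)" by (simp add: prod.distrib)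
    also have "\<dots> = 1" by (intro prod.neutral ballI signs_square[OF \<epsilon>]) (use E in auto)
    finally show "(\<Prod>e\<in>E. \<epsilon> e) * (\<Prod>e\<in>E. \<epsilon> (g e)) = 1" .
  qed
  then show ?thesis using True by simp
next
  case False
  have fE: "finite E" using fin E finite_subset by blast
  have "\<not> E \<subseteq> g ` E"
  proof
    assume "E \<subseteq> g ` E"
    then have "E = g ` E" using card_seteq[of "g ` E" E] fE card_image_le[OF fE, of g] by auto
    then show False using False by simp
  qed
  then obtain e0 where e0: "e0 \<in> E" "e0 \<notin> g ` E" by blast
  let ?F = "\<lambda>\<epsilon>. (\<Prod>e\<in>E. \<epsilon> e) * (\<Prod>e\<in>E. \<epsilon> (g e)) :: real"
  define \<delta> :: "'a \<Rightarrow> real" where "\<delta> e = (if e = e0 then -1 else 1)" for e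
  have "(\<Prod>e\<in>E. \<delta> e) = -1" using e0 fE by (simp add: \<delta>_def prod.remove[of E e0] prod.neutral)
  moreover have "(\<Prod>e\<in>E. \<delta> (g e)) = 1" using e0 by (intro prod.neutral) (auto simp: \<delta>_def)
  ultimately have "?F (\<lambda>p. \<delta> p * \<epsilon> p) = - ?F \<epsilon>" for \<epsilon> by (simp add: prod.distrib)
  then have "sE T ?F = - sE T ?F"
    using sE_flip[OF fin, of \<delta> ?F] sE_uminus[OF fin, of ?F] by (simp add: \<delta>_def)
  then show ?thesis using False by simp
qed

lemma finite_unordered_pairs: "finite (unordered_pairs n)"
  unfolding unordered_pairs_def by (rule finite_subset[of _ "Pow {1..n}"]) auto

text \<open>\<open>cover\<close> excludes isolated vertices, so that a permutation of the edges
  induced by a vertex map forces the latter to be onto \<open>W\<close>.\<close>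

locale graph_model =
  fixes W :: "'v set" and E :: "'v set set" and u v :: 'v
  assumes finW: "finite W" and E2: "e \<in> E \<Longrightarrow> card e = 2" and cover: "\<Union>E = W"
    and uv: "u \<in> W" "v \<in> W"
begin

lemma EW: "e \<in> E \<Longrightarrow> e \<subseteq> W" using cover by blast

lemma finE: "finite E" using finW cover finite_UnionD by blast

definition colour_class :: "nat \<Rightarrow> (nat \<Rightarrow> 'v) \<Rightarrow> 'v \<Rightarrow> nat set" where
  "colour_class n \<kappa> x = {i \<in> {1..n}. \<kappa> i = x}"

definition coloured_matrix :: "nat \<Rightarrow> (nat \<Rightarrow> 'v) \<Rightarrow> (nat set \<Rightarrow> real) \<Rightarrow> nat \<Rightarrow> nat \<Rightarrow> real" where
  "coloured_matrix n \<kappa> \<xi> i j = (\<Sum>\<phi>\<in>{\<phi> \<in> PiE W (colour_class n \<kappa>). \<phi> u = i \<and> \<phi> v = j}. \<Prod>e\<in>E. \<xi> (\<phi> ` e))"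

lemma PiE_colour_class_inj: "\<phi> \<in> PiE W (colour_class n \<kappa>) \<Longrightarrow> inj_on \<phi> W"
  by (rule inj_on_inverseI[of _ \<kappa>]) (auto simp: colour_class_def PiE_def Pi_def)

text \<open>\<kappa> recovers from the pair of labels of an edge both the edge and which label
  belongs to which end. Distinct typed positions therefore read distinct unordered pairs.\<close>

lemma expected_coloured_matrix:
  "sE (unordered_pairs n) (\<lambda>\<xi>. mat_opnorm (colour_class n \<kappa> u) (colour_class n \<kappa> v) (coloured_matrix n \<kappa> \<xi>))
    = typed_expected_norm W E u v (colour_class n \<kappa>)"
proof -
  let ?I = "colour_class n \<kappa>"
  let ?P = "typed_positions E ?I"
  let ?F = "\<lambda>\<xi>. mat_opnorm (?I u) (?I v) (typed_matrix W E u v ?I \<xi>)"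
  define h :: "'v set \<times> ('v \<Rightarrow> nat) \<Rightarrow> nat set" where "h p = snd p ` fst p" for p
  have chi: "\<kappa> (m x) = x" if "m \<in> PiE e ?I" "x \<in> e" for m e x using that by (auto simp: colour_class_def PiE_def Pi_def)
  have chie: "\<kappa> ` (m ` e) = e" if "m \<in> PiE e ?I" for m e using chi[OF that] by force
  have "mat_opnorm (?I u) (?I v) (coloured_matrix n \<kappa> \<xi>) = ?F (\<lambda>p. \<xi> (h p))" for \<xi>
  proof (rule mat_opnorm_cong)
    fix i j
    have "(\<Prod>e\<in>E. \<xi> (\<phi> ` e)) = (\<Prod>e\<in>E. \<xi> (h (e, restrict \<phi> e)))" for \<phi> :: "'v \<Rightarrow> nat"
      by (simp add: h_def)
    then show "coloured_matrix n \<kappa> \<xi> i j = typed_matrix W E u v ?I (\<lambda>p. \<xi> (h p)) i j"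
      by (simp add: coloured_matrix_def typed_matrix_def)
  qed
  then have "sE (unordered_pairs n) (\<lambda>\<xi>. mat_opnorm (?I u) (?I v) (coloured_matrix n \<kappa> \<xi>)) = sE (unordered_pairs n) (\<lambda>\<xi>. ?F (\<lambda>p. \<xi> (h p)))"
    by simp
  also have "\<dots> = sE ?P ?F"
  proof (rule sE_reindex'[OF finite_unordered_pairs])
    show "inj_on h ?P"
    proof (rule inj_onI)
      fix p p' assume p: "p \<in> ?P" "p' \<in> ?P" and eq: "h p = h p'"
      obtain e m e' m' where pp: "p = (e, m)" "p' = (e', m')" by (cases p; cases p')
      have m: "m \<in> PiE e ?I" "m' \<in> PiE e' ?I" using p pp by (auto simp: typed_positions_def)
      have eqm: "m ` e = m' ` e'" using eq pp by (simp add: h_def)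
      have ee: "e = e'" using chie[OF m(1)] chie[OF m(2)] eqm by simp
      have "m x = m' x" if "x \<in> e" for x
      proof -
        have "m x \<in> m' ` e'" using that eqm by auto
        then obtain y where y: "y \<in> e'" "m x = m' y" by auto
        then show ?thesis using chi[OF m(1) that] chi[OF m(2) y(1)] by simp
      qed
      then have "m = m'" using m ee by (auto intro: PiE_ext)
      then show "p = p'" using pp ee by simp
    qed
    show "h ` ?P \<subseteq> unordered_pairs n"
    proof
      fix s assume "s \<in> h ` ?P"
      then obtain e m where s: "e \<in> E" "m \<in> PiE e ?I" "s = m ` e" by (auto simp: typed_positions_def h_def)
      have "inj_on m e" by (rule inj_on_inverseI[of _ \<kappa>]) (use chi s in auto)
      then have "card s = 2" using s E2 by (simp add: card_image)
      moreover have "s \<subseteq> {1..n}" using s by (auto simp: colour_class_def PiE_def Pi_def)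
      ultimately show "s \<in> unordered_pairs n" by (simp add: unordered_pairs_def)
    qed
    show "depends ?P ?F" unfolding depends_def
    proof (intro allI impI mat_opnorm_cong)
      fix \<xi> \<xi>' :: "'v set \<times> ('v \<Rightarrow> nat) \<Rightarrow> real" and i j assume eq: "\<forall>p\<in>?P. \<xi> p = \<xi>' p"
      show "typed_matrix W E u v ?I \<xi> i j = typed_matrix W E u v ?I \<xi>' i j"
        unfolding typed_matrix_def
      proof (intro sum.cong prod.cong refl)
        fix l e assume "l \<in> {l \<in> PiE W ?I. l u = i \<and> l v = j}" "e \<in> E"
        then have "(e, restrict l e) \<in> ?P" using EW by (auto simp: typed_positions_def PiE_def Pi_def)
        then show "\<xi> (e, restrict l e) = \<xi>' (e, restrict l e)" using eq by simp
      qed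
    qed
  qed
  finally show ?thesis by (simp add: typed_expected_norm_def sE_def)
qed

text \<open>An injective map is compatible with exactly \<open>card W ^ (n - card W)\<close> of the colourings of \<open>{1..n}\<close> by \<open>W\<close>.\<close>

lemma inj_matrix_average:
  assumes n: "card W \<le> n"
  shows "inj_matrix W E u v n \<xi> i j * real (card W) ^ (n - card W) = (\<Sum>\<kappa>\<in>{1..n} \<rightarrow>\<^sub>E W. coloured_matrix n \<kappa> \<xi> i j)"
proof -
  let ?J = "{\<phi> \<in> W \<rightarrow>\<^sub>E {1..n}. inj_on \<phi> W \<and> \<phi> u = i \<and> \<phi> v = j}"
  let ?X = "{1..n} \<rightarrow>\<^sub>E W"
  have finJ: "finite ?J" using finite_PiE[OF finW, of "\<lambda>_. {1..n}"] by auto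
  have finX: "finite ?X" using finW by (intro finite_PiE) auto
  have sub: "{\<phi> \<in> PiE W (colour_class n \<kappa>). \<phi> u = i \<and> \<phi> v = j} = {\<phi> \<in> ?J. \<forall>x\<in>W. \<kappa> (\<phi> x) = x}" for \<kappa>
  proof (intro set_eqI iffI)
    fix \<phi> assume a: "\<phi> \<in> {\<phi> \<in> PiE W (colour_class n \<kappa>). \<phi> u = i \<and> \<phi> v = j}"
    then have "inj_on \<phi> W" using PiE_colour_class_inj by blast
    with a show "\<phi> \<in> {\<phi> \<in> ?J. \<forall>x\<in>W. \<kappa> (\<phi> x) = x}" by (auto simp: colour_class_def PiE_def Pi_def)
  qed (auto simp: colour_class_def PiE_def Pi_def)
  have cnt: "card {\<kappa> \<in> ?X. \<forall>x\<in>W. \<kappa> (\<phi> x) = x} = card W ^ (n - card W)" if \<phi>: "\<phi> \<in> ?J" for \<phi>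
  proof -
    have inj: "inj_on \<phi> W" and im: "\<phi> ` W \<subseteq> {1..n}" using \<phi> by auto
    have "{\<kappa> \<in> ?X. \<forall>x\<in>W. \<kappa> (\<phi> x) = x} = PiE {1..n} (\<lambda>i. if i \<in> \<phi> ` W then {inv_into W \<phi> i} else W)"
    proof (intro set_eqI iffI)
      fix \<kappa> assume "\<kappa> \<in> {\<kappa> \<in> ?X. \<forall>x\<in>W. \<kappa> (\<phi> x) = x}"
      then show "\<kappa> \<in> PiE {1..n} (\<lambda>i. if i \<in> \<phi> ` W then {inv_into W \<phi> i} else W)"
        using inj by (auto simp: PiE_def Pi_def)
    next
      fix \<kappa> assume a: "\<kappa> \<in> PiE {1..n} (\<lambda>i. if i \<in> \<phi> ` W then {inv_into W \<phi> i} else W)"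
      have "\<kappa> k \<in> W" if "k \<in> {1..n}" for k
        using PiE_mem[OF a that] by (cases "k \<in> \<phi> ` W") (auto intro: inv_into_into)
      moreover have "\<kappa> (\<phi> x) = x" if "x \<in> W" for x
        using PiE_mem[OF a, of "\<phi> x"] im that inj by auto
      ultimately show "\<kappa> \<in> {\<kappa> \<in> ?X. \<forall>x\<in>W. \<kappa> (\<phi> x) = x}" using a by (auto simp: PiE_def Pi_def)
    qed
    then have "card {\<kappa> \<in> ?X. \<forall>x\<in>W. \<kappa> (\<phi> x) = x} = (\<Prod>i\<in>{1..n}. if i \<in> \<phi> ` W then 1 else card W)"
      by (simp add: card_PiE) (rule prod.cong, auto)
    also have "\<dots> = card W ^ card ({1..n} - \<phi> ` W)"
      using im by (subst prod.If_cases) (simp_all add: Diff_eq Int_commute)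
    also have "card ({1..n} - \<phi> ` W) = n - card W"
      using im inj finW by (simp add: card_Diff_subset card_image)
    finally show ?thesis .
  qed
  have "(\<Sum>\<kappa>\<in>?X. coloured_matrix n \<kappa> \<xi> i j) = (\<Sum>\<kappa>\<in>?X. \<Sum>\<phi>\<in>?J. if \<forall>x\<in>W. \<kappa> (\<phi> x) = x then \<Prod>e\<in>E. \<xi> (\<phi> ` e) else 0)"
    by (simp only: coloured_matrix_def sub sum.inter_filter[OF finJ])
  also have "\<dots> = (\<Sum>\<phi>\<in>?J. \<Sum>\<kappa>\<in>?X. if \<forall>x\<in>W. \<kappa> (\<phi> x) = x then \<Prod>e\<in>E. \<xi> (\<phi> ` e) else 0)"
    by (rule sum.swap)
  also have "\<dots> = (\<Sum>\<phi>\<in>?J. (\<Prod>e\<in>E. \<xi> (\<phi> ` e)) * real (card {\<kappa> \<in> ?X. \<forall>x\<in>W. \<kappa> (\<phi> x) = x}))"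
    unfolding sum.inter_filter[OF finX, symmetric] by (simp add: mult.commute)
  also have "\<dots> = (\<Sum>\<phi>\<in>?J. (\<Prod>e\<in>E. \<xi> (\<phi> ` e)) * real (card W) ^ (n - card W))"
    by (intro sum.cong refl) (simp only: cnt of_nat_power)
  also have "\<dots> = inj_matrix W E u v n \<xi> i j * real (card W) ^ (n - card W)"
    by (simp add: inj_matrix_def sum_distrib_right)
  finally show ?thesis by simp
qed

text \<open>All \<open>card W ^ n\<close> colourings are summed and divided by
  \<open>card W ^ (n - card W)\<close>. Very unbalanced ones occur, so \<open>B\<close> has to bound
  the typed norm uniformly; \<open>typed_upper\<close> provides this, as it asks only for upper
  bounds on the label sets.\<close>

lemma inj_expected_norm_upper:
  assumes n: "card W \<le> n" and B: "\<And>\<kappa>. typed_expected_norm W E u v (colour_class n \<kappa>) \<le> B"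
  shows "inj_expected_norm W E u v n \<le> real (card W) ^ card W * B"
proof -
  let ?X = "{1..n} \<rightarrow>\<^sub>E W" and ?w = "real (card W)"
  have w: "?w > 0" using uv finW by (auto simp: card_gt_0_iff)
  have op: "mat_opnorm {1..n} {1..n} (inj_matrix W E u v n \<xi>)
     \<le> (1 / ?w ^ (n - card W)) * (\<Sum>\<kappa>\<in>?X. mat_opnorm (colour_class n \<kappa> u) (colour_class n \<kappa> v) (coloured_matrix n \<kappa> \<xi>))" for \<xi>
  proof -
    have "mat_opnorm {1..n} {1..n} (inj_matrix W E u v n \<xi>)
      = mat_opnorm {1..n} {1..n} (\<lambda>i j. (1 / ?w ^ (n - card W)) * (\<Sum>\<kappa>\<in>?X. coloured_matrix n \<kappa> \<xi> i j))"
      unfolding inj_matrix_average[OF n, symmetric] using w by (intro mat_opnorm_cong) simp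
    also have "\<dots> \<le> (1 / ?w ^ (n - card W)) * mat_opnorm {1..n} {1..n} (\<lambda>i j. \<Sum>\<kappa>\<in>?X. coloured_matrix n \<kappa> \<xi> i j)"
      using mat_opnorm_cmult_le[of "{1..n}" "{1..n}" "1 / ?w ^ (n - card W)" "\<lambda>i j. \<Sum>\<kappa>\<in>?X. coloured_matrix n \<kappa> \<xi> i j"] w by simp
    also have "\<dots> \<le> (1 / ?w ^ (n - card W)) * (\<Sum>\<kappa>\<in>?X. mat_opnorm {1..n} {1..n} (coloured_matrix n \<kappa> \<xi>))"
      using w by (intro mult_left_mono mat_opnorm_sum) auto
    also have "\<dots> \<le> (1 / ?w ^ (n - card W)) * (\<Sum>\<kappa>\<in>?X. mat_opnorm (colour_class n \<kappa> u) (colour_class n \<kappa> v) (coloured_matrix n \<kappa> \<xi>))"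
    proof (intro mult_left_mono sum_mono mat_opnorm_zero_pad)
      fix \<kappa> i j assume "i \<notin> colour_class n \<kappa> u \<or> j \<notin> colour_class n \<kappa> v"
      then have "{\<phi> \<in> PiE W (colour_class n \<kappa>). \<phi> u = i \<and> \<phi> v = j} = {}" using uv by auto
      then show "coloured_matrix n \<kappa> \<xi> i j = 0" by (simp only: coloured_matrix_def sum.empty)
    qed (use w in \<open>auto simp: colour_class_def\<close>)
    finally show ?thesis .
  qed
  have "inj_expected_norm W E u v n = sE (unordered_pairs n) (\<lambda>\<xi>. mat_opnorm {1..n} {1..n} (inj_matrix W E u v n \<xi>))"
    by (simp add: inj_expected_norm_def sE_def)
  also have "\<dots> \<le> sE (unordered_pairs n) (\<lambda>\<xi>. (1 / ?w ^ (n - card W)) * (\<Sum>\<kappa>\<in>?X. mat_opnorm (colour_class n \<kappa> u) (colour_class n \<kappa> v) (coloured_matrix n \<kappa> \<xi>)))"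
    by (intro sE_mono finite_unordered_pairs op)
  also have "\<dots> = (1 / ?w ^ (n - card W)) * (\<Sum>\<kappa>\<in>?X. typed_expected_norm W E u v (colour_class n \<kappa>))"
    by (simp add: sE_cmult sE_divide sE_sum finite_unordered_pairs expected_coloured_matrix)
  also have "\<dots> \<le> (1 / ?w ^ (n - card W)) * (\<Sum>\<kappa>\<in>?X. B)"
    using w by (intro mult_left_mono sum_mono B) auto
  also have "\<dots> = (1 / ?w ^ (n - card W)) * (?w ^ n * B)" by (simp add: card_PiE)
  also have "?w ^ n = ?w ^ (n - card W) * ?w ^ card W" using n by (simp flip: power_add)
  finally show ?thesis using w by simp
qed

text \<open>Automorphisms of the graph fixing both ends. Injectivity is automatic: the edges cover
  the finite set \<open>W\<close>, so such a map is onto (\<open>edge_auts_bij\<close>).\<close>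

definition edge_auts :: "('v \<Rightarrow> 'v) set" where
  "edge_auts = {\<tau> \<in> W \<rightarrow>\<^sub>E W. (\<lambda>e. \<tau> ` e) ` E = E \<and> \<tau> u = u \<and> \<tau> v = v}"

lemma edge_auts_bij: "\<tau> \<in> edge_auts \<Longrightarrow> bij_betw \<tau> W W"
proof -
  assume "\<tau> \<in> edge_auts"
  then have "(\<lambda>e. \<tau> ` e) ` E = E" by (simp add: edge_auts_def)
  then have "\<tau> ` (\<Union>E) = \<Union>E" by (metis image_Union)
  then have "\<tau> ` W = W" using cover by simp
  then show ?thesis using finW by (simp add: bij_betw_def eq_card_imp_inj_on)
qed

lemma finite_edge_auts: "finite edge_auts"
  unfolding edge_auts_def using finite_PiE[OF finW, of "\<lambda>_. W"] finW by auto

lemma id_in_edge_auts: "restrict id W \<in> edge_auts"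
proof -
  have "restrict id W ` e = e" if "e \<in> E" for e using EW[OF that] by (auto simp: image_iff)
  then show ?thesis using uv by (auto simp: edge_auts_def)
qed

text \<open>Precomposing with the inverse of \<tau> turns a map of colour pattern \<tau> into a
  properly coloured one. The product over \<open>E\<close> is unchanged since \<tau> permutes the
  edges, and the matrix entry since \<tau> fixes both ends.\<close>

lemma coloured_matrix_relabel:
  assumes \<tau>: "\<tau> \<in> edge_auts" and \<kappa>: "\<kappa> \<in> {1..n} \<rightarrow> W"
  shows "(\<Sum>\<phi>\<in>{\<phi> \<in> W \<rightarrow>\<^sub>E {1..n}. inj_on \<phi> W \<and> \<phi> u = i \<and> \<phi> v = j \<and> restrict (\<kappa> \<circ> \<phi>) W = \<tau>}. \<Prod>e\<in>E. \<xi> (\<phi> ` e))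
    = coloured_matrix n \<kappa> \<xi> i j"
proof -
  have bij: "bij_betw \<tau> W W" by (rule edge_auts_bij[OF \<tau>])
  define \<sigma> where "\<sigma> = inv_into W \<tau>"
  have bs: "bij_betw \<sigma> W W" unfolding \<sigma>_def by (rule bij_betw_inv_into[OF bij])
  have ts: "\<tau> (\<sigma> x) = x" if "x \<in> W" for x using bij_betw_inv_into_right[OF bij that] by (simp add: \<sigma>_def)
  have st: "\<sigma> (\<tau> x) = x" if "x \<in> W" for x using bij_betw_inv_into_left[OF bij that] by (simp add: \<sigma>_def)
  have tW: "\<tau> x \<in> W" and sW: "\<sigma> x \<in> W" if "x \<in> W" for x using that bij bs by (auto simp: bij_betw_def)
  have tuv: "\<tau> u = u" "\<tau> v = v" and tE: "(\<lambda>e. \<tau> ` e) ` E = E" using \<tau> by (auto simp: edge_auts_def)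
  have suv: "\<sigma> u = u" "\<sigma> v = v" using st[OF uv(1)] st[OF uv(2)] tuv by simp_all
  show ?thesis unfolding coloured_matrix_def
  proof (rule sum.reindex_bij_witness[where i = "\<lambda>\<phi>. restrict (\<phi> \<circ> \<tau>) W" and j = "\<lambda>\<phi>. restrict (\<phi> \<circ> \<sigma>) W"])
    fix \<phi> assume a: "\<phi> \<in> {\<phi> \<in> W \<rightarrow>\<^sub>E {1..n}. inj_on \<phi> W \<and> \<phi> u = i \<and> \<phi> v = j \<and> restrict (\<kappa> \<circ> \<phi>) W = \<tau>}"
    then have \<phi>: "\<phi> \<in> W \<rightarrow>\<^sub>E {1..n}" "\<phi> u = i" "\<phi> v = j" and cp: "restrict (\<kappa> \<circ> \<phi>) W = \<tau>" by auto
    have chi: "\<kappa> (\<phi> x) = \<tau> x" if "x \<in> W" for x using fun_cong[OF cp, of x] that by simp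
    show "restrict (restrict (\<phi> \<circ> \<sigma>) W \<circ> \<tau>) W = \<phi>"
      using \<phi>(1) st tW by (auto simp: fun_eq_iff restrict_def PiE_def extensional_def)
    show "restrict (\<phi> \<circ> \<sigma>) W \<in> {\<phi> \<in> PiE W (colour_class n \<kappa>). \<phi> u = i \<and> \<phi> v = j}"
      using \<phi> chi ts sW suv uv by (auto simp: colour_class_def PiE_def Pi_def)
    have inj: "inj_on (\<lambda>e. \<tau> ` e) E" using tE finE by (simp add: eq_card_imp_inj_on)
    have "(\<Prod>e\<in>E. \<xi> (restrict (\<phi> \<circ> \<sigma>) W ` e)) = (\<Prod>e\<in>(\<lambda>e. \<tau> ` e) ` E. \<xi> (restrict (\<phi> \<circ> \<sigma>) W ` e))" using tE by simp
    also have "\<dots> = (\<Prod>e\<in>E. \<xi> (restrict (\<phi> \<circ> \<sigma>) W ` \<tau> ` e))" by (simp add: prod.reindex[OF inj])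
    also have "\<dots> = (\<Prod>e\<in>E. \<xi> (\<phi> ` e))"
    proof (intro prod.cong refl arg_cong[where f=\<xi>])
      fix e assume "e \<in> E"
      then have eW: "e \<subseteq> W" by (rule EW)
      then show "restrict (\<phi> \<circ> \<sigma>) W ` \<tau> ` e = \<phi> ` e"
        unfolding image_image by (intro image_cong refl) (use st tW in auto)
    qed
    finally show "(\<Prod>e\<in>E. \<xi> (restrict (\<phi> \<circ> \<sigma>) W ` e)) = (\<Prod>e\<in>E. \<xi> (\<phi> ` e))" .
  next
    fix \<phi> assume "\<phi> \<in> {\<phi> \<in> PiE W (colour_class n \<kappa>). \<phi> u = i \<and> \<phi> v = j}"
    then have \<phi>: "\<phi> \<in> PiE W (colour_class n \<kappa>)" "\<phi> u = i" "\<phi> v = j" by auto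
    have chi: "\<phi> x \<in> {1..n}" "\<kappa> (\<phi> x) = x" if "x \<in> W" for x using PiE_mem[OF \<phi>(1) that] by (auto simp: colour_class_def)
    show "restrict (restrict (\<phi> \<circ> \<tau>) W \<circ> \<sigma>) W = \<phi>"
      using \<phi>(1) ts sW by (auto simp: fun_eq_iff restrict_def PiE_def extensional_def)
    have "inj_on (\<phi> \<circ> \<tau>) W"
      using PiE_colour_class_inj[OF \<phi>(1)] bij by (auto simp: bij_betw_def intro: comp_inj_on)
    moreover have "restrict (\<kappa> \<circ> restrict (\<phi> \<circ> \<tau>) W) W = \<tau>"
      using \<tau> chi tW by (auto simp: fun_eq_iff restrict_def edge_auts_def PiE_def extensional_def)
    ultimately show "restrict (\<phi> \<circ> \<tau>) W \<in> {\<phi> \<in> W \<rightarrow>\<^sub>E {1..n}. inj_on \<phi> W \<and> \<phi> u = i \<and> \<phi> v = j \<and> restrict (\<kappa> \<circ> \<phi>) W = \<tau>}"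
      using \<phi> chi(1) tW tuv uv by (auto simp: inj_on_def restrict_def)
  qed
qed

text \<open>Random signs attached to the colour sets of the edges of the label graph, averaged against
  \<open>\<Prod>e\<in>E. \<epsilon> e\<close>, keep only those maps \<open>\<phi>\<close> for which \<open>\<kappa> \<circ> \<phi>\<close> permutes \<open>E\<close>; each such permutation
  contributes one copy of the coloured matrix.\<close>

lemma inj_expected_norm_lower:
  assumes \<kappa>: "\<kappa> \<in> {1..n} \<rightarrow> W"
  shows "typed_expected_norm W E u v (colour_class n \<kappa>) \<le> inj_expected_norm W E u v n"
proof -
  let ?Pn = "unordered_pairs n" and ?T = "Pow W"
  let ?R = "{1..n}"
  let ?K = "inj_matrix W E u v n"
  have finT: "finite ?T" using finW by simp
  note finP = finite_unordered_pairs[of n]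
  \<comment> \<open>The sign given to a pair depends only on its set of colours, which may be a
    non-edge or a single colour; hence the index set \<open>Pow W\<close>.\<close>
  let ?fl = "\<lambda>\<epsilon> \<xi> p. \<epsilon> (\<kappa> ` p) * \<xi> p"
  define N where "N = real (card edge_auts)"
  have N: "N \<ge> 1" using id_in_edge_auts finite_edge_auts by (auto simp: N_def Suc_le_eq card_gt_0_iff)
  have proj: "sE ?T (\<lambda>\<epsilon>. (\<Prod>e\<in>E. \<epsilon> e) * ?K (?fl \<epsilon> \<xi>) i j) = N * coloured_matrix n \<kappa> \<xi> i j"
    if i: "i \<in> colour_class n \<kappa> u" and j: "j \<in> colour_class n \<kappa> v" for \<xi> i j
  proof -
    let ?J = "{\<phi> \<in> W \<rightarrow>\<^sub>E {1..n}. inj_on \<phi> W \<and> \<phi> u = i \<and> \<phi> v = j}"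
    let ?c = "\<lambda>\<phi>. restrict (\<kappa> \<circ> \<phi>) W"
    have finJ: "finite ?J" using finite_PiE[OF finW, of "\<lambda>_. {1..n}"] by auto
    have im: "\<kappa> ` \<phi> ` e = ?c \<phi> ` e" if "e \<in> E" for \<phi> :: "'v \<Rightarrow> nat" and e
      using EW[OF that] by (auto simp: image_image intro!: image_cong)
    have "sE ?T (\<lambda>\<epsilon>. (\<Prod>e\<in>E. \<epsilon> e) * ?K (?fl \<epsilon> \<xi>) i j)
      = sE ?T (\<lambda>\<epsilon>. \<Sum>\<phi>\<in>?J. (\<Prod>e\<in>E. \<xi> (\<phi> ` e)) * ((\<Prod>e\<in>E. \<epsilon> e) * (\<Prod>e\<in>E. \<epsilon> (?c \<phi> ` e))))"
      by (intro sE_cong finT) (simp add: inj_matrix_def prod.distrib sum_distrib_left im mult_ac cong: prod.cong)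
    also have "\<dots> = (\<Sum>\<phi>\<in>?J. (\<Prod>e\<in>E. \<xi> (\<phi> ` e)) * of_bool ((\<lambda>e. ?c \<phi> ` e) ` E = E))"
    proof -
      have *: "sE ?T (\<lambda>\<epsilon>. (\<Prod>e\<in>E. \<epsilon> e) * (\<Prod>e\<in>E. \<epsilon> (?c \<phi> ` e))) = of_bool ((\<lambda>e. ?c \<phi> ` e) ` E = E)" if "\<phi> \<in> ?J" for \<phi>
      proof (rule sE_prod_matching[OF finT])
        show "E \<subseteq> ?T" using EW by auto
        have "?c \<phi> x \<in> W" if "x \<in> W" for x using \<open>\<phi> \<in> ?J\<close> that \<kappa> by (auto simp: PiE_def Pi_def)
        then show "(\<lambda>e. ?c \<phi> ` e) ` E \<subseteq> ?T" using EW by blast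
      qed
      show ?thesis unfolding sE_sum[OF finT] sE_cmult
        by (intro sum.cong refl arg_cong2[where f="(*)"] *)
    qed
    also have "\<dots> = (\<Sum>\<phi>\<in>{\<phi> \<in> ?J. ?c \<phi> \<in> edge_auts}. \<Prod>e\<in>E. \<xi> (\<phi> ` e))"
    proof -
      have "((\<lambda>e. ?c \<phi> ` e) ` E = E) = (?c \<phi> \<in> edge_auts)" if "\<phi> \<in> ?J" for \<phi>
      proof -
        have "?c \<phi> \<in> W \<rightarrow>\<^sub>E W" using that \<kappa> by (auto simp: PiE_def Pi_def)
        moreover have "?c \<phi> u = u" "?c \<phi> v = v" using that i j uv by (auto simp: colour_class_def)
        ultimately show ?thesis by (simp add: edge_auts_def)
      qed
      then have "(\<Sum>\<phi>\<in>?J. (\<Prod>e\<in>E. \<xi> (\<phi> ` e)) * of_bool ((\<lambda>e. ?c \<phi> ` e) ` E = E))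
        = (\<Sum>\<phi>\<in>?J. if ?c \<phi> \<in> edge_auts then \<Prod>e\<in>E. \<xi> (\<phi> ` e) else 0)"
        by (intro sum.cong refl) auto
      then show ?thesis by (simp only: sum.inter_filter[OF finJ])
    qed
    also have "\<dots> = (\<Sum>\<tau>\<in>edge_auts. \<Sum>\<phi>\<in>{\<phi> \<in> {\<phi> \<in> ?J. ?c \<phi> \<in> edge_auts}. ?c \<phi> = \<tau>}. \<Prod>e\<in>E. \<xi> (\<phi> ` e))"
    proof (rule sum.group[symmetric])
      show "finite {\<phi> \<in> ?J. ?c \<phi> \<in> edge_auts}" by (rule finite_subset[OF _ finJ]) blast
    qed (use finite_edge_auts in auto)
    also have "\<dots> = (\<Sum>\<tau>\<in>edge_auts. coloured_matrix n \<kappa> \<xi> i j)"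
    proof (rule sum.cong[OF refl])
      fix \<tau> assume \<tau>: "\<tau> \<in> edge_auts"
      then have "{\<phi> \<in> {\<phi> \<in> ?J. ?c \<phi> \<in> edge_auts}. ?c \<phi> = \<tau>}
        = {\<phi> \<in> W \<rightarrow>\<^sub>E {1..n}. inj_on \<phi> W \<and> \<phi> u = i \<and> \<phi> v = j \<and> ?c \<phi> = \<tau>}" by blast
      then show "(\<Sum>\<phi>\<in>{\<phi> \<in> {\<phi> \<in> ?J. ?c \<phi> \<in> edge_auts}. ?c \<phi> = \<tau>}. \<Prod>e\<in>E. \<xi> (\<phi> ` e)) = coloured_matrix n \<kappa> \<xi> i j"
        using coloured_matrix_relabel[OF \<tau> \<kappa>] by simp
    qed
    finally show ?thesis by (simp add: N_def)
  qed
  have "typed_expected_norm W E u v (colour_class n \<kappa>) = sE ?Pn (\<lambda>\<xi>. mat_opnorm (colour_class n \<kappa> u) (colour_class n \<kappa> v) (coloured_matrix n \<kappa> \<xi>))"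
    by (rule expected_coloured_matrix[symmetric])
  also have "\<dots> \<le> sE ?Pn (\<lambda>\<xi>. sE ?T (\<lambda>\<epsilon>. mat_opnorm ?R ?R (?K (?fl \<epsilon> \<xi>))))"
  proof (rule sE_mono[OF finP])
    fix \<xi>
    have fc: "finite (colour_class n \<kappa> x)" "colour_class n \<kappa> x \<subseteq> ?R" for x by (auto simp: colour_class_def)
    have "mat_opnorm (colour_class n \<kappa> u) (colour_class n \<kappa> v) (coloured_matrix n \<kappa> \<xi>)
      = mat_opnorm (colour_class n \<kappa> u) (colour_class n \<kappa> v) (\<lambda>i j. (1 / N) * (N * coloured_matrix n \<kappa> \<xi> i j))"
      using N by simp
    also have "\<dots> \<le> \<bar>1 / N\<bar> * mat_opnorm (colour_class n \<kappa> u) (colour_class n \<kappa> v) (\<lambda>i j. N * coloured_matrix n \<kappa> \<xi> i j)"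
      by (rule mat_opnorm_cmult_le[OF fc(1)])
    \<comment> \<open>The identity lies in \<open>edge_auts\<close>, so \<open>N \<ge> 1\<close> and
      the multiplicity can only help.\<close>
    also have "\<dots> \<le> 1 * mat_opnorm (colour_class n \<kappa> u) (colour_class n \<kappa> v) (\<lambda>i j. N * coloured_matrix n \<kappa> \<xi> i j)"
      using N by (intro mult_right_mono mat_opnorm_nonneg) auto
    also have "\<dots> = mat_opnorm (colour_class n \<kappa> u) (colour_class n \<kappa> v) (\<lambda>i j. sE ?T (\<lambda>\<epsilon>. (\<Prod>e\<in>E. \<epsilon> e) * ?K (?fl \<epsilon> \<xi>) i j))"
      unfolding mult_1 by (rule mat_opnorm_cong) (simp add: proj)
    also have "\<dots> \<le> mat_opnorm ?R ?R (\<lambda>i j. sE ?T (\<lambda>\<epsilon>. (\<Prod>e\<in>E. \<epsilon> e) * ?K (?fl \<epsilon> \<xi>) i j))"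
      by (rule mat_opnorm_submatrix) (use fc in auto)
    also have "\<dots> \<le> sE ?T (\<lambda>\<epsilon>. mat_opnorm ?R ?R (\<lambda>i j. (\<Prod>e\<in>E. \<epsilon> e) * ?K (?fl \<epsilon> \<xi>) i j))"
      by (rule mat_opnorm_sE_le) (use finT in auto)
    also have "\<dots> \<le> sE ?T (\<lambda>\<epsilon>. mat_opnorm ?R ?R (?K (?fl \<epsilon> \<xi>)))"
    proof (rule sE_mono[OF finT])
      fix \<epsilon> assume \<epsilon>: "\<epsilon> \<in> signs ?T"
      have "\<bar>\<Prod>e\<in>E. \<epsilon> e\<bar> = 1" unfolding abs_prod
        by (intro prod.neutral ballI signs_abs[OF \<epsilon>]) (use EW in auto)
      then show "mat_opnorm ?R ?R (\<lambda>i j. (\<Prod>e\<in>E. \<epsilon> e) * ?K (?fl \<epsilon> \<xi>) i j) \<le> mat_opnorm ?R ?R (?K (?fl \<epsilon> \<xi>))"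
        using mat_opnorm_cmult_le[of ?R ?R "\<Prod>e\<in>E. \<epsilon> e" "?K (?fl \<epsilon> \<xi>)"] by simp
    qed
    finally show "mat_opnorm (colour_class n \<kappa> u) (colour_class n \<kappa> v) (coloured_matrix n \<kappa> \<xi>) \<le> sE ?T (\<lambda>\<epsilon>. mat_opnorm ?R ?R (?K (?fl \<epsilon> \<xi>)))" .
  qed
  also have "\<dots> = sE ?T (\<lambda>\<epsilon>. sE ?Pn (\<lambda>\<xi>. mat_opnorm ?R ?R (?K (?fl \<epsilon> \<xi>))))"
    by (rule sE_swap[OF finP finT])
  also have "\<dots> = sE ?T (\<lambda>\<epsilon>. sE ?Pn (\<lambda>\<xi>. mat_opnorm ?R ?R (?K \<xi>)))"
  proof (rule sE_cong[OF finT])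
    fix \<epsilon> assume \<epsilon>: "\<epsilon> \<in> signs ?T"
    show "sE ?Pn (\<lambda>\<xi>. mat_opnorm ?R ?R (?K (?fl \<epsilon> \<xi>))) = sE ?Pn (\<lambda>\<xi>. mat_opnorm ?R ?R (?K \<xi>))"
    proof (rule sE_flip[OF finP, of "\<lambda>p. \<epsilon> (\<kappa> ` p)" "\<lambda>\<xi>. mat_opnorm ?R ?R (?K \<xi>)"])
      fix p assume "p \<in> ?Pn"
      then have "\<kappa> ` p \<in> ?T" using \<kappa> by (auto simp: unordered_pairs_def)
      then show "\<epsilon> (\<kappa> ` p) = -1 \<or> \<epsilon> (\<kappa> ` p) = 1" by (rule signsD[OF \<epsilon>])
    qed
  qed
  also have "\<dots> = inj_expected_norm W E u v n" by (simp add: inj_expected_norm_def sE_def)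
  finally show ?thesis .
qed

text \<open>Labels are coloured by residues modulo \<open>card W\<close>; since
  \<open>2 * card W \<le> n\<close>, rounding the quotient down loses at most a factor 2.\<close>

lemma balanced_colouring:
  assumes n: "2 * card W \<le> n"
  obtains \<kappa> where "\<kappa> \<in> {1..n} \<rightarrow> W" "\<And>x. x \<in> W \<Longrightarrow> real n / (2 * real (card W)) \<le> real (card (colour_class n \<kappa> x))"
proof -
  define w where "w = card W"
  have w: "w > 0" using uv finW by (auto simp: w_def card_gt_0_iff)
  obtain f where f: "bij_betw f {0..<w} W" using ex_bij_betw_nat_finite[OF finW] unfolding w_def by blast
  show thesis
  proof (rule that[of "\<lambda>i. f (i mod w)"])
    show "(\<lambda>i. f (i mod w)) \<in> {1..n} \<rightarrow> W" using f w by (auto simp: bij_betw_def)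
    fix x assume "x \<in> W"
    then obtain k where k: "k < w" "f k = x" using f by (auto simp: bij_betw_def)
    \<comment> \<open>The representative of the residue is taken in \<open>{1..w}\<close> because
      labels start at 1.\<close>
    define s where "s = (if k = 0 then w else k)"
    have s: "1 \<le> s" "s \<le> w" "s mod w = k" using k w by (auto simp: s_def)
    have "(\<lambda>t. t * w + s) ` {..<n div w} \<subseteq> colour_class n (\<lambda>i. f (i mod w)) x"
    proof
      fix i assume "i \<in> (\<lambda>t. t * w + s) ` {..<n div w}"
      then obtain t where t: "t < n div w" "i = t * w + s" by auto
      have "i \<le> (t + 1) * w" using t s by simp
      also have "\<dots> \<le> n div w * w" using t by (intro mult_right_mono) auto
      also have "\<dots> \<le> n" by simp
      finally show "i \<in> colour_class n (\<lambda>i. f (i mod w)) x" using t s k by (simp add: colour_class_def)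
    qed
    then have "card ((\<lambda>t. t * w + s) ` {..<n div w}) \<le> card (colour_class n (\<lambda>i. f (i mod w)) x)"
      by (intro card_mono) (auto simp: colour_class_def)
    moreover have "card ((\<lambda>t. t * w + s) ` {..<n div w}) = n div w"
      using w by (subst card_image) (auto simp: inj_on_def)
    ultimately have c: "real (n div w) \<le> real (card (colour_class n (\<lambda>i. f (i mod w)) x))" by simp
    have "n < (n div w + 1) * w" using w by (metis Suc_eq_plus1 dividend_less_div_times mult.commute mult_Suc_right)
    then have "real n < (real (n div w) + 1) * real w" by (metis of_nat_1 of_nat_add of_nat_less_iff of_nat_mult)
    moreover have "2 * real w \<le> real n" using n by (simp add: w_def)
    ultimately have "real n \<le> real (n div w) * (2 * real w)" by (simp add: algebra_simps)
    then have "real n / (2 * real w) \<le> real (n div w)" using w by (simp add: field_simps)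
    then show "real n / (2 * real (card W)) \<le> real (card (colour_class n (\<lambda>i. f (i mod w)) x))"
      using c by (simp add: w_def)
  qed
qed

end

section \<open>Separators of the decorated chain\<close>

lemma chain_verts_eq:
  "chain_verts L q = Spine ` {..Suc L} \<union> (\<lambda>(j, k). Leaf j k) ` (SIGMA j:{1..L}. {..<q j})"
  by (auto simp: chain_verts_def image_iff)

lemma card_chain_verts: "card (chain_verts L q) = L + 2 + sum q {1..L}"
proof -
  have "card (chain_verts L q) = card (Spine ` {..Suc L}) + card ((\<lambda>(j, k). Leaf j k) ` (SIGMA j:{1..L}. {..<q j}))"
    unfolding chain_verts_eq by (rule card_Un_disjoint) auto
  also have "card (Spine ` {..Suc L}) = L + 2" by (simp add: card_image inj_on_def)
  also have "card ((\<lambda>(j, k). Leaf j k) ` (SIGMA j:{1..L}. {..<q j})) = sum q {1..L}"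
    by (subst card_image) (auto simp: inj_on_def)
  finally show ?thesis .
qed

lemma card_chain_edges: "card (chain_edges L q) = L + 1 + sum q {1..L}"
proof -
  have eq: "chain_edges L q = (\<lambda>j. {Spine j, Spine (Suc j)}) ` {..L} \<union> (\<lambda>(j, k). {Spine j, Leaf j k}) ` (SIGMA j:{1..L}. {..<q j})"
    unfolding chain_edges_eq by auto
  have "card (chain_edges L q) = card ((\<lambda>j. {Spine j, Spine (Suc j)}) ` {..L}) + card ((\<lambda>(j, k). {Spine j, Leaf j k}) ` (SIGMA j:{1..L}. {..<q j}))"
    unfolding eq by (rule card_Un_disjoint) (auto simp: doubleton_eq_iff)
  also have "card ((\<lambda>j. {Spine j, Spine (Suc j)}) ` {..L}) = L + 1"
    by (subst card_image) (auto simp: inj_on_def doubleton_eq_iff)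
  also have "card ((\<lambda>(j, k). {Spine j, Leaf j k}) ` (SIGMA j:{1..L}. {..<q j})) = sum q {1..L}"
    by (subst card_image) (auto simp: inj_on_def doubleton_eq_iff)
  finally show ?thesis .
qed

lemma spine_edge: "j \<le> L \<Longrightarrow> {Spine j, Spine (Suc j)} \<in> chain_edges L q"
  by (auto simp: chain_edges_def)

lemma leaf_edge: "1 \<le> j \<Longrightarrow> j \<le> L \<Longrightarrow> k < q j \<Longrightarrow> {Spine j, Leaf j k} \<in> chain_edges L q"
  unfolding chain_edges_def by blast

lemma chain_cover: "\<Union>(chain_edges L q) = chain_verts L q"
proof
  show "\<Union>(chain_edges L q) \<subseteq> chain_verts L q" using chain_edges_subset by blast
  show "chain_verts L q \<subseteq> \<Union>(chain_edges L q)"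
  proof
    fix x assume x: "x \<in> chain_verts L q"
    show "x \<in> \<Union>(chain_edges L q)"
    proof (cases x)
      case (Spine j)
      show ?thesis
      proof (cases "j \<le> L")
        case True then show ?thesis using spine_edge[OF True, of q] Spine by blast
      next
        case False
        then have "j = Suc L" using x Spine by (auto simp: chain_verts_def)
        then show ?thesis using spine_edge[of L L q] Spine by blast
      qed
    next
      case (Leaf j k)
      then have "1 \<le> j" "j \<le> L" "k < q j" using x by (auto simp: chain_verts_def)
      from leaf_edge[of j L k q, OF this] Leaf show ?thesis by blast
    qed
  qed
qed

lemma graph_path_spine_up:
  assumes "i \<le> j" "\<And>k. i \<le> k \<Longrightarrow> k \<le> j \<Longrightarrow> Spine k \<in> W" "\<And>k. i \<le> k \<Longrightarrow> k < j \<Longrightarrow> {Spine k, Spine (Suc k)} \<in> E"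
  shows "graph_path W E (map Spine [i..<Suc j])"
  unfolding graph_path_def successively_conv_nth
  using assms by (auto simp: distinct_map inj_on_def simp del: upt_Suc)

lemma graph_path_rev: "graph_path W E p \<Longrightarrow> graph_path W E (rev p)"
  unfolding graph_path_def by (auto simp: insert_commute)

lemma graph_path_spine_down:
  assumes "i \<le> j" "\<And>k. i \<le> k \<Longrightarrow> k \<le> j \<Longrightarrow> Spine k \<in> W" "\<And>k. i \<le> k \<Longrightarrow> k < j \<Longrightarrow> {Spine k, Spine (Suc k)} \<in> E"
  shows "graph_path W E (rev (map Spine [i..<Suc j]))"
  by (rule graph_path_rev[OF graph_path_spine_up[OF assms]])

lemma graph_path_Cons:
  assumes "graph_path W E p" "x \<in> W" "x \<notin> set p" "{x, hd p} \<in> E"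
  shows "graph_path W E (x # p)"
  using assms unfolding graph_path_def by (cases p) auto

lemma hd_last_spine:
  "i \<le> j \<Longrightarrow> hd (map Spine [i..<Suc j]) = Spine i" "i \<le> j \<Longrightarrow> last (map Spine [i..<Suc j]) = Spine j"
  by (simp_all add: hd_map last_map del: upt_Suc)

fun level :: "role \<Rightarrow> nat" where
  "level (Spine j) = j" | "level (Leaf j k) = j"

text \<open>Step to the spine, then walk along it to one end. \<open>J\<close> lists the spine
  indices on the way, so the lemma serves both the whole chain and the chain with one spine vertex
  removed.\<close>

lemma exists_path_to_end:
  assumes W: "\<And>k. k \<in> J \<Longrightarrow> Spine k \<in> W" and E: "\<And>k. k \<in> J \<Longrightarrow> Suc k \<in> J \<Longrightarrow> {Spine k, Spine (Suc k)} \<in> E"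
    and x: "x \<in> W" "\<And>j k. x = Leaf j k \<Longrightarrow> {Leaf j k, Spine j} \<in> E"
    and J: "J = {0..level x} \<and> b = 0 \<or> J = {level x..b} \<and> level x \<le> b"
  shows "\<exists>p. graph_path W E p \<and> hd p = x \<and> last p = Spine b"
proof -
  let ?l = "level x"
  have "\<exists>p. graph_path W E p \<and> hd p = Spine ?l \<and> last p = Spine b \<and> set p \<subseteq> range Spine"
  proof (cases "J = {0..?l} \<and> b = 0")
    case True
    then have "graph_path W E (rev (map Spine [0..<Suc ?l]))"
      by (intro graph_path_spine_down W E) auto
    then show ?thesis using True hd_last_spine[of 0 ?l]
      by (intro exI[of _ "rev (map Spine [0..<Suc ?l])"]) (auto simp: hd_rev last_rev simp del: upt_Suc)
  next
    case False
    then have J': "J = {?l..b}" "?l \<le> b" using J by auto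
    then have "graph_path W E (map Spine [?l..<Suc b])"
      by (intro graph_path_spine_up W E) auto
    then show ?thesis using J' hd_last_spine[of ?l b]
      by (intro exI[of _ "map Spine [?l..<Suc b]"]) (auto simp del: upt_Suc)
  qed
  then obtain p where p: "graph_path W E p" "hd p = Spine ?l" "last p = Spine b" "set p \<subseteq> range Spine" by blast
  show ?thesis
  proof (cases x)
    case (Spine j)
    then show ?thesis using p by auto
  next
    case (Leaf j k)
    then have "graph_path W E (x # p)" using p x by (intro graph_path_Cons) auto
    moreover have "p \<noteq> []" using p(1) by (simp add: graph_path_def)
    ultimately show ?thesis using p by (intro exI[of _ "x # p"]) auto
  qed
qed

lemma level_le: "x \<in> chain_verts L q \<Longrightarrow> level x \<le> Suc L"
  by (auto simp: chain_verts_def)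

lemma Spine_in: "k \<le> Suc L \<Longrightarrow> Spine k \<in> chain_verts L q"
  by (auto simp: chain_verts_def)

lemma leaf_edge': "Leaf j k \<in> chain_verts L q \<Longrightarrow> {Leaf j k, Spine j} \<in> chain_edges L q"
  using leaf_edge[of j L k q] by (auto simp: chain_verts_def insert_commute)

lemma no_detached: "\<not> detached_component (chain_verts L q) (chain_edges L q) {Spine 0} V K"
proof
  let ?W = "chain_verts L q" and ?E = "chain_edges L q"
  assume "detached_component ?W ?E {Spine 0} V K"
  then obtain x where x: "x \<in> ?W" "K = {y. \<exists>p. graph_path ?W ?E p \<and> hd p = x \<and> last p = y}" "Spine 0 \<notin> K"
    by (auto simp: detached_component_def graph_components_def quotient_def)
  have "\<exists>p. graph_path ?W ?E p \<and> hd p = x \<and> last p = Spine 0"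
    by (rule exists_path_to_end[where J="{0..level x}"])
      (use x level_le[OF x(1)] in \<open>auto intro: Spine_in spine_edge leaf_edge'\<close>)
  then show False using x by blast
qed

lemma no_isolated: "\<not> isolated_middle (chain_verts L q) (chain_edges L q) U V x"
  unfolding isolated_middle_def using chain_cover[of L q] by blast

lemma chain_edge_cases:
  assumes "{x, y} \<in> chain_edges L q"
  obtains j where "x = Spine j" "y = Spine (Suc j)" | j where "y = Spine j" "x = Spine (Suc j)"
  | j k where "x = Spine j" "y = Leaf j k" | j k where "y = Spine j" "x = Leaf j k"
  using assms unfolding chain_edges_def by (auto simp: doubleton_eq_iff)

text \<open>A discrete intermediate value argument: the level changes by at most one per edge and
  only between spine vertices, so the step beyond level \<open>j\<close> must leave from
  \<open>Spine j\<close>.\<close>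

lemma path_meets_spine:
  assumes "successively (\<lambda>x y. {x, y} \<in> chain_edges L q) p" "p \<noteq> []" "level (hd p) \<le> j" "last p = Spine b" "j \<le> b"
  shows "Spine j \<in> set p"
  using assms
proof (induction p rule: induct_list012)
  case (3 x y p)
  show ?case
  proof (cases "level y \<le> j")
    case True
    then have "Spine j \<in> set (y # p)" using 3 by (intro "3.IH"(2)) auto
    then show ?thesis by simp
  next
    case False
    have "{x, y} \<in> chain_edges L q" using 3 by simp
    then show ?thesis using False "3.prems"(3) by (cases rule: chain_edge_cases) (auto simp: le_antisym)
  qed
qed auto

lemma spine_separator:
  assumes "j \<le> Suc L"
  shows "is_separator (chain_verts L q) (chain_edges L q) {Spine 0} {Spine (Suc L)} {Spine j}"
  unfolding is_separator_def
proof (intro conjI allI impI)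
  show "{Spine j} \<subseteq> chain_verts L q" using Spine_in[OF assms] by auto
  fix p assume "graph_path (chain_verts L q) (chain_edges L q) p \<and> hd p \<in> {Spine 0} \<and> last p \<in> {Spine (Suc L)}"
  then have "Spine j \<in> set p"
    using assms by (intro path_meets_spine[of L q p j "Suc L"]) (auto simp: graph_path_def)
  then show "set p \<inter> {Spine j} \<noteq> {}" by blast
qed

lemma separator_meets_spine:
  assumes "is_separator (chain_verts L q) (chain_edges L q) {Spine 0} {Spine (Suc L)} S"
  shows "\<exists>j\<le>Suc L. Spine j \<in> S"
proof -
  let ?p = "map Spine [0..<Suc (Suc L)]"
  have "graph_path (chain_verts L q) (chain_edges L q) ?p"
    by (rule graph_path_spine_up) (auto intro: Spine_in spine_edge)
  moreover have "hd ?p \<in> {Spine 0}" "last ?p \<in> {Spine (Suc L)}"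
    using hd_last_spine[of 0 "Suc L"] by (simp_all del: upt_Suc)
  ultimately have "set ?p \<inter> S \<noteq> {}"
    using assms unfolding is_separator_def by blast
  then show ?thesis by (auto simp: less_Suc_eq_le simp del: upt_Suc)
qed

lemma chain_min_separator_size:
  "min_separator_size (chain_verts L q) (chain_edges L q) {Spine 0} {Spine (Suc L)} = 1"
  unfolding min_separator_size_def
proof (rule Min_eqI)
  let ?S = "{S. is_separator (chain_verts L q) (chain_edges L q) {Spine 0} {Spine (Suc L)} S}"
  have "?S \<subseteq> Pow (chain_verts L q)" by (auto simp: is_separator_def)
  then show "finite (card ` ?S)" using finite_chain_verts finite_subset by blast
  show "1 \<le> y" if y: "y \<in> card ` ?S" for y
  proof -
    obtain S where S: "S \<in> ?S" "y = card S" using y by blast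
    have "finite S" using S finite_chain_verts[of L q] finite_subset by (auto simp: is_separator_def)
    moreover have "S \<noteq> {}" using separator_meets_spine[of L q S] S by auto
    ultimately show ?thesis using S by (simp add: Suc_le_eq card_gt_0_iff)
  qed
  have "{Spine 0} \<in> ?S" using spine_separator[of 0 L q] by simp
  then show "1 \<in> card ` ?S" by (intro image_eqI[of _ _ "{Spine 0}"]) auto
qed

lemma chain_min_separators:
  "min_separators (chain_verts L q) (chain_edges L q) {Spine 0} {Spine (Suc L)} = (\<lambda>j. {Spine j}) ` {..Suc L}"
proof (intro set_eqI iffI)
  fix S assume "S \<in> min_separators (chain_verts L q) (chain_edges L q) {Spine 0} {Spine (Suc L)}"
  then have S: "is_separator (chain_verts L q) (chain_edges L q) {Spine 0} {Spine (Suc L)} S" "card S = 1"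
    by (auto simp: min_separators_def chain_min_separator_size)
  obtain j where j: "j \<le> Suc L" "Spine j \<in> S" using separator_meets_spine[OF S(1)] by blast
  obtain x where "S = {x}" using card_1_singletonE[OF S(2)] by blast
  then show "S \<in> (\<lambda>j. {Spine j}) ` {..Suc L}" using j by auto
next
  fix S assume "S \<in> (\<lambda>j. {Spine j}) ` {..Suc L}"
  then show "S \<in> min_separators (chain_verts L q) (chain_edges L q) {Spine 0} {Spine (Suc L)}"
    using spine_separator by (auto simp: min_separators_def chain_min_separator_size)
qed

text \<open>Removing \<open>Spine j\<close> isolates exactly its own leaves. Every other vertex lies
  strictly to one side of level \<open>j\<close> and still reaches the end of the chain on that
  side, so its component is not counted.\<close>

lemma chain_active_count:
  assumes j: "j \<le> Suc L"
  shows "active_count (chain_verts L q) (chain_edges L q) {Spine 0} {Spine (Suc L)} {Spine j}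
    = (if 1 \<le> j \<and> j \<le> L then q j else 0)"
proof -
  let ?W = "chain_verts L q" and ?E = "chain_edges L q"
  define W' where "W' = ?W - {Spine j}"
  define E' where "E' = {e \<in> ?E. e \<inter> {Spine j} = {}}"
  define lv where "lv = {Leaf j k | k. 1 \<le> j \<and> j \<le> L \<and> k < q j}"
  define cmp where "cmp x = {y. \<exists>p. graph_path W' E' p \<and> hd p = x \<and> last p = y}" for x
  have leaf: "cmp x = {x}" if "x \<in> lv" for x
  proof -
    obtain k where x: "x = Leaf j k" "1 \<le> j" "j \<le> L" "k < q j" using \<open>x \<in> lv\<close> by (auto simp: lv_def)
    then have xW: "x \<in> W'" by (auto simp: W'_def chain_verts_def)
    have "last p = x" if "graph_path W' E' p" "hd p = x" for p
    proof (cases p)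
      case (Cons a p')
      show ?thesis
      proof (cases p')
        case (Cons b p'')
        then have "{Leaf j k, b} \<in> E'" using that \<open>p = a # p'\<close> x by (auto simp: graph_path_def)
        then have "{Leaf j k, b} \<in> ?E" "b \<noteq> Spine j" by (auto simp: E'_def)
        then show ?thesis by (auto elim: chain_edge_cases)
      qed (use that Cons in auto)
    qed (use that in \<open>auto simp: graph_path_def\<close>)
    moreover have "graph_path W' E' [x]" using xW by (simp add: graph_path_def)
    then have "x \<in> cmp x" unfolding cmp_def by force
    ultimately show ?thesis by (auto simp: cmp_def)
  qed
  have other: "cmp x \<inter> ({Spine 0} \<union> {Spine (Suc L)}) \<noteq> {}" if x: "x \<in> W'" "x \<notin> lv" for x
  proof -
    have xW: "x \<in> ?W" "x \<noteq> Spine j" using x by (auto simp: W'_def)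
    have lx: "level x \<noteq> j" using x by (cases x) (auto simp: W'_def lv_def chain_verts_def)
    have le: "level x \<le> Suc L" by (rule level_le[OF xW(1)])
    have ed: "{Leaf i k, Spine i} \<in> E'" if "x = Leaf i k" for i k
      using leaf_edge'[of i k L q] xW lx that by (auto simp: E'_def)
    show ?thesis
    proof (cases "level x < j")
      case True
      have "\<exists>p. graph_path W' E' p \<and> hd p = x \<and> last p = Spine 0"
        by (rule exists_path_to_end[where J="{0..level x}"])
          (use True x le ed in \<open>auto simp: W'_def E'_def intro: Spine_in spine_edge\<close>)
      then show ?thesis by (auto simp: cmp_def)
    next
      case False
      have "\<exists>p. graph_path W' E' p \<and> hd p = x \<and> last p = Spine (Suc L)"
        by (rule exists_path_to_end[where J="{level x..Suc L}"])
          (use False lx x le ed in \<open>auto simp: W'_def E'_def intro: Spine_in spine_edge\<close>)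
      then show ?thesis by (auto simp: cmp_def)
    qed
  qed
  have comps: "graph_components W' E' = cmp ` W'"
    by (auto simp: graph_components_def quotient_def cmp_def)
  have "{K \<in> graph_components W' E'. K \<inter> ({Spine 0} \<union> {Spine (Suc L)}) = {} \<and> (\<exists>x\<in>K. \<exists>s\<in>{Spine j}. {x, s} \<in> ?E)}
    = (\<lambda>x. {x}) ` lv"
  proof (intro set_eqI iffI)
    fix K assume "K \<in> {K \<in> graph_components W' E'. K \<inter> ({Spine 0} \<union> {Spine (Suc L)}) = {} \<and> (\<exists>x\<in>K. \<exists>s\<in>{Spine j}. {x, s} \<in> ?E)}"
    then obtain x where x: "x \<in> W'" "K = cmp x" "K \<inter> ({Spine 0} \<union> {Spine (Suc L)}) = {}" unfolding comps by auto
    then have "x \<in> lv" using other by blast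
    then show "K \<in> (\<lambda>x. {x}) ` lv" using leaf x by auto
  next
    fix K assume "K \<in> (\<lambda>x. {x}) ` lv"
    then obtain x where x: "x \<in> lv" "K = {x}" by auto
    then have "x \<in> W'" by (auto simp: lv_def W'_def chain_verts_def)
    moreover have "{x, Spine j} \<in> ?E" using x leaf_edge'[of j _ L q] by (auto simp: lv_def chain_verts_def)
    moreover have "x \<noteq> Spine 0" "x \<noteq> Spine (Suc L)" using x by (auto simp: lv_def)
    ultimately show "K \<in> {K \<in> graph_components W' E'. K \<inter> ({Spine 0} \<union> {Spine (Suc L)}) = {} \<and> (\<exists>x\<in>K. \<exists>s\<in>{Spine j}. {x, s} \<in> ?E)}"
      using x leaf[OF x(1)] unfolding comps by auto
  qed
  then have "active_count ?W ?E {Spine 0} {Spine (Suc L)} {Spine j} = card ((\<lambda>x. {x}) ` lv)"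
    unfolding active_count_def W'_def E'_def by simp
  also have "\<dots> = card lv" by (rule card_image) auto
  also have "lv = (if 1 \<le> j \<and> j \<le> L then Leaf j ` {..<q j} else {})" by (auto simp: lv_def)
  also have "card \<dots> = (if 1 \<le> j \<and> j \<le> L then q j else 0)" by (simp add: card_image inj_on_def)
  finally show ?thesis .
qed

lemma chain_max_active_count:
  assumes "L \<ge> 1"
  shows "max_active_count (chain_verts L q) (chain_edges L q) {Spine 0} {Spine (Suc L)} = Max (q ` {1..L})"
  unfolding max_active_count_def chain_min_separators image_image
proof (rule Max_eqI)
  let ?a = "\<lambda>j. active_count (chain_verts L q) (chain_edges L q) {Spine 0} {Spine (Suc L)} {Spine j}"
  show "finite (?a ` {..Suc L})" by simp
  show "y \<le> Max (q ` {1..L})" if "y \<in> ?a ` {..Suc L}" for y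
    using that by (auto simp: chain_active_count intro: Max_ge)
  have "Max (q ` {1..L}) \<in> q ` {1..L}" using assms by (intro Max_in) auto
  then obtain j where "j \<in> {1..L}" "Max (q ` {1..L}) = q j" by auto
  then show "Max (q ` {1..L}) \<in> ?a ` {..Suc L}"
    by (intro image_eqI[of _ _ j]) (auto simp: chain_active_count)
qed

section \<open>Asymptotics of the expected norms\<close>

lemma chain_graph_model: "graph_model (chain_verts L q) (chain_edges L q) (Spine 0) (Spine (Suc L))"
proof
  show "card e = 2" if "e \<in> chain_edges L q" for e using that by (auto simp: chain_edges_def)
qed (auto simp: finite_chain_verts chain_cover intro: Spine_in)

lemma eventually_chain_size:
  "\<forall>\<^sub>F n in sequentially. real n \<ge> B \<and> ln (real n) \<ge> A \<and> n \<ge> 2"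
proof (intro eventually_conj)
  show "\<forall>\<^sub>F n in sequentially. real n \<ge> B"
    by (rule filterlim_at_top[THEN iffD1, rule_format, OF filterlim_real_sequentially])
  show "\<forall>\<^sub>F n in sequentially. ln (real n) \<ge> A"
    by (rule filterlim_at_top[THEN iffD1, rule_format, OF filterlim_compose[OF ln_at_top filterlim_real_sequentially]])
  show "\<forall>\<^sub>F n in sequentially. n \<ge> (2::nat)" by (rule eventually_ge_at_top)
qed

lemma typed_chain_rate:
  fixes c C :: "role \<Rightarrow> real"
  assumes "q (Suc L) = 0" "\<And>j. j \<le> Suc L \<Longrightarrow> q j \<le> q j0" "1 \<le> j0" "j0 \<le> L"
    and pos: "\<forall>x\<in>chain_verts L q. 0 < c x \<and> 0 < C x"
  shows "\<exists>a b :: real. 0 < a \<and> 0 < b \<and>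
    (\<forall>\<^sub>F n in sequentially. \<forall>I :: role \<Rightarrow> 'l set. balanced_labels (chain_verts L q) c C n I \<longrightarrow>
      a * chain_rate (L + 1 + sum q {1..L}) (q j0) n
        \<le> typed_expected_norm (chain_verts L q) (chain_edges L q) (Spine 0) (Spine (Suc L)) I \<and>
      typed_expected_norm (chain_verts L q) (chain_edges L q) (Spine 0) (Spine (Suc L)) I
        \<le> b * chain_rate (L + 1 + sum q {1..L}) (q j0) n)"
proof -
  let ?W = "chain_verts L q"
  let ?N = "\<lambda>I :: role \<Rightarrow> 'l set. typed_expected_norm ?W (chain_edges L q) (Spine 0) (Spine (Suc L)) I"
  let ?r = "chain_rate (L + 1 + sum q {1..L}) (q j0)"
  have W: "finite ?W" "?W \<noteq> {}" using finite_chain_verts Spine_in[of 0 L q] by auto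
  \<comment> \<open>The constants attached to the vertices are replaced by their extremes over the
    finite vertex set; the maximum with 1 meets the hypothesis of
    \<open>typed_upper\<close>.\<close>
  define c0 where "c0 = Min (c ` ?W)"
  define C0 where "C0 = max 1 (Max (C ` ?W))"
  have "c0 \<in> c ` ?W" unfolding c0_def using W by (intro Min_in) auto
  then have c0: "c0 > 0" using pos by auto
  have c0_le: "c0 \<le> c x" and C0_ge: "C x \<le> C0" if "x \<in> ?W" for x
    using that W by (auto simp: c0_def C0_def intro: Min_le max.coboundedI2)
  obtain b where b: "b > 0"
    "\<And>n I. real n \<ge> max 3 C0 \<Longrightarrow> (\<And>x. x \<in> ?W \<Longrightarrow> finite (I x) \<and> real (card (I x)) \<le> C0 * real n) \<Longrightarrow> ?N I \<le> b * ?r n"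
    using typed_upper[of q L "q j0" C0, where 'l='l] assms(1,2) by (auto simp: C0_def)
  obtain a A where a: "a > 0"
    "\<And>n I. ln (real n) \<ge> A \<Longrightarrow> n \<ge> 2 \<Longrightarrow> (\<And>x. x \<in> ?W \<Longrightarrow> finite (I x) \<and> c0 * real n \<le> real (card (I x))) \<Longrightarrow> a * ?r n \<le> ?N I"
    using typed_lower[of q L j0 c0, where 'l='l] assms c0 by blast
  have "\<forall>\<^sub>F n in sequentially. \<forall>I. balanced_labels ?W c C n I \<longrightarrow> a * ?r n \<le> ?N I \<and> ?N I \<le> b * ?r n"
    using eventually_chain_size[of "max 3 C0" A]
  proof eventually_elim
    case (elim n)
    show ?case
    proof (intro allI impI)
      fix I :: "role \<Rightarrow> 'l set" assume I: "balanced_labels ?W c C n I"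
      have fI: "finite (I x)" and lo: "c0 * real n \<le> real (card (I x))" and hi: "real (card (I x)) \<le> C0 * real n" if x: "x \<in> ?W" for x
      proof -
        have I': "finite (I x)" "c x * real n \<le> real (card (I x))" "real (card (I x)) \<le> C x * real n"
          using I x by (auto simp: balanced_labels_def)
        then show "finite (I x)" "c0 * real n \<le> real (card (I x))" "real (card (I x)) \<le> C0 * real n"
          using mult_right_mono[OF c0_le[OF x], of "real n"] mult_right_mono[OF C0_ge[OF x], of "real n"] by auto
      qed
      show "a * ?r n \<le> ?N I \<and> ?N I \<le> b * ?r n"
        using elim fI lo hi by (intro conjI a(2) b(2)) auto
    qed
  qed
  then show ?thesis using a(1) b(1) by blast
qed

text \<open>From above, all colour classes have at most \<open>n\<close> elements; from below, a
  single balanced colouring suffices, with class constant \<open>1 / (2 * w)\<close>.\<close>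

lemma inj_chain_rate:
  assumes "q (Suc L) = 0" "\<And>j. j \<le> Suc L \<Longrightarrow> q j \<le> q j0" "1 \<le> j0" "j0 \<le> L"
  shows "(\<lambda>n. inj_expected_norm (chain_verts L q) (chain_edges L q) (Spine 0) (Spine (Suc L)) n)
    \<in> \<Theta>(chain_rate (L + 1 + sum q {1..L}) (q j0))"
proof -
  let ?W = "chain_verts L q"
  interpret graph_model ?W "chain_edges L q" "Spine 0" "Spine (Suc L)" by (rule chain_graph_model)
  let ?r = "chain_rate (L + 1 + sum q {1..L}) (q j0)"
  define w where "w = real (card ?W)"
  have w: "w > 0" using Spine_in[of 0 L q] finite_chain_verts by (auto simp: w_def card_gt_0_iff)
  let ?N = "\<lambda>I :: role \<Rightarrow> nat set. typed_expected_norm ?W (chain_edges L q) (Spine 0) (Spine (Suc L)) I"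
  let ?J = "inj_expected_norm ?W (chain_edges L q) (Spine 0) (Spine (Suc L))"
  obtain b where b: "b > 0"
    "\<And>n I. real n \<ge> max 3 1 \<Longrightarrow> (\<And>x. x \<in> ?W \<Longrightarrow> finite (I x) \<and> real (card (I x)) \<le> 1 * real n) \<Longrightarrow> ?N I \<le> b * ?r n"
    using typed_upper[of q L "q j0" 1, where 'l=nat] assms(1,2) by auto
  obtain a A where a: "a > 0"
    "\<And>n I. ln (real n) \<ge> A \<Longrightarrow> n \<ge> 2 \<Longrightarrow> (\<And>x. x \<in> ?W \<Longrightarrow> finite (I x) \<and> 1 / (2 * w) * real n \<le> real (card (I x))) \<Longrightarrow> a * ?r n \<le> ?N I"
    using typed_lower[of q L j0 "1 / (2 * w)", where 'l=nat] assms w by auto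
  have "\<forall>\<^sub>F n in sequentially. a * ?r n \<le> ?J n \<and> ?J n \<le> (w ^ card ?W * b) * ?r n \<and> 0 \<le> ?r n \<and> 0 \<le> ?J n"
    using eventually_chain_size[of "max 3 (2 * w)" A]
  proof eventually_elim
    case (elim n)
    then have n: "2 * card ?W \<le> n" by (simp add: w_def)
    have "?J n \<le> w ^ card ?W * (b * ?r n)"
      unfolding w_def
    proof (rule inj_expected_norm_upper)
      fix \<kappa> show "?N (colour_class n \<kappa>) \<le> b * ?r n"
      proof (rule b(2))
        fix x
        have "card (colour_class n \<kappa> x) \<le> card {1..n}" by (intro card_mono) (auto simp: colour_class_def)
        then show "finite (colour_class n \<kappa> x) \<and> real (card (colour_class n \<kappa> x)) \<le> 1 * real n" by (auto simp: colour_class_def)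
      qed (use elim in auto)
    qed (use n in simp)
    moreover have "a * ?r n \<le> ?J n"
    proof -
      obtain \<kappa> where k: "\<kappa> \<in> {1..n} \<rightarrow> ?W" "\<And>x. x \<in> ?W \<Longrightarrow> real n / (2 * w) \<le> real (card (colour_class n \<kappa> x))"
        using balanced_colouring[OF n] unfolding w_def by blast
      have "a * ?r n \<le> ?N (colour_class n \<kappa>)"
        using elim k(2) by (intro a(2)) (auto simp: colour_class_def)
      also have "\<dots> \<le> ?J n" by (rule inj_expected_norm_lower[OF k(1)])
      finally show ?thesis .
    qed
    moreover have r0: "0 \<le> ?r n" unfolding chain_rate_def by simp
    moreover have "0 \<le> a * ?r n" using a(1) r0 by simp
    ultimately show ?case by simp
  qed
  then show ?thesis using a(1) b(1) w
    by (intro bigthetaI'[of a "w ^ card ?W * b"]) (auto elim!: eventually_mono)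
qed

theorem proposition2p8:
  fixes L :: nat and q :: "nat \<Rightarrow> nat"
  assumes "L \<ge> 1"
  defines "W \<equiv> chain_verts L q"
    and "E \<equiv> chain_edges L q"
    and "u \<equiv> Spine 0"
    and "v \<equiv> Spine (L + 1)"
    and "Q \<equiv> (\<Sum>j=1..L. q j)"
    and "qmax \<equiv> Max (q ` {1..L})"
  defines "rate \<equiv> (\<lambda>n::nat. real n powr (real (L + 1 + Q) / 2) * ln (real n) powr (real qmax / 2))"
  shows "card W = L + 2 + Q
    \<and> card E = L + 1 + Q
    \<and> (\<nexists>x. isolated_middle W E {u} {v} x)
    \<and> (\<nexists>K. detached_component W E {u} {v} K)
    \<and> min_separator_size W E {u} {v} = 1
    \<and> max_active_count W E {u} {v} = qmax
    \<and> (\<lambda>n. inj_expected_norm W E u v n) \<in> \<Theta>(rate)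
    \<and> (\<forall>c C :: role \<Rightarrow> real. (\<forall>x\<in>W. 0 < c x \<and> 0 < C x) \<longrightarrow>
         (\<exists>a b :: real. 0 < a \<and> 0 < b \<and>
           (\<forall>\<^sub>F n in sequentially. \<forall>I :: role \<Rightarrow> 'l set. balanced_labels W c C n I \<longrightarrow>
              a * rate n \<le> typed_expected_norm W E u v I \<and>
              typed_expected_norm W E u v I \<le> b * rate n)))"
proof -
  \<comment> \<open>The values of \<open>q\<close> outside \<open>{1..L}\<close> are arbitrary.
    Truncation leaves the graph and \<open>Q\<close> unchanged, yields
    \<open>q' (Suc L) = 0\<close>, and makes the maximum over \<open>{1..L}\<close> dominate every
    level.\<close>
  define q' where "q' j = (if 1 \<le> j \<and> j \<le> L then q j else 0)" for j
  have "qmax \<in> q ` {1..L}" unfolding qmax_def using assms(1) by (intro Max_in) auto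
  then obtain j0 where j0: "1 \<le> j0" "j0 \<le> L" "qmax = q' j0" by (auto simp: q'_def)
  have q'le: "q' j \<le> q' j0" for j
  proof -
    have "q' j \<le> qmax" by (simp add: q'_def qmax_def)
    then show ?thesis by (simp only: j0(3))
  qed
  have q'0: "q' (Suc L) = 0" by (simp add: q'_def)
  have sumq: "sum q' {1..L} = Q" unfolding Q_def by (intro sum.cong) (auto simp: q'_def)
  have W': "chain_verts L q' = W" unfolding W_def chain_verts_def q'_def by auto
  have E': "chain_edges L q' = E" unfolding E_def chain_edges_def q'_def by auto
  have rate: "rate = chain_rate (L + 1 + sum q' {1..L}) (q' j0)"
    by (rule ext) (simp only: rate_def chain_rate_def sumq j0(3))
  have vv: "v = Spine (Suc L)" by (simp add: v_def)
  show ?thesis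
  proof (intro conjI allI impI)
    show "card W = L + 2 + Q" unfolding W_def Q_def by (rule card_chain_verts)
    show "card E = L + 1 + Q" unfolding E_def Q_def by (rule card_chain_edges)
    show "\<nexists>x. isolated_middle W E {u} {v} x" unfolding W_def E_def by (simp add: no_isolated)
    show "\<nexists>K. detached_component W E {u} {v} K" unfolding W_def E_def u_def by (simp add: no_detached)
    show "min_separator_size W E {u} {v} = 1" unfolding W_def E_def u_def vv by (rule chain_min_separator_size)
    show "max_active_count W E {u} {v} = qmax"
      unfolding W_def E_def u_def vv qmax_def by (rule chain_max_active_count[OF assms(1)])
    show "(\<lambda>n. inj_expected_norm W E u v n) \<in> \<Theta>(rate)"
      unfolding rate vv u_def using inj_chain_rate[of q' L j0, OF q'0 q'le j0(1,2)] by (simp add: W' E')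
    fix c C :: "role \<Rightarrow> real" assume pos: "\<forall>x\<in>W. 0 < c x \<and> 0 < C x"
    show "\<exists>a b :: real. 0 < a \<and> 0 < b \<and>
           (\<forall>\<^sub>F n in sequentially. \<forall>I :: role \<Rightarrow> 'l set. balanced_labels W c C n I \<longrightarrow>
              a * rate n \<le> typed_expected_norm W E u v I \<and>
              typed_expected_norm W E u v I \<le> b * rate n)"
      unfolding rate vv u_def
      using typed_chain_rate[of q' L j0 c C, OF q'0 q'le j0(1,2), where 'l='l] pos by (simp add: W' E')
  qed
qed

end
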